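(* There is a constant $C>0$ (independent of $V$ and $k$) such that the following holds for every potential $V:\mathbb{R}^2\to\mathbb{C}^{2\times 2}$ as in the context. If $k\in\mathbb{C}\setminus\mathbb{R}$ is an eigenvalue of the operator $D=D_0+V$, then $$ C\left(\bigl|\ln|k|\bigr|\sup_{x\in\mathbb{R}^2}\int_{|x-y|<(2|k|)^{-1}}|V(y)|\,dy+\sup_{x\in\mathbb{R}^2}\int_{\mathbb{R}^2}\bigl(1+\bigl|\ln|x-y|\bigr|\bigr)|V(y)|\,dy\right)+3C\int_{\mathbb{R}^2}|V(x)|\,dx\ge 1 . $$
   Context: $D_0$ is the operator in $L^2(\mathbb{R}^2;\mathbb{C}^2)$ with domain the Sobolev space $\mathcal{H}^2(\mathbb{R}^2;\mathbb{C}^2)$ given by $$ D_0=\begin{pmatrix} 0 & 4\partial_{\bar z}^2\\ 4\partial_z^2 & 0\end{pmatrix},\qquad \partial_{\bar z}=\tfrac12\Bigl(\tfrac{\partial}{\partial x_1}+\tfrac1i\tfrac{\partial}{\partial x_2}\Bigr),\qquad \partial_z=\tfrac12\Bigl(\tfrac{\partial}{\partial x_1}-\tfrac1i\tfrac{\partial}{\partial x_2}\Bigr). $$ Its spectrum is $\mathbb{R}$. The potential $V=(V_{i,j})_{i,j=1,2}$ is a measurable function with values in the complex $2\times2$ matrices, not necessarily self-adjoint, and $|V(x)|=\bigl(\sum_{i,j=1,2}|V_{i,j}(x)|^2\bigr)^{1/2}$. The operator $D=D_0+V$ acts in $L^2(\mathbb{R}^2;\mathbb{C}^2)$ with domain $\mathcal{H}^2(\mathbb{R}^2;\mathbb{C}^2)$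 (so $V$ is such that $Vu\in L^2$ for all $u\in\mathcal{H}^2$). A number $k\in\mathbb{C}$ is an eigenvalue of $D$ if $Du=ku$ for some nonzero $u\in\mathcal{H}^2(\mathbb{R}^2;\mathbb{C}^2)$. The integrals of $|V|$ are allowed to be $+\infty$, in which case the inequality is trivial. *)

theory Defs
  imports "HOL-Analysis.Analysis"
begin

section \<open>Weak derivatives and Sobolev spaces on Euclidean space\<close>

definition pderiv_dir :: "'n::finite \<Rightarrow> (real^'n \<Rightarrow> real) \<Rightarrow> real^'n \<Rightarrow> real" where
  "pderiv_dir j f x = frechet_derivative f (at x) (axis j 1)"

text \<open>A list of directions plays the role of a multi-index; for smooth functions the order
  of the list is irrelevant.\<close>

primrec pderivs :: "'n::finite list \<Rightarrow> (real^'n \<Rightarrow> real) \<Rightarrow> real^'n \<Rightarrow> real" where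
  "pderivs [] f = f"
| "pderivs (j # js) f = pderiv_dir j (pderivs js f)"

primrec C_times :: "nat \<Rightarrow> (real^'n::finite \<Rightarrow> real) \<Rightarrow> bool" where
  "C_times 0 f \<longleftrightarrow> continuous_on UNIV f"
| "C_times (Suc m) f \<longleftrightarrow> f differentiable_on UNIV \<and> (\<forall>j. C_times m (pderiv_dir j f))"

definition test_functions :: "(real^'n::finite \<Rightarrow> real) set" where
  "test_functions = {\<phi>. (\<forall>m. C_times m \<phi>) \<and> compact (closure {x. \<phi> x \<noteq> 0})}"

definition locally_integrable :: "(real^'n::finite \<Rightarrow> 'b::euclidean_space) \<Rightarrow> bool" where
  "locally_integrable u \<longleftrightarrow> (\<forall>K. compact K \<longrightarrow> u absolutely_integrable_on K)"

definition has_weak_pderivs ::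
    "'n::finite list \<Rightarrow> (real^'n \<Rightarrow> 'b::euclidean_space) \<Rightarrow> (real^'n \<Rightarrow> 'b) \<Rightarrow> bool" where
  "has_weak_pderivs js u w \<longleftrightarrow> locally_integrable u \<and> locally_integrable w \<and>
     (\<forall>\<phi>\<in>test_functions.
        (LINT x|lebesgue. pderivs js \<phi> x *\<^sub>R u x)
          = (-1) ^ length js *\<^sub>R (LINT x|lebesgue. \<phi> x *\<^sub>R w x))"

text \<open>Elements of the function spaces below are represented by functions, not by classes of
  functions modulo null sets; equality of such elements is therefore always written as
  equality almost everywhere.\<close>

definition L2 :: "(real^'n::finite \<Rightarrow> 'b::euclidean_space) set" where
  "L2 = {u. u \<in> borel_measurable lebesgue \<and> integrable lebesgue (\<lambda>x. (norm (u x))\<^sup>2)}"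

definition Sobolev2 :: "nat \<Rightarrow> (real^'n::finite \<Rightarrow> 'b::euclidean_space) set" where
  "Sobolev2 m = {u \<in> L2. \<forall>js. length js \<le> m \<longrightarrow> (\<exists>w\<in>L2. has_weak_pderivs js u w)}"

text \<open>The weak partial derivative, when it exists, is unique up to a null set, so the choice
  only picks a representative.  Without a weak derivative the value is meaningless.\<close>

definition weak_pderiv ::
    "'n::finite \<Rightarrow> (real^'n \<Rightarrow> 'b::euclidean_space) \<Rightarrow> real^'n \<Rightarrow> 'b" where
  "weak_pderiv j u = (SOME w. has_weak_pderivs [j] u w)"


section \<open>The operator \<open>D\<close>\<close>

text \<open>The sign convention for \<open>1/\<i>\<close> is the one of the source: \<open>dzbar\<close> is
  \<open>(\<partial>\<^sub>1 - \<i> \<partial>\<^sub>2) / 2\<close> and \<open>dz\<close> is \<open>(\<partial>\<^sub>1 + \<i> \<partial>\<^sub>2) / 2\<close>, opposite to the usual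
  Wirtinger derivatives.\<close>

definition dzbar :: "(real^2 \<Rightarrow> complex) \<Rightarrow> real^2 \<Rightarrow> complex" where
  "dzbar f x = 1/2 * (weak_pderiv 1 f x + 1/\<i> * weak_pderiv 2 f x)"

definition dz :: "(real^2 \<Rightarrow> complex) \<Rightarrow> real^2 \<Rightarrow> complex" where
  "dz f x = 1/2 * (weak_pderiv 1 f x - 1/\<i> * weak_pderiv 2 f x)"

definition D0 :: "(real^2 \<Rightarrow> complex^2) \<Rightarrow> real^2 \<Rightarrow> complex^2" where
  "D0 u x = vector [4 * dzbar (dzbar (\<lambda>y. u y $ 2)) x, 4 * dz (dz (\<lambda>y. u y $ 1)) x]"

definition D :: "(real^2 \<Rightarrow> complex^2^2) \<Rightarrow> (real^2 \<Rightarrow> complex^2) \<Rightarrow> real^2 \<Rightarrow> complex^2" where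
  "D V u x = D0 u x + V x *v u x"

definition potential :: "(real^2 \<Rightarrow> complex^2^2) \<Rightarrow> bool" where
  "potential V \<longleftrightarrow> V \<in> borel_measurable lebesgue \<and>
     (\<forall>u\<in>Sobolev2 2. (\<lambda>x. V x *v u x) \<in> L2)"

definition eigenvalue :: "(real^2 \<Rightarrow> complex^2) set \<Rightarrow>
    ((real^2 \<Rightarrow> complex^2) \<Rightarrow> real^2 \<Rightarrow> complex^2) \<Rightarrow> complex \<Rightarrow> bool" where
  "eigenvalue U T k \<longleftrightarrow> (\<exists>u\<in>U. \<not> (AE x in lebesgue. u x = 0) \<and>
     (AE x in lebesgue. T u x = k *s u x))"

text \<open>The library norm on matrices as nested vectors is the Hilbert--Schmidt norm, i.e. the
  \<open>|V(x)|\<close> of the source (not the operator norm).\<close>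

lemma norm_matrix_eq:
  fixes A :: "complex^2^2"
  shows "norm A = sqrt (\<Sum>i\<in>UNIV. \<Sum>j\<in>UNIV. (cmod (A $ i $ j))\<^sup>2)"
  by (simp add: norm_vec_def L2_set_def sum_nonneg)

end

theory Submission
  imports Defs
begin

text \<open>
  Write \<open>R\<close> for the integral kernel of the inverse of \<open>D0 - k\<close>.  It is bounded by an absolute constant,
  uniformly in the nonreal number \<open>k\<close>.  An eigenfunction \<open>u\<close> satisfies \<open>(D0 - k) u = - V u\<close>, hence
  \<open>sup |u| \<le> M (\<integral>|V|) sup |u|\<close> with an absolute \<open>M\<close>, and \<open>sup |u|\<close> is finite and nonzero.  So
  \<open>M \<integral>|V| \<ge> 1\<close>, which makes the last summand of the inequality at least one, and the other summand is
  nonnegative (\<open>eigenvalue_potential_bound\<close>).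

  The kernel.  Since \<open>D0\<^sup>2\<close> is the squared Laplacian, the diagonal entries of \<open>R\<close> are half the
  difference of the resolvent kernels of \<open>-\<Delta>\<close> at \<open>k\<close> and at \<open>-k\<close>, and the off-diagonal entries are
  \<open>1/k\<close> times a second derivative of that difference.  Each resolvent is a Laplace transform of the heat
  kernel \<open>exp (- |x|\<^sup>2 / (4 w)) / (4 \<pi> w)\<close> along a ray of complex times \<open>w\<close>.  Starting the ray at a time
  \<open>\<epsilon> > 0\<close> instead of \<open>0\<close> gives a kernel that is smooth, decays rapidly, and solves the equation with
  the heat kernel at time \<open>\<epsilon>\<close> in place of the point mass (\<open>kernel_rapid\<close>, \<open>kernel_equation\<close>).  It is
  therefore a legitimate test function, up to a cutoff at infinity (\<open>weak_identity_rapid\<close>), and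
  testing the eigenvalue equation with it expresses the Gaussian averages of \<open>u\<close> through \<open>V u\<close>
  (\<open>representation\<close>).  Bounds on all Gaussian averages bound \<open>u\<close> almost everywhere
  (\<open>average_bound_imp_bound\<close>).

  The bounds.  Two choices of the direction of the ray serve two purposes.  Along imaginary times
  \<open>\<epsilon> \<plusminus> \<i> s\<close>, that is, with the Schroedinger propagator, every exponential has modulus at most one,
  for \<open>k\<close> arbitrarily close to the real axis.  For \<open>s\<close> beyond \<open>|x|\<^sup>2\<close> the contributions of the two
  conjugate rays cancel to an integrable remainder; for smaller \<open>s\<close> everything reduces to one
  oscillatory integral, which is controlled by integration by parts away from its stationary point
  (\<open>osc_bound\<close>, \<open>kernel_0_bound\<close>, \<open>kernel_2_bound\<close>).  This gives the absolute constant.  Along rays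
  tilted into the right half plane the heat kernels decay like Gaussians and the kernel is square integrable,
  uniformly in \<open>\<epsilon>\<close> but not in \<open>k\<close> (\<open>kernel_tilted_bound\<close>); paired with the square integrable
  function \<open>V u\<close> this shows that \<open>u\<close> is bounded in the first place (\<open>bounded_solution\<close>).
\<close>

section \<open>Smooth functions of the squared distance\<close>

definition smooth :: "(real^'n::finite \<Rightarrow> real) \<Rightarrow> bool" where
  "smooth f \<longleftrightarrow> (\<forall>m. C_times m f)"

text \<open>A tower lists a function of one real variable together with all its derivatives.  Smoothness of
  \<open>F (|y - x|\<^sup>2)\<close> then follows from the chain rule, which moves up one step of the tower per derivative.\<close>

definition smooth_tower :: "(nat \<Rightarrow> real \<Rightarrow> real) \<Rightarrow> bool" where
  "smooth_tower F \<longleftrightarrow> (\<forall>m t. (F m has_real_derivative F (Suc m) t) (at t))"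

definition sqdist :: "real^'n::finite \<Rightarrow> real^'n \<Rightarrow> real" where
  "sqdist x y = (y - x) \<bullet> (y - x)"

lemma pderiv_dir_eq:
  assumes "(f has_derivative f') (at x)"
  shows "pderiv_dir j f x = f' (axis j 1)"
  unfolding pderiv_dir_def using frechet_derivative_at[OF assms] by simp

lemma C_times_Suc_imp: "C_times (Suc m) f \<Longrightarrow> C_times m f"
proof (induction m arbitrary: f)
  case 0
  then show ?case by (simp add: differentiable_imp_continuous_on)
next
  case (Suc m)
  then show ?case by (metis C_times.simps(2))
qed

lemma C_times_differentiable:
  assumes "C_times (Suc m) f"
  shows "(f has_derivative frechet_derivative f (at x)) (at x)"
  using assms by (auto simp: differentiable_on_def frechet_derivative_works)

lemma pderiv_dir_const: "pderiv_dir j (\<lambda>x. c) = (\<lambda>x. 0)"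
  by (rule ext, subst pderiv_dir_eq[where f' = "\<lambda>_. 0"]) auto

lemma C_times_const: "C_times m (\<lambda>x. c)"
  by (induction m arbitrary: c) (auto simp: pderiv_dir_const)

lemma pderiv_dir_add:
  assumes "C_times (Suc m) f" "C_times (Suc m) g"
  shows "pderiv_dir j (\<lambda>x. f x + g x) = (\<lambda>x. pderiv_dir j f x + pderiv_dir j g x)"
proof
  fix x
  show "pderiv_dir j (\<lambda>x. f x + g x) x = pderiv_dir j f x + pderiv_dir j g x"
    by (subst pderiv_dir_eq[OF has_derivative_add[OF C_times_differentiable[OF assms(1)] C_times_differentiable[OF assms(2)]]])
       (simp add: pderiv_dir_def)
qed

lemma C_times_add: "C_times m f \<Longrightarrow> C_times m g \<Longrightarrow> C_times m (\<lambda>x. f x + g x)"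
proof (induction m arbitrary: f g)
  case 0
  then show ?case by (simp add: continuous_on_add)
next
  case (Suc m)
  have "C_times m (pderiv_dir j (\<lambda>x. f x + g x))" for j
    unfolding pderiv_dir_add[OF Suc.prems] using Suc by simp
  then show ?case using Suc.prems by (simp add: differentiable_on_add)
qed

lemma pderiv_dir_mult:
  assumes "C_times (Suc m) f" "C_times (Suc m) g"
  shows "pderiv_dir j (\<lambda>x. f x * g x) = (\<lambda>x. f x * pderiv_dir j g x + pderiv_dir j f x * g x)"
proof
  fix x
  show "pderiv_dir j (\<lambda>x. f x * g x) x = f x * pderiv_dir j g x + pderiv_dir j f x * g x"
    by (subst pderiv_dir_eq[OF has_derivative_mult[OF C_times_differentiable[OF assms(1)] C_times_differentiable[OF assms(2)]]])
       (simp add: pderiv_dir_def)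
qed

lemma C_times_mult: "C_times m f \<Longrightarrow> C_times m g \<Longrightarrow> C_times m (\<lambda>x. f x * g x)"
proof (induction m arbitrary: f g)
  case 0
  then show ?case by (simp add: continuous_on_mult)
next
  case (Suc m)
  have "C_times m (pderiv_dir j (\<lambda>x. f x * g x))" for j
    unfolding pderiv_dir_mult[OF Suc.prems]
    by (intro C_times_add Suc.IH) (use Suc.prems C_times_Suc_imp in auto)
  then show ?case using Suc.prems by (auto simp: differentiable_on_def)
qed

lemma pderiv_dir_coord: "pderiv_dir j (\<lambda>y. y $ i - c) = (\<lambda>y. if i = j then 1 else 0)"
proof
  fix x :: "real^'a"
  have "((\<lambda>y::real^'a. y $ i - c) has_derivative (\<lambda>v. v $ i)) (at x)"
    using has_derivative_diff[OF bounded_linear_imp_has_derivative[OF bounded_linear_vec_nth] has_derivative_const] by simp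
  from pderiv_dir_eq[OF this] show "pderiv_dir j (\<lambda>y. y $ i - c) x = (if i = j then 1 else 0)"
    by (simp add: axis_def)
qed

lemma C_times_coord: "C_times m (\<lambda>y. y $ i - c)"
  using bounded_linear_imp_differentiable_on[OF bounded_linear_vec_nth]
  by (cases m) (auto simp: pderiv_dir_coord C_times_const intro!: continuous_intros differentiable_on_diff)

lemma has_derivative_sqdist: "(sqdist x has_derivative (\<lambda>v. 2 * ((y - x) \<bullet> v))) (at y)"
  unfolding sqdist_def
  by (auto intro!: derivative_eq_intros simp: inner_commute)

lemma has_derivative_tower:
  assumes "smooth_tower F"
  shows "((\<lambda>y. F m (sqdist x y)) has_derivative (\<lambda>v. 2 * ((y - x) \<bullet> v) * F (Suc m) (sqdist x y))) (at y)"
proof -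
  have "(F m has_derivative (\<lambda>h. h * F (Suc m) (sqdist x y))) (at (sqdist x y))"
    using assms unfolding smooth_tower_def has_field_derivative_def by (simp add: mult_commute_abs)
  from has_derivative_compose[OF has_derivative_sqdist this] show ?thesis .
qed

lemma pderiv_dir_tower:
  assumes "smooth_tower F"
  shows "pderiv_dir j (\<lambda>y. F m (sqdist x y)) = (\<lambda>y. (2 * (y $ j - x $ j)) * F (Suc m) (sqdist x y))"
  by (rule ext, subst pderiv_dir_eq[OF has_derivative_tower[OF assms]]) (simp add: inner_axis)

text \<open>A partial derivative of \<open>F m (|y - x|\<^sup>2)\<close> is a coordinate times \<open>F (m + 1) (|y - x|\<^sup>2)\<close>, so a single
  induction treats all members of the tower at once.\<close>

lemma C_times_tower:
  assumes "smooth_tower F"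
  shows "C_times n (\<lambda>y. F m (sqdist x y))"
proof (induction n arbitrary: m)
  case 0
  have "isCont (\<lambda>y. F m (sqdist x y)) y" for y
    using has_derivative_continuous[OF has_derivative_tower[OF assms]] .
  then show ?case by (simp add: continuous_at_imp_continuous_on)
next
  case (Suc n)
  have "C_times n (pderiv_dir j (\<lambda>y. F m (sqdist x y)))" for j
    unfolding pderiv_dir_tower[OF assms]
    by (intro C_times_mult Suc C_times_coord C_times_const)
  moreover have "(\<lambda>y. F m (sqdist x y)) differentiable_on UNIV"
    unfolding differentiable_on_def differentiable_def using has_derivative_tower[OF assms] by blast
  ultimately show ?case by simp
qed

lemma smooth_pderiv_dir: "smooth f \<Longrightarrow> smooth (pderiv_dir j f)"
  unfolding smooth_def by (metis C_times.simps(2))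

lemma smooth_pderivs: "smooth f \<Longrightarrow> smooth (pderivs js f)"
  by (induction js) (auto simp: smooth_pderiv_dir)

lemma smooth_mult: "smooth f \<Longrightarrow> smooth g \<Longrightarrow> smooth (\<lambda>x. f x * g x)"
  by (simp add: smooth_def C_times_mult)

lemma smooth_const: "smooth (\<lambda>x. c)"
  by (simp add: smooth_def C_times_const)

lemma smooth_coord: "smooth (\<lambda>y. y $ i - c)"
  by (simp add: smooth_def C_times_coord)

lemma smooth_tower_sqdist: "smooth_tower F \<Longrightarrow> smooth (\<lambda>y. F m (sqdist x y))"
  by (simp add: smooth_def C_times_tower)

lemma smooth_continuous: "smooth f \<Longrightarrow> continuous_on UNIV f"
  using C_times.simps(1) unfolding smooth_def by blast

lemma pderiv_dir_smooth_mult: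
  assumes "smooth f" "smooth g"
  shows "pderiv_dir j (\<lambda>x. f x * g x) = (\<lambda>x. f x * pderiv_dir j g x + pderiv_dir j f x * g x)"
  using assms pderiv_dir_mult unfolding smooth_def by blast

lemma pderiv_dir_smooth_add:
  assumes "smooth f" "smooth g"
  shows "pderiv_dir j (\<lambda>x. f x + g x) = (\<lambda>x. pderiv_dir j f x + pderiv_dir j g x)"
  using assms pderiv_dir_add unfolding smooth_def by blast

lemma smooth_zero_outside:
  assumes "\<And>y. y \<notin> K \<Longrightarrow> f y = 0" "closed K" "y \<notin> K"
  shows "pderiv_dir j f y = 0"
proof -
  have "open (- K)" using assms by auto
  then have "eventually (\<lambda>z. z \<in> - K) (nhds y)" using assms(3) by (simp add: eventually_nhds) blast
  then have ev: "eventually (\<lambda>z. f z = 0) (nhds y)" by eventually_elim (use assms in auto)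
  have "(f has_derivative (\<lambda>_. 0)) (at y)"
    by (rule has_derivative_transform_eventually[where f = "\<lambda>_. 0"])
       (use ev assms in \<open>auto simp: eventually_at_filter elim: eventually_mono\<close>)
  from pderiv_dir_eq[OF this] show ?thesis by simp
qed

lemma test_functionsI:
  assumes "smooth f" "\<And>y. y \<notin> K \<Longrightarrow> f y = 0" "compact K"
  shows "f \<in> test_functions"
proof -
  have "closure {x. f x \<noteq> 0} \<subseteq> K"
    by (rule closure_minimal) (use assms compact_imp_closed in auto)
  then have "compact (closure {x. f x \<noteq> 0})"
    using assms(3) by (metis closed_closure compact_Int_closed inf.absorb_iff2)
  then show ?thesis using assms by (simp add: test_functions_def smooth_def)
qed

lemma test_functions_smooth: "f \<in> test_functions \<Longrightarrow> smooth f"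
  by (simp add: test_functions_def smooth_def)

lemma test_functions_pderiv_dir:
  assumes "f \<in> test_functions" shows "pderiv_dir j f \<in> test_functions"
proof (rule test_functionsI)
  show "smooth (pderiv_dir j f)" using assms smooth_pderiv_dir test_functions_smooth by blast
  show "compact (closure {x. f x \<noteq> 0})" using assms by (simp add: test_functions_def)
  show "pderiv_dir j f y = 0" if "y \<notin> closure {x. f x \<noteq> 0}" for y
    by (rule smooth_zero_outside[OF _ _ that]) (use closure_subset[of "{x. f x \<noteq> 0}"] in auto)
qed

lemma test_functions_pderivs: "f \<in> test_functions \<Longrightarrow> pderivs js f \<in> test_functions"
  by (induction js) (auto simp: test_functions_pderiv_dir)

subsection \<open>A smooth cutoff\<close>

text \<open>The polynomials \<open>P\<close> for which the \<open>n\<close>-th derivative of \<open>exp (-1/s)\<close> is \<open>P (1/s) exp (-1/s)\<close>.\<close>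

fun flat_poly :: "nat \<Rightarrow> real poly" where
  "flat_poly 0 = 1"
| "flat_poly (Suc n) = [:0, 0, 1:] * (flat_poly n - pderiv (flat_poly n))"

definition flat :: "nat \<Rightarrow> real \<Rightarrow> real" where
  "flat n s = (if s > 0 then poly (flat_poly n) (1 / s) * exp (- (1 / s)) else 0)"

lemma poly_times_exp_tendsto_0: "((\<lambda>x::real. poly p x * exp (- x)) \<longlongrightarrow> 0) at_top"
proof -
  have "((\<lambda>x. (\<Sum>i\<le>degree p. coeff p i * (x ^ i / exp x))) \<longlongrightarrow> (\<Sum>i\<le>degree p. coeff p i * 0)) at_top"
    by (intro tendsto_sum tendsto_mult tendsto_const tendsto_power_div_exp_0)
  then show ?thesis
    by (simp add: poly_altdef sum_distrib_right exp_minus divide_inverse mult.assoc)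
qed

lemma flat_over_self_tendsto_0: "((\<lambda>h. flat n h / h) \<longlongrightarrow> 0) (at 0)"
proof -
  have "((\<lambda>h::real. poly ([:0,1:] * flat_poly n) (inverse h) * exp (- inverse h)) \<longlongrightarrow> 0) (at_right 0)"
    by (rule filterlim_compose[OF poly_times_exp_tendsto_0 filterlim_inverse_at_top_right])
  then have r: "((\<lambda>h. flat n h / h) \<longlongrightarrow> 0) (at_right 0)"
    by (rule Lim_transform_eventually)
       (auto simp: eventually_at_filter flat_def field_simps inverse_eq_divide intro!: always_eventually)
  have l: "((\<lambda>h. flat n h / h) \<longlongrightarrow> 0) (at_left 0)"
    by (rule Lim_transform_eventually[OF tendsto_const])
       (auto simp: eventually_at_filter flat_def intro!: always_eventually)
  show ?thesis using l r by (simp add: filterlim_split_at)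
qed

lemma flat_has_derivative: "(flat n has_real_derivative flat (Suc n) s) (at s)"
proof -
  consider "s > 0" | "s < 0" | "s = 0" by linarith
  then show ?thesis
  proof cases
    case 1
    have "((\<lambda>s. poly (flat_poly n) (1 / s) * exp (- (1 / s))) has_real_derivative
        poly (pderiv (flat_poly n)) (1/s) * (- 1 / s\<^sup>2) * exp (- (1 / s)) + poly (flat_poly n) (1 / s) * (exp (- (1 / s)) * (1/s\<^sup>2))) (at s)"
      using 1 by (auto intro!: derivative_eq_intros simp: power2_eq_square field_simps)
    also have "poly (pderiv (flat_poly n)) (1/s) * (- 1 / s\<^sup>2) * exp (- (1 / s)) + poly (flat_poly n) (1 / s) * (exp (- (1 / s)) * (1/s\<^sup>2))
       = flat (Suc n) s"
      using 1 by (simp add: flat_def algebra_simps power2_eq_square)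
    finally show ?thesis
      by (rule has_field_derivative_transform_within_open[where S = "{0<..}"])
         (use 1 in \<open>auto simp: flat_def\<close>)
  next
    case 2
    have "((\<lambda>_. 0) has_real_derivative flat (Suc n) s) (at s)" using 2 by (simp add: flat_def)
    then show ?thesis
      by (rule has_field_derivative_transform_within_open[where S = "{..<0}"])
         (use 2 in \<open>auto simp: flat_def\<close>)
  next
    case 3
    then show ?thesis using flat_over_self_tendsto_0[of n]
      by (simp add: DERIV_def flat_def)
  qed
qed

text \<open>The argument \<open>t\<close> stands for a squared distance, so that a compactly supported radial function arises from
  the support in \<open>t \<le> 1\<close>; the factor makes its value at the origin equal to one.\<close>

definition bump :: "nat \<Rightarrow> real \<Rightarrow> real" where
  "bump n t = exp 1 * (-1) ^ n * flat n (1 - t)"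

lemma bump_tower: "smooth_tower bump"
  unfolding smooth_tower_def bump_def
  by (auto intro!: derivative_eq_intros DERIV_chain'[OF _ flat_has_derivative] simp: algebra_simps)

lemma bump_0: "bump 0 0 = 1"
  by (simp add: bump_def flat_def flip: exp_add)

lemma bump_outside: "t \<ge> 1 \<Longrightarrow> bump n t = 0"
  by (simp add: bump_def flat_def)

lemma smooth_tower_continuous: "smooth_tower F \<Longrightarrow> continuous_on UNIV (F n)"
  unfolding smooth_tower_def by (meson DERIV_continuous continuous_at_imp_continuous_on)

lemma bump_bounded: "\<exists>B. \<forall>t\<ge>0. \<bar>bump n t\<bar> \<le> B"
proof -
  have "compact (bump n ` {0..1})"
    by (intro compact_continuous_image continuous_on_subset[OF smooth_tower_continuous[OF bump_tower]]) auto
  then obtain B where B: "\<And>t. t \<in> {0..1} \<Longrightarrow> \<bar>bump n t\<bar> \<le> B"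
    using compact_imp_bounded bounded_iff by (metis imageI real_norm_def)
  have "\<bar>bump n t\<bar> \<le> max B 0" if "t \<ge> 0" for t
    using that B[of t] bump_outside[of t n] by (cases "t \<le> 1") auto
  then show ?thesis by blast
qed

section \<open>The eigenvalue equation in weak form\<close>

lemma L2_mult_integrable:
  fixes f g :: "real^'n::finite \<Rightarrow> complex"
  assumes "f \<in> L2" "g \<in> L2"
  shows "integrable lebesgue (\<lambda>x. f x * g x)"
proof (rule Bochner_Integration.integrable_bound)
  show "integrable lebesgue (\<lambda>x. (norm (f x))\<^sup>2 + (norm (g x))\<^sup>2)"
    using assms by (auto simp: L2_def)
  show "(\<lambda>x. f x * g x) \<in> borel_measurable lebesgue"
    using assms by (auto simp: L2_def intro: borel_measurable_times)
  have "norm (f x * g x) \<le> (norm (f x))\<^sup>2 + (norm (g x))\<^sup>2" for x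
    using sum_squares_bound[of "norm (f x)" "norm (g x)"]
      mult_nonneg_nonneg[OF norm_ge_zero[of "f x"] norm_ge_zero[of "g x"]]
    unfolding norm_mult by linarith
  then show "AE x in lebesgue. norm (f x * g x) \<le> norm ((norm (f x))\<^sup>2 + (norm (g x))\<^sup>2)"
    by (auto intro!: always_eventually intro: order_trans)
qed

lemma L2_linear:
  fixes u :: "real^'n::finite \<Rightarrow> 'b::euclidean_space" and T :: "'b \<Rightarrow> 'c::euclidean_space"
  assumes "u \<in> L2" "bounded_linear T"
  shows "(\<lambda>x. T (u x)) \<in> L2"
proof -
  have m: "(\<lambda>x. T (u x)) \<in> borel_measurable lebesgue"
    using assms borel_measurable_continuous_onI[OF linear_continuous_on[OF assms(2)]]
    by (auto simp: L2_def intro: measurable_compose)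
  obtain K where K: "\<And>x. norm (T x) \<le> norm x * K" using bounded_linear.bounded[OF assms(2)] by blast
  have "(norm (T (u x)))\<^sup>2 \<le> norm ((norm (u x))\<^sup>2 * K\<^sup>2)" for x
    using power_mono[OF K[of "u x"] norm_ge_zero, of 2] by (simp add: power_mult_distrib)
  then have ae: "AE x in lebesgue. norm ((norm (T (u x)))\<^sup>2) \<le> norm ((norm (u x))\<^sup>2 * K\<^sup>2)" by simp
  have "integrable lebesgue (\<lambda>x. (norm (u x))\<^sup>2 * K\<^sup>2)" using assms(1) by (simp add: L2_def)
  from Bochner_Integration.integrable_bound[OF this _ ae]
  have "integrable lebesgue (\<lambda>x. (norm (T (u x)))\<^sup>2)" using m by simp
  with m show ?thesis by (simp add: L2_def)
qed

lemma L2_add: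
  fixes u v :: "real^'n::finite \<Rightarrow> 'b::euclidean_space"
  assumes "u \<in> L2" "v \<in> L2"
  shows "(\<lambda>x. u x + v x) \<in> L2"
proof -
  have m: "(\<lambda>x. u x + v x) \<in> borel_measurable lebesgue"
    using assms by (auto simp: L2_def)
  have "(norm (u x + v x))\<^sup>2 \<le> norm (2 * (norm (u x))\<^sup>2 + 2 * (norm (v x))\<^sup>2)" for x
    using power_mono[OF norm_triangle_ineq[of "u x" "v x"], of 2]
      sum_squares_bound[of "norm (u x)" "norm (v x)"] by (simp add: power2_sum)
  then have ae: "AE x in lebesgue. norm ((norm (u x + v x))\<^sup>2) \<le> norm (2 * (norm (u x))\<^sup>2 + 2 * (norm (v x))\<^sup>2)" by simp
  have "integrable lebesgue (\<lambda>x. 2 * (norm (u x))\<^sup>2 + 2 * (norm (v x))\<^sup>2)" using assms by (simp add: L2_def)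
  from Bochner_Integration.integrable_bound[OF this _ ae]
  have "integrable lebesgue (\<lambda>x. (norm (u x + v x))\<^sup>2)" using m by simp
  with m show ?thesis by (simp add: L2_def)
qed

lemma L2_vec_nth: "u \<in> L2 \<Longrightarrow> (\<lambda>x. u x $ i) \<in> L2"
  by (rule L2_linear[OF _ bounded_linear_vec_nth])

lemma L2_eigen_residual:
  fixes u w :: "real^'n::finite \<Rightarrow> complex^'m::finite"
  assumes "u \<in> L2" "w \<in> L2"
  shows "(\<lambda>x. k * u x $ i - w x $ i) \<in> L2"
  using L2_add[OF L2_linear[OF L2_vec_nth[OF assms(1), of i] bounded_linear_mult_right[of k]]
      L2_linear[OF L2_vec_nth[OF assms(2), of i] bounded_linear_minus[OF bounded_linear_ident]]] by simp

lemma test_function_bounded: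
  fixes \<phi> :: "real^'n::finite \<Rightarrow> real"
  assumes "\<phi> \<in> test_functions" obtains B where "\<And>x. \<bar>\<phi> x\<bar> \<le> B" "B \<ge> 0"
proof -
  let ?K = "closure {x. \<phi> x \<noteq> 0}"
  have c: "continuous_on UNIV \<phi>" using assms smooth_continuous test_functions_smooth by blast
  have "compact (\<phi> ` ?K)"
    by (intro compact_continuous_image continuous_on_subset[OF c]) (use assms in \<open>auto simp: test_functions_def\<close>)
  then obtain B where B: "\<And>x. x \<in> ?K \<Longrightarrow> \<bar>\<phi> x\<bar> \<le> B"
    using compact_imp_bounded bounded_iff by (metis imageI real_norm_def)
  have "\<bar>\<phi> x\<bar> \<le> max B 0" for x
  proof (cases "\<phi> x = 0")
    case False
    then have "x \<in> ?K" using closure_subset[of "{x. \<phi> x \<noteq> 0}"] by auto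
    then show ?thesis using B[of x] by auto
  qed auto
  then show thesis using that[of "max B 0"] by auto
qed

lemma test_function_integrable:
  fixes u :: "real^'n::finite \<Rightarrow> 'b::euclidean_space"
  assumes "\<phi> \<in> test_functions" "locally_integrable u"
  shows "integrable lebesgue (\<lambda>x. \<phi> x *\<^sub>R u x)"
proof -
  let ?K = "closure {x. \<phi> x \<noteq> 0}"
  have "u absolutely_integrable_on ?K" using assms by (auto simp: locally_integrable_def test_functions_def)
  then have i: "integrable lebesgue (\<lambda>x. indicat_real ?K x *\<^sub>R u x)" by (simp add: set_integrable_def)
  obtain B where B: "\<And>x. \<bar>\<phi> x\<bar> \<le> B" "B \<ge> 0" using test_function_bounded[OF assms(1)] by blast
  have eq: "\<phi> x *\<^sub>R u x = \<phi> x *\<^sub>R (indicat_real ?K x *\<^sub>R u x)" for x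
    using closure_subset[of "{x. \<phi> x \<noteq> 0}"] by (auto simp: indicator_def)
  have "\<phi> \<in> borel_measurable borel"
    using assms(1) smooth_continuous test_functions_smooth borel_measurable_continuous_onI by blast
  then have m: "\<phi> \<in> borel_measurable lebesgue"
    by (simp add: measurable_completion)
  show ?thesis
    unfolding eq
  proof (rule Bochner_Integration.integrable_bound)
    show "integrable lebesgue (\<lambda>x. B * norm (indicat_real ?K x *\<^sub>R u x))"
      by (intro integrable_mult_right Bochner_Integration.integrable_norm i)
    show "(\<lambda>x. \<phi> x *\<^sub>R indicat_real ?K x *\<^sub>R u x) \<in> borel_measurable lebesgue"
      using m borel_measurable_integrable[OF i] by (rule borel_measurable_scaleR)
    show "AE x in lebesgue. norm (\<phi> x *\<^sub>R indicat_real ?K x *\<^sub>R u x) \<le> norm (B * norm (indicat_real ?K x *\<^sub>R u x))"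
      using B by (intro AE_I2) (simp add: abs_mult mult.assoc mult_right_mono)
  qed
qed

lemma has_weak_pderivs_linear:
  fixes u w :: "real^'n::finite \<Rightarrow> 'b::euclidean_space" and T :: "'b \<Rightarrow> 'c::euclidean_space"
  assumes "has_weak_pderivs js u w" "bounded_linear T"
  shows "has_weak_pderivs js (\<lambda>x. T (u x)) (\<lambda>x. T (w x))"
proof -
  interpret T: bounded_linear T by fact
  have l: "locally_integrable (\<lambda>x. T (v x))" if "locally_integrable v" for v :: "real^'n \<Rightarrow> 'b"
    using that absolutely_integrable_linear[OF _ assms(2)]
    by (auto simp: locally_integrable_def o_def)
  have "(LINT x|lebesgue. pderivs js \<phi> x *\<^sub>R T (u x)) = (-1) ^ length js *\<^sub>R (LINT x|lebesgue. \<phi> x *\<^sub>R T (w x))"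
    if \<phi>: "\<phi> \<in> test_functions" for \<phi>
  proof -
    have "(LINT x|lebesgue. pderivs js \<phi> x *\<^sub>R T (u x)) = T (LINT x|lebesgue. pderivs js \<phi> x *\<^sub>R u x)"
      using integral_bounded_linear[OF assms(2) test_function_integrable[OF test_functions_pderivs[OF \<phi>], of u js]]
        assms(1) by (simp add: T.scaleR has_weak_pderivs_def)
    also have "\<dots> = (-1) ^ length js *\<^sub>R T (LINT x|lebesgue. \<phi> x *\<^sub>R w x)"
      using assms(1) \<phi> by (simp add: T.scaleR has_weak_pderivs_def)
    also have "T (LINT x|lebesgue. \<phi> x *\<^sub>R w x) = (LINT x|lebesgue. \<phi> x *\<^sub>R T (w x))"
      using integral_bounded_linear[OF assms(2) test_function_integrable[OF \<phi>, of w]]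
        assms(1) by (simp add: T.scaleR has_weak_pderivs_def)
    finally show ?thesis .
  qed
  then show ?thesis using assms(1) l by (auto simp: has_weak_pderivs_def)
qed

lemma has_weak_pderivs_add:
  fixes u w u' w' :: "real^'n::finite \<Rightarrow> 'b::euclidean_space"
  assumes "has_weak_pderivs js u w" "has_weak_pderivs js u' w'"
  shows "has_weak_pderivs js (\<lambda>x. u x + u' x) (\<lambda>x. w x + w' x)"
proof -
  have l: "locally_integrable (\<lambda>x. v x + v' x)" if "locally_integrable v" "locally_integrable v'"
    for v v' :: "real^'n \<Rightarrow> 'b"
    using that by (auto simp: locally_integrable_def intro: set_integral_add)
  have "(LINT x|lebesgue. pderivs js \<phi> x *\<^sub>R (u x + u' x)) = (-1) ^ length js *\<^sub>R (LINT x|lebesgue. \<phi> x *\<^sub>R (w x + w' x))"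
    if \<phi>: "\<phi> \<in> test_functions" for \<phi>
  proof -
    have l: "locally_integrable u" "locally_integrable w" "locally_integrable u'" "locally_integrable w'"
      using assms by (auto simp: has_weak_pderivs_def)
    note i = test_function_integrable[OF \<phi>] test_function_integrable[OF test_functions_pderivs[OF \<phi>, of js]]
    show ?thesis
      using assms \<phi> unfolding scaleR_add_right
      by (simp add: has_weak_pderivs_def Bochner_Integration.integral_add[OF i(1)[OF l(2)] i(1)[OF l(4)]]
         Bochner_Integration.integral_add[OF i(2)[OF l(1)] i(2)[OF l(3)]] scaleR_add_right)
  qed
  then show ?thesis using assms l by (auto simp: has_weak_pderivs_def)
qed

text \<open>Testing the first derivative with \<open>\<partial>\<^sub>l \<phi>\<close> transfers a second derivative of \<open>f\<close> to every
  representative \<open>g\<close> of the first one.  Thus iterated choices of weak derivatives stay meaningful, whichever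
  representatives were chosen.\<close>

lemma has_weak_pderivs_shift:
  assumes "has_weak_pderivs [j] f g" "has_weak_pderivs [j, l] f w"
  shows "has_weak_pderivs [l] g w"
  unfolding has_weak_pderivs_def
proof (intro conjI ballI)
  fix \<phi> :: "real^'a \<Rightarrow> real" assume \<phi>: "\<phi> \<in> test_functions"
  have "(LINT x|lebesgue. pderivs [j] (pderiv_dir l \<phi>) x *\<^sub>R f x) = - (LINT x|lebesgue. pderiv_dir l \<phi> x *\<^sub>R g x)"
    using assms(1) test_functions_pderiv_dir[OF \<phi>] by (simp add: has_weak_pderivs_def)
  moreover have "(LINT x|lebesgue. pderivs [j, l] \<phi> x *\<^sub>R f x) = (LINT x|lebesgue. \<phi> x *\<^sub>R w x)"
    using assms(2) \<phi> by (simp add: has_weak_pderivs_def)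
  ultimately have "- (LINT x|lebesgue. pderiv_dir l \<phi> x *\<^sub>R g x) = (LINT x|lebesgue. \<phi> x *\<^sub>R w x)"
    by simp
  then show "(LINT x|lebesgue. pderivs [l] \<phi> x *\<^sub>R g x) = (-1) ^ length [l] *\<^sub>R (LINT x|lebesgue. \<phi> x *\<^sub>R w x)"
    by (simp add: minus_equation_iff eq_commute)
qed (use assms in \<open>auto simp: has_weak_pderivs_def\<close>)

text \<open>Both first order operators at once: \<open>e = - \<i>\<close> gives \<open>dzbar\<close> and \<open>e = \<i>\<close> gives \<open>dz\<close>.\<close>

definition wirtinger :: "complex \<Rightarrow> (real^2 \<Rightarrow> complex) \<Rightarrow> real^2 \<Rightarrow> complex" where
  "wirtinger e f x = 1/2 * (weak_pderiv 1 f x + e * weak_pderiv 2 f x)"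

lemma dzbar_wirtinger: "dzbar = wirtinger (- \<i>)" and dz_wirtinger: "dz = wirtinger \<i>"
  by (auto simp: dzbar_def dz_def wirtinger_def fun_eq_iff)

text \<open>The operator \<open>(\<partial>\<^sub>1 + e \<partial>\<^sub>2)\<^sup>2\<close>, which is four times the square of \<open>wirtinger e\<close>.  Both
  orders of the mixed derivatives occur, as in the composition of the first order operators.\<close>

definition wirtinger2 :: "complex \<Rightarrow> (real^2 \<Rightarrow> real) \<Rightarrow> real^2 \<Rightarrow> complex" where
  "wirtinger2 e \<phi> x = of_real (pderivs [1,1] \<phi> x) + e * of_real (pderivs [2,1] \<phi> x)
     + e * of_real (pderivs [1,2] \<phi> x) + e\<^sup>2 * of_real (pderivs [2,2] \<phi> x)"

lemma weak_pderiv_works: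
  assumes "has_weak_pderivs [j] f w" shows "has_weak_pderivs [j] f (weak_pderiv j f)"
  unfolding weak_pderiv_def using someI[of "has_weak_pderivs [j] f", OF assms] .

lemma wirtinger_weak:
  fixes f :: "real^2 \<Rightarrow> complex"
  assumes "has_weak_pderivs (1 # js) f w1" "has_weak_pderivs (2 # js) f w2"
    and "has_weak_pderivs [1] f v1" "has_weak_pderivs [2] f v2" and "js = [l]"
  shows "has_weak_pderivs js (wirtinger e f) (\<lambda>x. 1/2 * w1 x + 1/2 * e * w2 x)"
proof -
  have g: "has_weak_pderivs js (weak_pderiv 1 f) w1" "has_weak_pderivs js (weak_pderiv 2 f) w2"
    using assms has_weak_pderivs_shift weak_pderiv_works by blast+
  have "has_weak_pderivs js (\<lambda>x. 1/2 * weak_pderiv 1 f x + 1/2 * e * weak_pderiv 2 f x) (\<lambda>x. 1/2 * w1 x + 1/2 * e * w2 x)"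
    by (intro has_weak_pderivs_add has_weak_pderivs_linear[OF g(1)] has_weak_pderivs_linear[OF g(2)]
        bounded_linear_mult_right)
  then show ?thesis by (simp add: wirtinger_def[abs_def] algebra_simps)
qed

text \<open>Two integrations by parts change the sign twice, so the operator moves to the test function unaltered.
  Integrability of the right-hand side is recorded because it supplies the measurability of the chosen
  derivatives.\<close>

lemma wirtinger_wirtinger_weak:
  fixes f :: "real^2 \<Rightarrow> complex"
  assumes ex: "\<And>js. length js \<le> 2 \<Longrightarrow> \<exists>w. has_weak_pderivs js f w" and \<phi>: "\<phi> \<in> test_functions"
  shows "(LINT x|lebesgue. wirtinger2 e \<phi> x * f x)
     = (LINT x|lebesgue. \<phi> x *\<^sub>R (4 * wirtinger e (wirtinger e f) x))" (is ?eq)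
    and "integrable lebesgue (\<lambda>x. \<phi> x *\<^sub>R (4 * wirtinger e (wirtinger e f) x))" (is ?int)
proof -
  obtain v1 v2 w11 w12 w21 w22 where w: "has_weak_pderivs [1] f v1" "has_weak_pderivs [2] f v2"
    "has_weak_pderivs [1,1] f w11" "has_weak_pderivs [1,2] f w12"
    "has_weak_pderivs [2,1] f w21" "has_weak_pderivs [2,2] f w22"
    using ex[of "[1]"] ex[of "[2]"] ex[of "[1,1]"] ex[of "[1,2]"] ex[of "[2,1]"] ex[of "[2,2]"] by auto
  define h where "h = wirtinger e f"
  define g1 where "g1 = weak_pderiv 1 f"
  define g2 where "g2 = weak_pderiv 2 f"
  define h1 where "h1 = weak_pderiv 1 h"
  define h2 where "h2 = weak_pderiv 2 h"
  have h: "has_weak_pderivs [1] h h1" "has_weak_pderivs [2] h h2"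
    unfolding h_def h1_def h2_def
    using weak_pderiv_works wirtinger_weak[OF w(3,5,1,2) refl] wirtinger_weak[OF w(4,6,1,2) refl] by blast+
  have g: "has_weak_pderivs [1] f g1" "has_weak_pderivs [2] f g2"
    unfolding g1_def g2_def using weak_pderiv_works w by blast+
  have loc: "locally_integrable f" "locally_integrable g1" "locally_integrable g2" "locally_integrable h1" "locally_integrable h2"
    using g h by (auto simp: has_weak_pderivs_def)
  define I where "I \<psi> v = (LINT x|lebesgue. \<psi> x *\<^sub>R v x)" for \<psi> and v :: "real^2 \<Rightarrow> complex"
  have Iint: "integrable lebesgue (\<lambda>x. \<psi> x *\<^sub>R v x)" if "\<psi> \<in> test_functions" "locally_integrable v" for \<psi> and v :: "real^2 \<Rightarrow> complex"
    using test_function_integrable[OF that] .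
  have J: "I (pderiv_dir 1 \<psi>) v = - I \<psi> v1" if "has_weak_pderivs [1] v v1" "\<psi> \<in> test_functions" for \<psi> v v1
    using that unfolding has_weak_pderivs_def I_def by simp
  have J2: "I (pderiv_dir 2 \<psi>) v = - I \<psi> v1" if "has_weak_pderivs [2] v v1" "\<psi> \<in> test_functions" for \<psi> v v1
    using that unfolding has_weak_pderivs_def I_def by simp
  have t: "pderiv_dir j \<psi> \<in> test_functions" if "\<psi> \<in> test_functions" for j \<psi>
    using that by (rule test_functions_pderiv_dir)
  have Ih: "I \<psi> h = 1/2 * I \<psi> g1 + e/2 * I \<psi> g2" if "\<psi> \<in> test_functions" for \<psi>
  proof -
    have "\<psi> x *\<^sub>R h x = 1/2 * (\<psi> x *\<^sub>R g1 x) + e/2 * (\<psi> x *\<^sub>R g2 x)" for x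
      by (simp add: h_def wirtinger_def g1_def g2_def scaleR_conv_of_real algebra_simps)
    note E = this
    show ?thesis unfolding I_def E
      using Iint[OF that loc(2)] Iint[OF that loc(3)]
      by (simp only: Bochner_Integration.integral_add integrable_mult_right integral_mult_right_zero)
  qed
  have R: "\<phi> x *\<^sub>R (4 * wirtinger e h x) = 2 * (\<phi> x *\<^sub>R h1 x) + (2 * e) * (\<phi> x *\<^sub>R h2 x)" for x
    by (simp add: wirtinger_def h1_def h2_def scaleR_conv_of_real algebra_simps)
  have "(LINT x|lebesgue. \<phi> x *\<^sub>R (4 * wirtinger e h x)) = 2 * I \<phi> h1 + (2 * e) * I \<phi> h2"
    unfolding R I_def using Iint[OF \<phi> loc(4)] Iint[OF \<phi> loc(5)]
    by (simp only: Bochner_Integration.integral_add integrable_mult_right integral_mult_right_zero)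
  also have "\<dots> = - 2 * I (pderiv_dir 1 \<phi>) h - (2 * e) * I (pderiv_dir 2 \<phi>) h"
    using J[OF h(1) \<phi>] J2[OF h(2) \<phi>] by simp
  also have "\<dots> = I (pderivs [1,1] \<phi>) f + e * I (pderivs [2,1] \<phi>) f + e * I (pderivs [1,2] \<phi>) f + e\<^sup>2 * I (pderivs [2,2] \<phi>) f"
    using Ih[OF t[OF \<phi>]] J[OF g(1) t[OF \<phi>]] J2[OF g(2) t[OF \<phi>]]
    by (simp add: algebra_simps power2_eq_square)
  also have "\<dots> = (LINT x|lebesgue. wirtinger2 e \<phi> x * f x)"
  proof -
    have E: "wirtinger2 e \<phi> x * f x = pderivs [1,1] \<phi> x *\<^sub>R f x + e * (pderivs [2,1] \<phi> x *\<^sub>R f x)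
       + e * (pderivs [1,2] \<phi> x *\<^sub>R f x) + e\<^sup>2 * (pderivs [2,2] \<phi> x *\<^sub>R f x)" for x
      by (simp only: wirtinger2_def scaleR_conv_of_real ring_distribs mult.assoc)
    note i = Iint[OF test_functions_pderivs[OF \<phi>] loc(1)]
    show ?thesis unfolding E I_def
      by (simp only: Bochner_Integration.integral_add integrable_mult_right integral_mult_right_zero Bochner_Integration.integrable_add i)
  qed
  finally show ?eq unfolding h_def by simp
  have "integrable lebesgue (\<lambda>x. \<phi> x *\<^sub>R (4 * wirtinger e h x))"
    unfolding R by (intro Bochner_Integration.integrable_add integrable_mult_right Iint \<phi> loc)
  then show ?int unfolding h_def .
qed

lemma eigenfunction_weak:
  fixes u :: "real^2 \<Rightarrow> complex^2"
  assumes u: "u \<in> Sobolev2 2" and Vu: "(\<lambda>x. V x *v u x) \<in> L2"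
    and eq: "AE x in lebesgue. D V u x = k *s u x"
    and \<phi>: "\<phi> \<in> test_functions"
  shows "(LINT x|lebesgue. wirtinger2 (- \<i>) \<phi> x * u x $ 2) = (LINT x|lebesgue. \<phi> x *\<^sub>R (k * u x $ 1 - (V x *v u x) $ 1))"
    and "(LINT x|lebesgue. wirtinger2 \<i> \<phi> x * u x $ 1) = (LINT x|lebesgue. \<phi> x *\<^sub>R (k * u x $ 2 - (V x *v u x) $ 2))"
proof -
  have ex: "\<exists>w. has_weak_pderivs js (\<lambda>x. u x $ i) w" if len: "length js \<le> 2" for js i
  proof -
    obtain w where "has_weak_pderivs js u w" using u len unfolding Sobolev2_def by blast
    from has_weak_pderivs_linear[OF this bounded_linear_vec_nth[of i]] show ?thesis by blast
  qed
  have "AE x in lebesgue. 4 * dzbar (dzbar (\<lambda>y. u y $ 2)) x = k * u x $ 1 - (V x *v u x) $ 1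
      \<and> 4 * dz (dz (\<lambda>y. u y $ 1)) x = k * u x $ 2 - (V x *v u x) $ 2"
    using eq
  proof eventually_elim
    case (elim x)
    have "D V u x $ 1 = (k *s u x) $ 1" "D V u x $ 2 = (k *s u x) $ 2" using elim by auto
    then show ?case by (simp add: D_def D0_def algebra_simps)
  qed
  then have ae: "AE x in lebesgue. \<phi> x *\<^sub>R (4 * dzbar (dzbar (\<lambda>y. u y $ 2)) x) = \<phi> x *\<^sub>R (k * u x $ 1 - (V x *v u x) $ 1)"
    "AE x in lebesgue. \<phi> x *\<^sub>R (4 * dz (dz (\<lambda>y. u y $ 1)) x) = \<phi> x *\<^sub>R (k * u x $ 2 - (V x *v u x) $ 2)"
    by (auto elim: eventually_mono)
  have lm: "(\<lambda>x. \<phi> x *\<^sub>R (k * u x $ i - (V x *v u x) $ i)) \<in> borel_measurable lebesgue" for i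
  proof -
    have "\<phi> \<in> borel_measurable lebesgue"
      using smooth_continuous[OF test_functions_smooth[OF \<phi>]]
      by (simp add: borel_measurable_continuous_onI measurable_completion)
    moreover have "(\<lambda>x. k * u x $ i - (V x *v u x) $ i) \<in> borel_measurable lebesgue"
      using L2_eigen_residual[OF _ Vu, of u k i] u by (simp add: L2_def Sobolev2_def)
    ultimately show ?thesis by (intro borel_measurable_scaleR)
  qed
  show "(LINT x|lebesgue. wirtinger2 (- \<i>) \<phi> x * u x $ 2) = (LINT x|lebesgue. \<phi> x *\<^sub>R (k * u x $ 1 - (V x *v u x) $ 1))"
    using integral_cong_AE[OF _ lm ae(1)] wirtinger_wirtinger_weak[OF ex[where i = 2] \<phi>, where e = "- \<i>"]
    by (simp add: dzbar_wirtinger borel_measurable_integrable)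
  show "(LINT x|lebesgue. wirtinger2 \<i> \<phi> x * u x $ 1) = (LINT x|lebesgue. \<phi> x *\<^sub>R (k * u x $ 2 - (V x *v u x) $ 2))"
    using integral_cong_AE[OF _ lm ae(2)] wirtinger_wirtinger_weak[OF ex[where i = 1] \<phi>, where e = "\<i>"]
    by (simp add: dz_wirtinger borel_measurable_integrable)
qed

section \<open>Testing against rapidly decaying functions\<close>

text \<open>Faster decay than every power of the distance to \<open>x\<close>; \<open>rapid x m\<close> asks it of all derivatives up to
  order \<open>m\<close>.\<close>

definition rapid0 :: "real^'n::finite \<Rightarrow> (real^'n \<Rightarrow> real) \<Rightarrow> bool" where
  "rapid0 x f \<longleftrightarrow> (\<forall>N::nat. \<exists>C. \<forall>y. \<bar>f y\<bar> * (1 + sqdist x y) ^ N \<le> C)"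

primrec rapid :: "real^'n::finite \<Rightarrow> nat \<Rightarrow> (real^'n \<Rightarrow> real) \<Rightarrow> bool" where
  "rapid x 0 f \<longleftrightarrow> rapid0 x f"
| "rapid x (Suc m) f \<longleftrightarrow> rapid0 x f \<and> (\<forall>j. rapid x m (pderiv_dir j f))"

definition rapid_tower :: "(nat \<Rightarrow> real \<Rightarrow> real) \<Rightarrow> bool" where
  "rapid_tower F \<longleftrightarrow> smooth_tower F \<and> (\<forall>m N. \<exists>C. \<forall>t\<ge>0. \<bar>F m t\<bar> * (1 + t) ^ N \<le> C)"

lemma sqdist_nonneg [simp]: "0 \<le> sqdist x y"
  by (simp add: sqdist_def)

lemma rapid_0: "rapid x m f \<Longrightarrow> rapid0 x f"
  by (cases m) auto

lemma rapid_Suc_imp: "rapid x (Suc m) f \<Longrightarrow> rapid x m f"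
  by (induction m arbitrary: f) auto

lemma rapid_0_add:
  assumes "rapid0 x f" "rapid0 x g" shows "rapid0 x (\<lambda>y. f y + g y)"
  unfolding rapid0_def
proof
  fix N
  obtain C D where C: "\<And>y. \<bar>f y\<bar> * (1 + sqdist x y) ^ N \<le> C" and D: "\<And>y. \<bar>g y\<bar> * (1 + sqdist x y) ^ N \<le> D"
    using assms unfolding rapid0_def by meson
  have "\<bar>f y + g y\<bar> * (1 + sqdist x y) ^ N \<le> (\<bar>f y\<bar> + \<bar>g y\<bar>) * (1 + sqdist x y) ^ N" for y
    by (intro mult_right_mono) auto
  also have "\<dots> y \<le> C + D" for y using C[of y] D[of y] by (simp add: algebra_simps)
  finally show "\<exists>C. \<forall>y. \<bar>f y + g y\<bar> * (1 + sqdist x y) ^ N \<le> C" by blast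
qed

lemma rapid_add:
  "smooth f \<Longrightarrow> smooth g \<Longrightarrow> rapid x m f \<Longrightarrow> rapid x m g \<Longrightarrow> rapid x m (\<lambda>y. f y + g y)"
proof (induction m arbitrary: f g)
  case 0
  show ?case using rapid_0_add 0 by simp
next
  case (Suc m)
  have "rapid x m (pderiv_dir j (\<lambda>y. f y + g y))" for j
    unfolding pderiv_dir_smooth_add[OF Suc.prems(1,2)]
    by (rule Suc.IH) (use Suc.prems in \<open>auto intro: smooth_pderiv_dir\<close>)
  then show ?case using rapid_0_add[OF rapid_0[OF Suc.prems(3)] rapid_0[OF Suc.prems(4)]]
    by simp
qed

lemma coord_le_sqdist: "\<bar>y $ i - x $ i\<bar> \<le> 1 + sqdist x y"
proof -
  have "\<bar>(y - x) $ i\<bar> \<le> norm (y - x)" by (rule component_le_norm_cart)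
  moreover have "norm (y - x) \<le> 1 + (norm (y - x))\<^sup>2"
    using sum_squares_bound[of 1 "norm (y - x)"] norm_ge_zero[of "y - x"] by (simp; linarith)
  ultimately show ?thesis by (simp add: sqdist_def dot_square_norm)
qed

lemma rapid_0_coord:
  assumes "rapid0 x f" shows "rapid0 x (\<lambda>y. c * (y $ i - x $ i) * f y)"
  unfolding rapid0_def
proof
  fix N
  obtain C where C: "\<And>y. \<bar>f y\<bar> * (1 + sqdist x y) ^ Suc N \<le> C"
    using assms unfolding rapid0_def by meson
  have "\<bar>c * (y $ i - x $ i) * f y\<bar> * (1 + sqdist x y) ^ N \<le> \<bar>c\<bar> * C" for y
  proof -
    have "\<bar>y $ i - x $ i\<bar> * (\<bar>f y\<bar> * (1 + sqdist x y) ^ N) \<le> (1 + sqdist x y) * (\<bar>f y\<bar> * (1 + sqdist x y) ^ N)"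
      by (intro mult_right_mono coord_le_sqdist mult_nonneg_nonneg) auto
    also have "\<dots> \<le> C" using C[of y] by (simp add: algebra_simps)
    finally show ?thesis by (simp add: abs_mult mult.assoc mult_left_mono)
  qed
  then show "\<exists>C. \<forall>y. \<bar>c * (y $ i - x $ i) * f y\<bar> * (1 + sqdist x y) ^ N \<le> C" by blast
qed

lemma rapid_0_cmult:
  assumes "rapid0 x f" shows "rapid0 x (\<lambda>y. c * f y)"
  unfolding rapid0_def
proof
  fix N
  obtain C where C: "\<And>y. \<bar>f y\<bar> * (1 + sqdist x y) ^ N \<le> C" using assms unfolding rapid0_def by meson
  then have "\<bar>c * f y\<bar> * (1 + sqdist x y) ^ N \<le> \<bar>c\<bar> * C" for y
    by (simp add: abs_mult mult.assoc mult_left_mono)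
  then show "\<exists>C. \<forall>y. \<bar>c * f y\<bar> * (1 + sqdist x y) ^ N \<le> C" by blast
qed

lemma pderiv_dir_cmult:
  assumes "smooth f" shows "pderiv_dir j (\<lambda>y. c * f y) = (\<lambda>y. c * pderiv_dir j f y)"
  using pderiv_dir_smooth_mult[OF smooth_const assms, of j c] by (simp add: pderiv_dir_const)

lemma rapid_cmult: "smooth f \<Longrightarrow> rapid x m f \<Longrightarrow> rapid x m (\<lambda>y. c * f y)"
proof (induction m arbitrary: f)
  case 0 show ?case using rapid_0_cmult 0 by simp
next
  case (Suc m)
  have "rapid x m (pderiv_dir j (\<lambda>y. c * f y))" for j
    unfolding pderiv_dir_cmult[OF Suc.prems(1)]
    by (rule Suc.IH) (use Suc.prems in \<open>auto intro: smooth_pderiv_dir\<close>)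
  then show ?case using rapid_0_cmult[OF rapid_0[OF Suc.prems(2)]] by simp
qed

lemma pderiv_dir_coord_mult:
  assumes "smooth f"
  shows "pderiv_dir j (\<lambda>y. c * (y $ i - x $ i) * f y)
     = (\<lambda>y. c * (y $ i - x $ i) * pderiv_dir j f y + (if i = j then c else 0) * f y)"
proof -
  have s: "smooth (\<lambda>y. c * (y $ i - x $ i))" by (intro smooth_mult smooth_const smooth_coord)
  show ?thesis
    unfolding pderiv_dir_smooth_mult[OF s assms] pderiv_dir_cmult[OF smooth_coord] pderiv_dir_coord
    by auto
qed

lemma rapid_coord: "smooth f \<Longrightarrow> rapid x m f \<Longrightarrow> rapid x m (\<lambda>y. c * (y $ i - x $ i) * f y)"
proof (induction m arbitrary: f)
  case 0 show ?case using rapid_0_coord 0 by simp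
next
  case (Suc m)
  have "rapid x m (pderiv_dir j (\<lambda>y. c * (y $ i - x $ i) * f y))" for j
    unfolding pderiv_dir_coord_mult[OF Suc.prems(1)]
    by (intro rapid_add Suc.IH rapid_cmult smooth_mult smooth_const smooth_coord)
       (use Suc.prems rapid_Suc_imp in \<open>auto intro: smooth_pderiv_dir\<close>)
  then show ?case using rapid_0_coord[OF rapid_0[OF Suc.prems(2)]] by simp
qed

lemma rapid_tower_rapid:
  assumes "rapid_tower F" shows "rapid x n (\<lambda>y. F m (sqdist x y))"
proof (induction n arbitrary: m)
  case 0
  show ?case using assms unfolding rapid_tower_def rapid.simps rapid0_def by (meson sqdist_nonneg)
next
  case (Suc n)
  have F: "smooth_tower F" using assms by (simp add: rapid_tower_def)
  have "rapid x n (pderiv_dir j (\<lambda>y. F m (sqdist x y)))" for j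
    unfolding pderiv_dir_tower[OF F] by (intro rapid_coord Suc smooth_tower_sqdist F)
  moreover have "rapid0 x (\<lambda>y. F m (sqdist x y))"
    using assms unfolding rapid_tower_def rapid0_def by (meson sqdist_nonneg)
  ultimately show ?case by simp
qed

lemma rapid_pderivs: "rapid x m f \<Longrightarrow> length js \<le> m \<Longrightarrow> rapid x (m - length js) (pderivs js f)"
proof (induction js)
  case (Cons j js)
  have "m - length js = Suc (m - length (j # js))" using Cons.prems by auto
  then have "rapid x (Suc (m - length (j # js))) (pderivs js f)" using Cons by auto
  then show ?case by auto
qed auto

lemma sqdist_2: "sqdist x (y :: real^2) = (y $ 1 - x $ 1)\<^sup>2 + (y $ 2 - x $ 2)\<^sup>2"
  by (simp add: sqdist_def inner_vec_def sum_2 power2_eq_square)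

lemma nn_integral_product_2:
  fixes h :: "2 \<Rightarrow> real \<Rightarrow> real"
  assumes [measurable]: "\<And>i. h i \<in> borel_measurable borel" and h: "\<And>i t. h i t \<ge> 0"
  shows "(\<integral>\<^sup>+ y. ennreal (h 1 (y $ 1) * h 2 (y $ 2)) \<partial>(lborel :: (real^2) measure))
     = (\<integral>\<^sup>+ t. ennreal (h 1 t) \<partial>lborel) * (\<integral>\<^sup>+ t. ennreal (h 2 t) \<partial>lborel)"
proof -
  have B: "Basis = {axis 1 1, axis 2 1 :: real^2}"
    by (auto simp: Basis_vec_def exhaust_2 axis_eq_axis) (metis exhaust_2)
  have ne: "axis 1 1 \<noteq> (axis 2 1 :: real^2)" by (simp add: axis_eq_axis)
  define H where "H b = (if b = axis 1 1 then h 1 else h 2)" for b :: "real^2"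
  have "(\<integral>\<^sup>+ y. (\<Prod>b\<in>Basis. (\<lambda>t. ennreal (H b t)) (y \<bullet> b)) \<partial>(lborel :: (real^2) measure))
      = (\<Prod>b\<in>(Basis :: (real^2) set). (\<integral>\<^sup>+ t. ennreal (H b t) \<partial>lborel))"
    by (rule nn_integral_lborel_prod) (auto simp: H_def)
  then show ?thesis
    unfolding B using ne by (simp add: inner_axis h ennreal_mult H_def)
qed

lemma nn_integral_even_finite:
  fixes h :: "real \<Rightarrow> real"
  assumes [measurable]: "h \<in> borel_measurable borel" and even: "\<And>t. h (- t) = h t"
    and fin: "(\<integral>\<^sup>+ t. ennreal (h t) * indicator {0..} t \<partial>lborel) < \<infinity>"
  shows "(\<integral>\<^sup>+ t. ennreal (h (t - a)) \<partial>lborel) < \<infinity>"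
proof -
  have "(\<integral>\<^sup>+ t. ennreal (h (t - a)) \<partial>lborel) = (\<integral>\<^sup>+ t. ennreal (h t) \<partial>lborel)"
    by (subst nn_integral_real_affine[where c = 1 and t = a]) auto
  also have "\<dots> \<le> (\<integral>\<^sup>+ t. ennreal (h t) * indicator {0..} t + ennreal (h t) * indicator {0..} (- t) \<partial>lborel)"
    by (intro nn_integral_mono) (auto simp: indicator_def)
  also have "\<dots> = (\<integral>\<^sup>+ t. ennreal (h t) * indicator {0..} t \<partial>lborel) + (\<integral>\<^sup>+ t. ennreal (h t) * indicator {0..} (- t) \<partial>lborel)"
    by (rule nn_integral_add) auto
  also have "(\<integral>\<^sup>+ t. ennreal (h t) * indicator {0..} (- t) \<partial>lborel) = (\<integral>\<^sup>+ t. ennreal (h t) * indicator {0..} t \<partial>lborel)"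
    by (subst nn_integral_real_affine[where c = "-1" and t = 0]) (auto simp: even)
  finally show ?thesis using fin by (auto simp: ennreal_add_less_top elim!: le_less_trans)
qed

lemma nn_integral_inverse_quadratic: "(\<integral>\<^sup>+ t. ennreal (1 / (1 + (t - a)\<^sup>2)) \<partial>lborel) < \<infinity>"
proof (rule nn_integral_even_finite)
  have "(\<integral>\<^sup>+ t. ennreal (1 / (1 + t\<^sup>2)) * indicator {0..} t \<partial>lborel) = ennreal (pi / 2 - arctan 0)"
    by (rule nn_integral_FTC_atLeast)
      (auto intro!: derivative_eq_intros tendsto_arctan_at_top simp: field_simps add_nonneg_eq_0_iff)
  then show "(\<integral>\<^sup>+ t. ennreal (1 / (1 + t\<^sup>2)) * indicator {0..} t \<partial>lborel) < \<infinity>" by simp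
qed auto

text \<open>A bound of product form reduces square integrability in the plane to two integrals on the line.\<close>

lemma L2_of_product_bound:
  fixes W :: "real^2 \<Rightarrow> real" and h :: "2 \<Rightarrow> real \<Rightarrow> real"
  assumes W: "W \<in> borel_measurable borel" and [measurable]: "\<And>i. h i \<in> borel_measurable borel"
    and h: "\<And>i t. h i t \<ge> 0" and fin: "\<And>i. (\<integral>\<^sup>+ t. ennreal (h i t) \<partial>lborel) < \<infinity>"
    and b: "AE y in lborel. (W y)\<^sup>2 \<le> C * (h 1 (y $ 1) * h 2 (y $ 2))"
  shows "(\<lambda>y. complex_of_real (W y)) \<in> L2"
proof -
  note [measurable] = W
  have "C * (h 1 (y $ 1) * h 2 (y $ 2)) \<le> \<bar>C\<bar> * (h 1 (y $ 1) * h 2 (y $ 2))" for y :: "real^2"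
    by (intro mult_right_mono mult_nonneg_nonneg h) auto
  then have "AE y in lborel. ennreal ((W y)\<^sup>2) \<le> ennreal \<bar>C\<bar> * ennreal (h 1 (y $ 1) * h 2 (y $ 2))"
    using b by (auto simp: h ennreal_mult[symmetric] elim!: eventually_mono intro!: ennreal_leI intro: order_trans)
  then have "(\<integral>\<^sup>+ y. ennreal ((W y)\<^sup>2) \<partial>lborel) \<le> (\<integral>\<^sup>+ y. ennreal \<bar>C\<bar> * ennreal (h 1 (y $ 1) * h 2 (y $ 2)) \<partial>(lborel :: (real^2) measure))"
    by (rule nn_integral_mono_AE)
  also have "\<dots> = ennreal \<bar>C\<bar> * (\<integral>\<^sup>+ y. ennreal (h 1 (y $ 1) * h 2 (y $ 2)) \<partial>(lborel :: (real^2) measure))"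
    by (rule nn_integral_cmult) measurable
  also have "\<dots> < \<infinity>"
    unfolding nn_integral_product_2[of h, OF assms(2) h] using fin[of 1] fin[of 2]
    by (auto simp: ennreal_mult_less_top)
  finally have "integrable lborel (\<lambda>y. (W y)\<^sup>2)"
    by (intro integrableI_nonneg) auto
  then have "integrable lebesgue (\<lambda>y. (W y)\<^sup>2)" by (subst integrable_completion) auto
  moreover have "(\<lambda>y. complex_of_real (W y)) \<in> borel_measurable lebesgue"
    by (rule measurable_completion) measurable
  ultimately show ?thesis by (simp add: L2_def)
qed

lemma continuous_inverse_sqdist: "continuous_on UNIV (\<lambda>y. C / (1 + sqdist x y))"
  unfolding sqdist_def by (intro continuous_intros) (metis add_nonneg_eq_0_iff inner_ge_zero zero_le_one zero_neq_one)

lemma inverse_sqdist_L2: "(\<lambda>y. complex_of_real (C / (1 + sqdist x y))) \<in> (L2 :: (real^2 \<Rightarrow> complex) set)"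
proof (rule L2_of_product_bound)
  show "(\<lambda>y. C / (1 + sqdist x y)) \<in> borel_measurable borel"
    by (rule borel_measurable_continuous_onI[OF continuous_inverse_sqdist])
  show "AE y in lborel. (C / (1 + sqdist x y))\<^sup>2 \<le> C\<^sup>2 * (1 / (1 + (y $ 1 - x $ 1)\<^sup>2) * (1 / (1 + (y $ 2 - x $ 2)\<^sup>2)))"
  proof (rule AE_I2)
    fix y :: "real^2"
    have "(1 + (y $ 1 - x $ 1)\<^sup>2) * (1 + (y $ 2 - x $ 2)\<^sup>2) \<le> (1 + sqdist x y) * (1 + sqdist x y)"
      by (intro mult_mono) (auto simp: sqdist_2)
    moreover have "(1 + (y $ 1 - x $ 1)\<^sup>2) * (1 + (y $ 2 - x $ 2)\<^sup>2) > 0"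
      by (intro mult_pos_pos) (auto intro: add_pos_nonneg)
    ultimately have "C\<^sup>2 / ((1 + sqdist x y) * (1 + sqdist x y)) \<le> C\<^sup>2 / ((1 + (y $ 1 - x $ 1)\<^sup>2) * (1 + (y $ 2 - x $ 2)\<^sup>2))"
      by (intro divide_left_mono mult_pos_pos) (auto intro: add_pos_nonneg)
    then show "(C / (1 + sqdist x y))\<^sup>2 \<le> C\<^sup>2 * (1 / (1 + (y $ 1 - x $ 1)\<^sup>2) * (1 / (1 + (y $ 2 - x $ 2)\<^sup>2)))"
      by (simp add: power_divide power2_eq_square)
  qed
  show "(\<integral>\<^sup>+ t. ennreal (1 / (1 + (t - x $ i)\<^sup>2)) \<partial>lborel) < \<infinity>" for i
    by (rule nn_integral_inverse_quadratic)
qed auto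

definition cutoff :: "real \<Rightarrow> nat \<Rightarrow> real \<Rightarrow> real" where
  "cutoff c m t = c ^ m * bump m (c * t)"

lemma cutoff_tower: "smooth_tower (cutoff c)"
  unfolding smooth_tower_def cutoff_def
  by (auto intro!: derivative_eq_intros DERIV_chain'[OF _ bump_tower[unfolded smooth_tower_def, rule_format]])

lemma pderivs_tower_2:
  assumes "smooth_tower F"
  shows "pderivs [i, j] (\<lambda>y. F 0 (sqdist x y)) = (\<lambda>y. 4 * (y $ i - x $ i) * (y $ j - x $ j) * F 2 (sqdist x y) + (if i = j then 2 * F 1 (sqdist x y) else 0))"
proof -
  have "pderivs [i, j] (\<lambda>y. F 0 (sqdist x y)) = pderiv_dir i (\<lambda>y. 2 * (y $ j - x $ j) * F 1 (sqdist x y))"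
    using pderiv_dir_tower[OF assms, of j 0 x] by simp
  also have "\<dots> = (\<lambda>y. 4 * (y $ i - x $ i) * (y $ j - x $ j) * F 2 (sqdist x y) + (if i = j then 2 * F 1 (sqdist x y) else 0))"
    unfolding pderiv_dir_coord_mult[OF smooth_tower_sqdist[OF assms]] pderiv_dir_tower[OF assms]
    by (auto simp: numeral_2_eq_2 algebra_simps)
  finally show ?thesis .
qed

lemma pderivs_1_1_mult:
  assumes "smooth f" "smooth g"
  shows "pderivs [i, j] (\<lambda>y. f y * g y) = (\<lambda>y. f y * pderivs [i, j] g y + pderiv_dir i f y * pderiv_dir j g y
      + pderiv_dir j f y * pderiv_dir i g y + pderivs [i, j] f y * g y)"
  using assms
  by (simp add: pderiv_dir_smooth_mult pderiv_dir_smooth_add smooth_mult smooth_pderiv_dir fun_eq_iff)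

text \<open>On the support of the cutoff \<open>c |y|\<^sup>2 \<le> 1\<close>, so a factor \<open>c y\<^sub>i\<close> produced by a differentiation is at
  most \<open>sqrt c\<close>: derivatives of the cutoff vanish in the limit \<open>c \<rightarrow> 0\<close>.\<close>

lemma cutoff_derivs_bounded:
  obtains B where "\<And>c (y :: real^'n::finite). 0 < c \<Longrightarrow> c \<le> 1 \<Longrightarrow> \<bar>cutoff c 0 (sqdist 0 y)\<bar> \<le> B"
    "\<And>c y i. 0 < c \<Longrightarrow> c \<le> 1 \<Longrightarrow> \<bar>pderiv_dir i (\<lambda>y::real^'n. cutoff c 0 (sqdist 0 y)) y\<bar> \<le> B * sqrt c"
    "\<And>c y i j. 0 < c \<Longrightarrow> c \<le> 1 \<Longrightarrow> \<bar>pderivs [i,j] (\<lambda>y::real^'n. cutoff c 0 (sqdist 0 y)) y\<bar> \<le> B * sqrt c"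
proof -
  obtain B0 B1 B2 where B: "\<And>t. t \<ge> 0 \<Longrightarrow> \<bar>bump 0 t\<bar> \<le> B0" "\<And>t. t \<ge> 0 \<Longrightarrow> \<bar>bump 1 t\<bar> \<le> B1" "\<And>t. t \<ge> 0 \<Longrightarrow> \<bar>bump 2 t\<bar> \<le> B2"
    using bump_bounded by metis
  have Bp: "B0 \<ge> 0" "B1 \<ge> 0" "B2 \<ge> 0" using B(1)[of 0] B(2)[of 0] B(3)[of 0] by auto
  define B' where "B' = B0 + 2 * B1 + 4 * B2"
  have comp: "\<bar>y $ i\<bar> * sqrt c \<le> 1" if "c > 0" "c * sqdist 0 y < 1" for c i and y :: "real^'n"
  proof -
    have "(\<bar>y $ i\<bar> * sqrt c)\<^sup>2 \<le> (norm y * sqrt c)\<^sup>2"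
      by (intro power_mono mult_right_mono component_le_norm_cart) (use that in auto)
    also have "\<dots> \<le> 1\<^sup>2" using that by (simp add: power_mult_distrib sqdist_def dot_square_norm mult.commute)
    finally show ?thesis by (rule power2_le_imp_le) simp
  qed
  have sq: "c \<le> sqrt c" if "0 < c" "c \<le> 1" for c :: real
    using that by (simp add: real_le_rsqrt power2_eq_square mult_left_le)
  show thesis
  proof (rule that[of B'])
    fix c :: real and y :: "real^'n" assume c: "0 < c" "c \<le> 1"
    show "\<bar>cutoff c 0 (sqdist 0 y)\<bar> \<le> B'"
      using B(1)[of "c * sqdist 0 y"] c Bp by (simp add: cutoff_def B'_def)
    fix i j
    have c2: "c = sqrt c * sqrt c" using c by simp
    have out: "bump n (c * sqdist 0 y) = 0" if "\<not> c * sqdist 0 y < 1" for n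
      using that bump_outside by simp
    show "\<bar>pderiv_dir i (\<lambda>y::real^'n. cutoff c 0 (sqdist 0 y)) y\<bar> \<le> B' * sqrt c"
    proof (cases "c * sqdist 0 y < 1")
      case True
      have "\<bar>pderiv_dir i (\<lambda>y::real^'n. cutoff c 0 (sqdist 0 y)) y\<bar> = 2 * (\<bar>y $ i\<bar> * sqrt c) * \<bar>bump 1 (c * sqdist 0 y)\<bar> * sqrt c"
        unfolding pderiv_dir_tower[OF cutoff_tower] using c2 c by (simp add: cutoff_def abs_mult)
      also have "\<dots> \<le> 2 * 1 * B1 * sqrt c"
        by (intro mult_right_mono mult_mono mult_left_mono comp[OF c(1) True] B) (use c Bp in auto)
      also have "\<dots> \<le> B' * sqrt c" using Bp c by (intro mult_right_mono) (auto simp: B'_def)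
      finally show ?thesis .
    next
      case False
      then show ?thesis unfolding pderiv_dir_tower[OF cutoff_tower] using Bp c by (simp add: cutoff_def out B'_def)
    qed
    show "\<bar>pderivs [i,j] (\<lambda>y::real^'n. cutoff c 0 (sqdist 0 y)) y\<bar> \<le> B' * sqrt c"
    proof (cases "c * sqdist 0 y < 1")
      case True
      have "pderivs [i,j] (\<lambda>y::real^'n. cutoff c 0 (sqdist 0 y)) y
         = (4 * (y $ i * sqrt c) * (y $ j * sqrt c) * bump 2 (c * sqdist 0 y) + (if i = j then 2 * bump 1 (c * sqdist 0 y) else 0)) * c"
        unfolding pderivs_tower_2[OF cutoff_tower] using c2 c by (simp add: cutoff_def abs_mult power2_eq_square algebra_simps)
      also have "\<bar>\<dots>\<bar> \<le> (4 * B2 + 2 * B1) * c"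
        unfolding abs_mult[of _ c] abs_of_pos[OF c(1)]
      proof (intro mult_right_mono)
        have "\<bar>4 * (y $ i * sqrt c) * (y $ j * sqrt c) * bump 2 (c * sqdist 0 y)\<bar> = 4 * (\<bar>y $ i\<bar> * sqrt c) * (\<bar>y $ j\<bar> * sqrt c) * \<bar>bump 2 (c * sqdist 0 y)\<bar>"
          using c by (simp add: abs_mult)
        also have "\<dots> \<le> 4 * 1 * 1 * B2"
          by (intro mult_right_mono mult_mono mult_left_mono comp[OF c(1) True] B) (use c Bp in auto)
        finally show "\<bar>4 * (y $ i * sqrt c) * (y $ j * sqrt c) * bump 2 (c * sqdist 0 y) + (if i = j then 2 * bump 1 (c * sqdist 0 y) else 0)\<bar> \<le> 4 * B2 + 2 * B1"
          using B(2)[of "c * sqdist 0 y"] c Bp by (auto split: if_splits)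
      qed (use c in auto)
      also have "\<dots> \<le> B' * sqrt c" using Bp sq[OF c] c by (intro mult_mono) (auto simp: B'_def)
      finally show ?thesis .
    next
      case False
      then show ?thesis unfolding pderivs_tower_2[OF cutoff_tower] using Bp c by (simp add: cutoff_def out B'_def)
    qed
  qed
qed

lemma pderiv_dir_borel: "smooth f \<Longrightarrow> pderivs js f \<in> borel_measurable borel"
  by (intro borel_measurable_continuous_onI smooth_continuous smooth_pderivs)

lemma wirtinger2_borel: "smooth f \<Longrightarrow> wirtinger2 e f \<in> borel_measurable borel"
  unfolding wirtinger2_def[abs_def]
  by (intro borel_measurable_add borel_measurable_times borel_measurable_const
      measurable_compose[OF pderiv_dir_borel borel_measurable_of_real])

lemma borel_lebesgue: "f \<in> borel_measurable borel \<Longrightarrow> f \<in> borel_measurable lebesgue"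
  by (simp add: measurable_completion)

lemma norm_sum3: "norm (a::'a::real_normed_vector) \<le> A \<Longrightarrow> norm b \<le> B \<Longrightarrow> norm (a + b) \<le> A + B"
  by (meson add_mono norm_triangle_ineq order_trans)

text \<open>Compact support of the test function may be relaxed to rapid decay: multiply by cutoffs, and let the
  radius grow.  All terms containing a derivative of the cutoff disappear by dominated convergence.\<close>

lemma weak_identity_rapid:
  fixes u g :: "real^2 \<Rightarrow> complex"
  assumes u: "u \<in> L2" and g: "g \<in> L2" and e: "norm e = 1"
    and weak: "\<And>\<phi>. \<phi> \<in> test_functions \<Longrightarrow> (LINT x|lebesgue. wirtinger2 e \<phi> x * u x) = (LINT x|lebesgue. \<phi> x *\<^sub>R g x)"
    and \<psi>: "smooth \<psi>" "rapid x0 2 \<psi>"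
  shows "(LINT x|lebesgue. wirtinger2 e \<psi> x * u x) = (LINT x|lebesgue. \<psi> x *\<^sub>R g x)"
proof -
  have "\<exists>C. \<forall>y. \<bar>pderivs js \<psi> y\<bar> \<le> C / (1 + sqdist x0 y)" if js: "length js \<le> 2" for js
  proof -
    have "rapid0 x0 (pderivs js \<psi>)" using rapid_pderivs[OF \<psi>(2) js] rapid_0 by blast
    then obtain C where "\<And>y. \<bar>pderivs js \<psi> y\<bar> * (1 + sqdist x0 y) ^ 1 \<le> C" unfolding rapid0_def by blast
    moreover have "1 + sqdist x0 y > 0" for y by (rule add_pos_nonneg) auto
    ultimately show ?thesis by (auto simp: pos_le_divide_eq intro!: exI[of _ C])
  qed
  then obtain Cf where Cf: "\<And>js y. length js \<le> 2 \<Longrightarrow> \<bar>pderivs js \<psi> y\<bar> \<le> Cf js / (1 + sqdist x0 y)" by metis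
  define S where "S = {js :: 2 list. length js \<le> 2}"
  have finS: "finite S" unfolding S_def using finite_lists_length_le[of "UNIV :: 2 set" 2] by simp
  define C where "C = (\<Sum>js\<in>S. \<bar>Cf js\<bar>)"
  define W where "W y = C / (1 + sqdist x0 y)" for y
  have pos: "1 + sqdist x0 y > 0" for y by (rule add_pos_nonneg) auto
  have W: "\<bar>pderivs js \<psi> y\<bar> \<le> W y" if "length js \<le> 2" for js y
  proof -
    have "Cf js \<le> C" unfolding C_def
      using member_le_sum[of js S "\<lambda>js. \<bar>Cf js\<bar>"] that finS by (auto simp: S_def)
    then have "Cf js / (1 + sqdist x0 y) \<le> W y" using pos[of y] by (simp add: W_def divide_right_mono)
    then show ?thesis using Cf[OF that] by (meson order_trans)
  qed
  have W0: "W y \<ge> 0" for y using W[of "[]" y] abs_ge_zero[of "\<psi> y"] by simp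
  have WL: "(\<lambda>y. complex_of_real (W y)) \<in> L2" unfolding W_def by (rule inverse_sqdist_L2)
  have Wint: "integrable lebesgue (\<lambda>y. W y * norm (v y))" if "v \<in> L2" for v :: "real^2 \<Rightarrow> complex"
    using Bochner_Integration.integrable_norm[OF L2_mult_integrable[OF WL that]] W0 by (simp add: norm_mult)
  obtain B where B: "\<And>c (y :: real^2). 0 < c \<Longrightarrow> c \<le> 1 \<Longrightarrow> \<bar>cutoff c 0 (sqdist 0 y)\<bar> \<le> B"
    "\<And>c y i. 0 < c \<Longrightarrow> c \<le> 1 \<Longrightarrow> \<bar>pderiv_dir i (\<lambda>y::real^2. cutoff c 0 (sqdist 0 y)) y\<bar> \<le> B * sqrt c"
    "\<And>c y i j. 0 < c \<Longrightarrow> c \<le> 1 \<Longrightarrow> \<bar>pderivs [i,j] (\<lambda>y::real^2. cutoff c 0 (sqdist 0 y)) y\<bar> \<le> B * sqrt c"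
    using cutoff_derivs_bounded[where 'n=2] by metis
  have B0: "B \<ge> 0" using B(1)[of 1 0] by auto
  define c where "c n = 1 / real (Suc n)" for n
  have c: "0 < c n" "c n \<le> 1" for n by (auto simp: c_def)
  have c0: "c \<longlonglongrightarrow> 0" unfolding c_def using LIMSEQ_inverse_real_of_nat by (simp add: inverse_eq_divide)
  have sc0: "(\<lambda>n. sqrt (c n)) \<longlonglongrightarrow> 0" using tendsto_real_sqrt[OF c0] by simp
  have sc1: "sqrt (c n) \<le> 1" "0 \<le> sqrt (c n)" for n using c[of n] by auto
  define \<eta> where "\<eta> n y = cutoff (c n) 0 (sqdist 0 y)" for n and y :: "real^2"
  have \<eta>s: "smooth (\<eta> n)" for n unfolding \<eta>_def[abs_def] by (rule smooth_tower_sqdist[OF cutoff_tower])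
  have \<eta>1: "(\<lambda>n. \<eta> n y) \<longlonglongrightarrow> 1" for y
  proof -
    have "isCont (bump 0) 0" using smooth_tower_continuous[OF bump_tower, of 0] by (simp add: continuous_on_eq_continuous_at)
    moreover have "(\<lambda>n. c n * sqdist 0 y) \<longlonglongrightarrow> 0" using tendsto_mult_right[OF c0, of "sqdist 0 y"] by simp
    ultimately have "(\<lambda>n. bump 0 (c n * sqdist 0 y)) \<longlonglongrightarrow> bump 0 0" by (rule isCont_tendsto_compose)
    then show ?thesis by (simp add: \<eta>_def cutoff_def bump_0)
  qed
  have Bd: "\<bar>\<eta> n y\<bar> \<le> B" "\<bar>pderiv_dir i (\<eta> n) y\<bar> \<le> B * sqrt (c n)" "\<bar>pderivs [i,j] (\<eta> n) y\<bar> \<le> B * sqrt (c n)" for n y i j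
    using B(1)[OF c] B(2)[OF c] B(3)[OF c] unfolding \<eta>_def[abs_def] by blast+
  have small: "(\<lambda>n. h n) \<longlonglongrightarrow> 0" if "\<And>n. \<bar>h n\<bar> \<le> B * sqrt (c n)" for h
    by (rule Lim_null_comparison[where g = "\<lambda>n. B * sqrt (c n)"])
       (use that tendsto_mult_right_zero[OF sc0, of B] in auto)
  have \<eta>d: "(\<lambda>n. pderiv_dir i (\<eta> n) y) \<longlonglongrightarrow> 0" "(\<lambda>n. pderivs [i,j] (\<eta> n) y) \<longlonglongrightarrow> 0" for i j y
    by (rule small, rule Bd)+
  define \<phi> where "\<phi> n y = \<eta> n y * \<psi> y" for n y
  have \<phi>t: "\<phi> n \<in> test_functions" for n
  proof (rule test_functionsI)
    show "smooth (\<phi> n)" unfolding \<phi>_def[abs_def] by (intro smooth_mult \<eta>s \<psi>)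
    show "compact (cball 0 (sqrt (1 / c n)) :: (real^2) set)" by simp
    fix y :: "real^2" assume "y \<notin> cball 0 (sqrt (1 / c n))"
    then have "sqrt (1 / c n) < norm y" by simp
    then have "1 / c n < (norm y)\<^sup>2"
      using power_strict_mono[of "sqrt (1 / c n)" "norm y" 2] c(1)[of n] by simp
    then have "1 \<le> c n * sqdist 0 y" using c(1)[of n] by (simp add: sqdist_def dot_square_norm field_simps)
    then show "\<phi> n y = 0" by (simp add: \<phi>_def \<eta>_def cutoff_def bump_outside)
  qed
  have exp2: "pderivs [i,j] (\<phi> n) y = \<eta> n y * pderivs [i,j] \<psi> y + pderiv_dir i (\<eta> n) y * pderiv_dir j \<psi> y
      + pderiv_dir j (\<eta> n) y * pderiv_dir i \<psi> y + pderivs [i,j] (\<eta> n) y * \<psi> y" for i j n y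
    unfolding \<phi>_def[abs_def] pderivs_1_1_mult[OF \<eta>s \<psi>(1)] ..
  have lim2: "(\<lambda>n. pderivs [i,j] (\<phi> n) y) \<longlonglongrightarrow> pderivs [i,j] \<psi> y" for i j y
  proof -
    have "(\<lambda>n. pderivs [i,j] (\<phi> n) y) \<longlonglongrightarrow> 1 * pderivs [i,j] \<psi> y + 0 * pderiv_dir j \<psi> y + 0 * pderiv_dir i \<psi> y + 0 * \<psi> y"
      unfolding exp2 by (intro tendsto_add tendsto_mult tendsto_const \<eta>1 \<eta>d)
    then show ?thesis by simp
  qed
  have bnd2: "\<bar>pderivs [i,j] (\<phi> n) y\<bar> \<le> 4 * B * W y" for i j n y
  proof -
    have b: "\<bar>pderiv_dir i (\<eta> n) y\<bar> \<le> B" "\<bar>pderivs [i,j] (\<eta> n) y\<bar> \<le> B" for i j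
      using Bd(2)[of i n y] Bd(3)[of i j n y] mult_left_mono[OF sc1(1)[of n] B0] by auto
    have m: "\<bar>s * t\<bar> \<le> B * W y" if "\<bar>s\<bar> \<le> B" "\<bar>t\<bar> \<le> W y" for s t
      unfolding abs_mult using that B0 by (intro mult_mono) auto
    have "\<bar>\<eta> n y * pderivs [i,j] \<psi> y\<bar> \<le> B * W y" "\<bar>pderiv_dir i (\<eta> n) y * pderiv_dir j \<psi> y\<bar> \<le> B * W y"
      "\<bar>pderiv_dir j (\<eta> n) y * pderiv_dir i \<psi> y\<bar> \<le> B * W y" "\<bar>pderivs [i,j] (\<eta> n) y * \<psi> y\<bar> \<le> B * W y"
      using m[OF Bd(1) W[of "[i,j]"]] m[OF b(1)[of i] W[of "[j]"]] m[OF b(1)[of j] W[of "[i]"]] m[OF b(2)[of i j] W[of "[]"]] by auto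
    then show ?thesis unfolding exp2 by linarith
  qed
  have bw: "norm (wirtinger2 e (\<phi> n) y) \<le> 16 * B * W y" for n y
  proof -
    have "norm (of_real (pderivs [1,1] (\<phi> n) y) :: complex) \<le> 4 * B * W y"
      "norm (e * of_real (pderivs [2,1] (\<phi> n) y)) \<le> 4 * B * W y"
      "norm (e * of_real (pderivs [1,2] (\<phi> n) y)) \<le> 4 * B * W y"
      "norm (e\<^sup>2 * of_real (pderivs [2,2] (\<phi> n) y)) \<le> 4 * B * W y"
      using bnd2 by (auto simp: norm_mult norm_power e simp del: pderivs.simps)
    from norm_sum3[OF norm_sum3[OF norm_sum3[OF this(1,2)] this(3)] this(4)]
    show ?thesis unfolding wirtinger2_def by simp
  qed
  have lw: "(\<lambda>n. wirtinger2 e (\<phi> n) y) \<longlonglongrightarrow> wirtinger2 e \<psi> y" for y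
    unfolding wirtinger2_def by (intro tendsto_intros lim2)
  have um: "u \<in> borel_measurable lebesgue" "g \<in> borel_measurable lebesgue" using u g by (auto simp: L2_def)
  have "(\<lambda>n. LINT x|lebesgue. wirtinger2 e (\<phi> n) x * u x) \<longlonglongrightarrow> (LINT x|lebesgue. wirtinger2 e \<psi> x * u x)"
  proof (rule integral_dominated_convergence)
    show "integrable lebesgue (\<lambda>y. (16 * B) * (W y * norm (u y)))" by (intro integrable_mult_right Wint u)
    show "AE x in lebesgue. (\<lambda>n. wirtinger2 e (\<phi> n) x * u x) \<longlonglongrightarrow> wirtinger2 e \<psi> x * u x"
      by (intro AE_I2 tendsto_intros lw)
    show "AE x in lebesgue. norm (wirtinger2 e (\<phi> n) x * u x) \<le> (16 * B) * (W x * norm (u x))" for n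
      using mult_right_mono[OF bw norm_ge_zero] by (intro AE_I2) (simp add: norm_mult mult.assoc)
    show "(\<lambda>x. wirtinger2 e \<psi> x * u x) \<in> borel_measurable lebesgue"
      by (intro borel_measurable_times um borel_lebesgue wirtinger2_borel \<psi>)
    show "(\<lambda>x. wirtinger2 e (\<phi> n) x * u x) \<in> borel_measurable lebesgue" for n
      by (intro borel_measurable_times um borel_lebesgue wirtinger2_borel test_functions_smooth \<phi>t)
  qed
  moreover have "(\<lambda>n. LINT x|lebesgue. \<phi> n x *\<^sub>R g x) \<longlonglongrightarrow> (LINT x|lebesgue. \<psi> x *\<^sub>R g x)"
  proof (rule integral_dominated_convergence)
    show "integrable lebesgue (\<lambda>y. B * (W y * norm (g y)))" by (intro integrable_mult_right Wint g)
    have "(\<lambda>n. \<phi> n x) \<longlonglongrightarrow> \<psi> x" for x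
      using tendsto_mult_right[OF \<eta>1, of x "\<psi> x"] by (simp add: \<phi>_def)
    then show "AE x in lebesgue. (\<lambda>n. \<phi> n x *\<^sub>R g x) \<longlonglongrightarrow> \<psi> x *\<^sub>R g x"
      by (intro AE_I2 tendsto_intros)
    have "\<bar>\<phi> n x\<bar> \<le> B * W x" for n x
      unfolding \<phi>_def abs_mult using Bd(1) W[of "[]" x] B0 by (intro mult_mono) auto
    then show "AE x in lebesgue. norm (\<phi> n x *\<^sub>R g x) \<le> B * (W x * norm (g x))" for n
      using mult_right_mono[OF _ norm_ge_zero] by (intro AE_I2) (simp add: mult.assoc[symmetric] mult_right_mono)
    show "(\<lambda>x. \<psi> x *\<^sub>R g x) \<in> borel_measurable lebesgue"
      by (intro borel_measurable_scaleR um borel_lebesgue borel_measurable_continuous_onI smooth_continuous \<psi>)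
    show "(\<lambda>x. \<phi> n x *\<^sub>R g x) \<in> borel_measurable lebesgue" for n
      by (intro borel_measurable_scaleR um borel_lebesgue borel_measurable_continuous_onI smooth_continuous test_functions_smooth \<phi>t)
  qed
  moreover have "(LINT x|lebesgue. wirtinger2 e (\<phi> n) x * u x) = (LINT x|lebesgue. \<phi> n x *\<^sub>R g x)" for n
    by (rule weak[OF \<phi>t])
  ultimately show ?thesis using LIMSEQ_unique by fastforce
qed

section \<open>Radial test functions and the representation formula\<close>

text \<open>The complex analogue of a tower, with rapid decay of every member on the half line.\<close>

definition rapid_ctower :: "(nat \<Rightarrow> real \<Rightarrow> complex) \<Rightarrow> bool" where
  "rapid_ctower F \<longleftrightarrow> (\<forall>m t. (F m has_vector_derivative F (Suc m) t) (at t))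
     \<and> (\<forall>m N. \<exists>C. \<forall>t\<ge>0. norm (F m t) * (1 + t) ^ N \<le> C)"

lemma rapid_ctower_Re_Im:
  assumes "rapid_ctower F"
  shows "rapid_tower (\<lambda>m t. Re (F m t))" "rapid_tower (\<lambda>m t. Im (F m t))"
proof -
  have d: "((\<lambda>t. Re (F m t)) has_real_derivative Re (F (Suc m) t)) (at t)" "((\<lambda>t. Im (F m t)) has_real_derivative Im (F (Suc m) t)) (at t)" for m t
    using assms unfolding rapid_ctower_def
    by (auto simp: has_real_derivative_iff_has_vector_derivative intro: bounded_linear.has_vector_derivative bounded_linear_Re bounded_linear_Im)
  have b: "\<exists>C. \<forall>t\<ge>0. \<bar>Re (F m t)\<bar> * (1 + t) ^ N \<le> C" "\<exists>C. \<forall>t\<ge>0. \<bar>Im (F m t)\<bar> * (1 + t) ^ N \<le> C" for m N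
  proof -
    obtain C where C: "\<And>t. t \<ge> 0 \<Longrightarrow> norm (F m t) * (1 + t) ^ N \<le> C" using assms unfolding rapid_ctower_def by meson
    have "\<bar>Re (F m t)\<bar> * (1 + t) ^ N \<le> C" "\<bar>Im (F m t)\<bar> * (1 + t) ^ N \<le> C" if "t \<ge> 0" for t
      using C[OF that] that abs_Re_le_cmod[of "F m t"] abs_Im_le_cmod[of "F m t"]
      by (meson add_nonneg_nonneg mult_right_mono order_trans zero_le_one zero_le_power)+
    then show "\<exists>C. \<forall>t\<ge>0. \<bar>Re (F m t)\<bar> * (1 + t) ^ N \<le> C" "\<exists>C. \<forall>t\<ge>0. \<bar>Im (F m t)\<bar> * (1 + t) ^ N \<le> C" by blast+
  qed
  show "rapid_tower (\<lambda>m t. Re (F m t))" "rapid_tower (\<lambda>m t. Im (F m t))"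
    using d b by (auto simp: rapid_tower_def smooth_tower_def)
qed

lemma wirtinger2_tower:
  assumes "smooth_tower R"
  shows "wirtinger2 e (\<lambda>y. R 0 (sqdist x y)) y
    = 4 * (of_real (y $ 1 - x $ 1) + e * of_real (y $ 2 - x $ 2))\<^sup>2 * of_real (R 2 (sqdist x y)) + 2 * (1 + e\<^sup>2) * of_real (R 1 (sqdist x y))"
  unfolding wirtinger2_def pderivs_tower_2[OF assms]
  by (simp add: power2_eq_square algebra_simps)

lemma pderivs_coord_product:
  "pderiv_dir i (\<lambda>y. (y $ a - x $ a) * (y $ b - x $ b)) = (\<lambda>y. (if a = i then y $ b - x $ b else 0) + (if b = i then y $ a - x $ a else 0))"
  "pderivs [i, j] (\<lambda>y. (y $ a - x $ a) * (y $ b - x $ b)) = (\<lambda>y. (if a = j \<and> b = i then 1 else 0) + (if b = j \<and> a = i then 1 else 0))"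
proof -
  show *: "pderiv_dir i (\<lambda>y. (y $ a - x $ a) * (y $ b - x $ b)) = (\<lambda>y. (if a = i then y $ b - x $ b else 0) + (if b = i then y $ a - x $ a else 0))" for i
    unfolding pderiv_dir_smooth_mult[OF smooth_coord smooth_coord] pderiv_dir_coord by auto
  have s: "smooth (\<lambda>y. if Q then y $ b - x $ b else 0)" for Q and b :: 'a
    by (cases Q) (simp_all add: smooth_coord smooth_const)
  have p: "pderiv_dir i (\<lambda>y. if Q then y $ b - x $ b else 0) = (\<lambda>y. if Q \<and> b = i then 1 else 0)" for Q and b :: 'a
    by (cases Q) (auto simp: pderiv_dir_coord pderiv_dir_const)
  show "pderivs [i, j] (\<lambda>y. (y $ a - x $ a) * (y $ b - x $ b)) = (\<lambda>y. (if a = j \<and> b = i then 1 else 0) + (if b = j \<and> a = i then 1 else 0))"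
    unfolding pderivs.simps * pderiv_dir_smooth_add[OF s s] p ..
qed

lemma wirtinger2_coord_product_tower:
  fixes x y :: "real^2"
  assumes "smooth_tower R"
  defines "Y1 \<equiv> complex_of_real (y $ 1 - x $ 1)" and "Y2 \<equiv> complex_of_real (y $ 2 - x $ 2)"
    and "r0 \<equiv> complex_of_real (R 0 (sqdist x y))" and "r1 \<equiv> complex_of_real (R 1 (sqdist x y))" and "r2 \<equiv> complex_of_real (R 2 (sqdist x y))"
  shows "wirtinger2 e (\<lambda>y. ((y $ 1 - x $ 1) * (y $ 1 - x $ 1)) * R 0 (sqdist x y)) y
     = Y1\<^sup>2 * (4 * (Y1 + e * Y2)\<^sup>2 * r2 + 2 * (1 + e\<^sup>2) * r1) + 8 * Y1 * (Y1 + e * Y2) * r1 + 2 * r0"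
   "wirtinger2 e (\<lambda>y. ((y $ 2 - x $ 2) * (y $ 2 - x $ 2)) * R 0 (sqdist x y)) y
     = Y2\<^sup>2 * (4 * (Y1 + e * Y2)\<^sup>2 * r2 + 2 * (1 + e\<^sup>2) * r1) + 8 * e * Y2 * (Y1 + e * Y2) * r1 + 2 * e\<^sup>2 * r0"
   "wirtinger2 e (\<lambda>y. ((y $ 1 - x $ 1) * (y $ 2 - x $ 2)) * R 0 (sqdist x y)) y
     = Y1 * Y2 * (4 * (Y1 + e * Y2)\<^sup>2 * r2 + 2 * (1 + e\<^sup>2) * r1) + 4 * (Y2 + e * Y1) * (Y1 + e * Y2) * r1 + 2 * e * r0"
proof -
  have s: "smooth (\<lambda>y. (y $ a - x $ a) * (y $ b - x $ b))" for a b by (intro smooth_mult smooth_coord)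
  have t: "smooth (\<lambda>y. R 0 (sqdist x y))" by (rule smooth_tower_sqdist[OF assms(1)])
  note E = wirtinger2_def pderivs_1_1_mult[OF s t] pderivs_tower_2[OF assms(1)] pderiv_dir_tower[OF assms(1)] pderivs_coord_product
  show "wirtinger2 e (\<lambda>y. ((y $ 1 - x $ 1) * (y $ 1 - x $ 1)) * R 0 (sqdist x y)) y
     = Y1\<^sup>2 * (4 * (Y1 + e * Y2)\<^sup>2 * r2 + 2 * (1 + e\<^sup>2) * r1) + 8 * Y1 * (Y1 + e * Y2) * r1 + 2 * r0"
    unfolding E by (simp add: Y1_def Y2_def r0_def r1_def r2_def power2_eq_square algebra_simps)
  show "wirtinger2 e (\<lambda>y. ((y $ 2 - x $ 2) * (y $ 2 - x $ 2)) * R 0 (sqdist x y)) y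
     = Y2\<^sup>2 * (4 * (Y1 + e * Y2)\<^sup>2 * r2 + 2 * (1 + e\<^sup>2) * r1) + 8 * e * Y2 * (Y1 + e * Y2) * r1 + 2 * e\<^sup>2 * r0"
    unfolding E by (simp add: Y1_def Y2_def r0_def r1_def r2_def power2_eq_square algebra_simps)
  show "wirtinger2 e (\<lambda>y. ((y $ 1 - x $ 1) * (y $ 2 - x $ 2)) * R 0 (sqdist x y)) y
     = Y1 * Y2 * (4 * (Y1 + e * Y2)\<^sup>2 * r2 + 2 * (1 + e\<^sup>2) * r1) + 4 * (Y2 + e * Y1) * (Y1 + e * Y2) * r1 + 2 * e * r0"
    unfolding E by (simp add: Y1_def Y2_def r0_def r1_def r2_def power2_eq_square algebra_simps)
qed

text \<open>The identity obtained by testing with a complex function \<open>\<Psi>\<close> whose image under the differential operator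
  is \<open>L\<close>.  Integrability is included to make the notion linear in the pair \<open>(\<Psi>, L)\<close>, so that complex test
  functions can be assembled from real ones.\<close>

definition weak_pair :: "(real^2 \<Rightarrow> complex) \<Rightarrow> (real^2 \<Rightarrow> complex) \<Rightarrow> (real^2 \<Rightarrow> complex) \<Rightarrow> (real^2 \<Rightarrow> complex) \<Rightarrow> bool" where
  "weak_pair u g \<Psi> L \<longleftrightarrow> integrable lebesgue (\<lambda>y. L y * u y) \<and> integrable lebesgue (\<lambda>y. \<Psi> y * g y)
     \<and> (LINT y|lebesgue. L y * u y) = (LINT y|lebesgue. \<Psi> y * g y)"

lemma weak_pair_add: "weak_pair u g \<Psi> L \<Longrightarrow> weak_pair u g \<Psi>' L' \<Longrightarrow> weak_pair u g (\<lambda>y. \<Psi> y + \<Psi>' y) (\<lambda>y. L y + L' y)"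
  by (simp add: weak_pair_def ring_distribs)

lemma weak_pair_cmult: "weak_pair u g \<Psi> L \<Longrightarrow> weak_pair u g (\<lambda>y. c * \<Psi> y) (\<lambda>y. c * L y)"
  by (simp add: weak_pair_def mult.assoc)

lemma rapid0_integrable:
  fixes v :: "real^2 \<Rightarrow> complex"
  assumes "v \<in> L2" "continuous_on UNIV \<Psi>" "\<And>y. norm (\<Psi> y) * (1 + sqdist x y) \<le> C"
  shows "integrable lebesgue (\<lambda>y. \<Psi> y * v y)"
proof (rule Bochner_Integration.integrable_bound)
  show "integrable lebesgue (\<lambda>y. complex_of_real (C / (1 + sqdist x y)) * v y)"
    by (rule L2_mult_integrable[OF inverse_sqdist_L2 assms(1)])
  show "(\<lambda>y. \<Psi> y * v y) \<in> borel_measurable lebesgue"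
    using assms(1) borel_lebesgue[OF borel_measurable_continuous_onI[OF assms(2)]]
    by (intro borel_measurable_times) (auto simp: L2_def)
  have "norm (\<Psi> y) \<le> C / (1 + sqdist x y)" for y
    using assms(3)[of y] by (simp add: pos_le_divide_eq add_pos_nonneg)
  then have "norm (\<Psi> y) \<le> norm (complex_of_real (C / (1 + sqdist x y)))" for y
    by (metis abs_ge_self norm_of_real order_trans)
  then show "AE y in lebesgue. norm (\<Psi> y * v y) \<le> norm (complex_of_real (C / (1 + sqdist x y)) * v y)"
    unfolding norm_mult by (intro AE_I2 mult_right_mono) auto
qed

lemma weak_pair_rapid:
  fixes u g :: "real^2 \<Rightarrow> complex"
  assumes u: "u \<in> L2" and g: "g \<in> L2" and e: "norm e = 1"
    and weak: "\<And>\<phi>. \<phi> \<in> test_functions \<Longrightarrow> (LINT x|lebesgue. wirtinger2 e \<phi> x * u x) = (LINT x|lebesgue. \<phi> x *\<^sub>R g x)"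
    and \<psi>: "smooth \<psi>" "rapid x 2 \<psi>"
  shows "weak_pair u g (\<lambda>y. of_real (\<psi> y)) (wirtinger2 e \<psi>)"
proof -
  have i: "integrable lebesgue (\<lambda>y. of_real (pderivs js \<psi> y) * v y)" if js: "length js \<le> 2" and v: "v \<in> L2" for js and v :: "real^2 \<Rightarrow> complex"
  proof -
    have "rapid0 x (pderivs js \<psi>)" using rapid_pderivs[OF \<psi>(2) js] rapid_0 by blast
    then obtain C where "\<And>y. \<bar>pderivs js \<psi> y\<bar> * (1 + sqdist x y) ^ 1 \<le> C" unfolding rapid0_def by meson
    then show ?thesis
      by (intro rapid0_integrable[OF v, of _ x C] continuous_on_of_real smooth_continuous smooth_pderivs \<psi>) auto
  qed
  have E: "wirtinger2 e \<psi> y * u y = of_real (pderivs [1,1] \<psi> y) * u y + e * (of_real (pderivs [2,1] \<psi> y) * u y)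
     + e * (of_real (pderivs [1,2] \<psi> y) * u y) + e\<^sup>2 * (of_real (pderivs [2,2] \<psi> y) * u y)" for y
    by (simp only: wirtinger2_def ring_distribs mult.assoc)
  have "integrable lebesgue (\<lambda>y. wirtinger2 e \<psi> y * u y)"
    unfolding E by (intro Bochner_Integration.integrable_add integrable_mult_right i u) auto
  moreover have "integrable lebesgue (\<lambda>y. of_real (\<psi> y) * g y)" using i[of "[]", OF _ g] by simp
  ultimately show ?thesis
    using weak_identity_rapid[OF u g e weak \<psi>] by (simp add: weak_pair_def scaleR_conv_of_real)
qed

lemma weak_pair_complex:
  fixes u g :: "real^2 \<Rightarrow> complex" and p :: "real^2 \<Rightarrow> real"
  assumes u: "u \<in> L2" and g: "g \<in> L2" and e: "norm e = 1"
    and weak: "\<And>\<phi>. \<phi> \<in> test_functions \<Longrightarrow> (LINT x|lebesgue. wirtinger2 e \<phi> x * u x) = (LINT x|lebesgue. \<phi> x *\<^sub>R g x)"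
    and F: "rapid_ctower F"
    and p: "\<And>f. smooth f \<Longrightarrow> smooth (\<lambda>y. p y * f y)" "\<And>f. smooth f \<Longrightarrow> rapid x 2 f \<Longrightarrow> rapid x 2 (\<lambda>y. p y * f y)"
  shows "weak_pair u g (\<lambda>y. of_real (p y) * F 0 (sqdist x y))
    (\<lambda>y. wirtinger2 e (\<lambda>y. p y * Re (F 0 (sqdist x y))) y + \<i> * wirtinger2 e (\<lambda>y. p y * Im (F 0 (sqdist x y))) y)"
proof -
  note T = rapid_ctower_Re_Im[OF F]
  have st: "smooth_tower (\<lambda>m t. Re (F m t))" "smooth_tower (\<lambda>m t. Im (F m t))" using T by (auto simp: rapid_tower_def)
  note s = smooth_tower_sqdist[OF st(1), of 0 x] smooth_tower_sqdist[OF st(2), of 0 x]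
  have "weak_pair u g (\<lambda>y. of_real (p y * Re (F 0 (sqdist x y))) + \<i> * of_real (p y * Im (F 0 (sqdist x y))))
    (\<lambda>y. wirtinger2 e (\<lambda>y. p y * Re (F 0 (sqdist x y))) y + \<i> * wirtinger2 e (\<lambda>y. p y * Im (F 0 (sqdist x y))) y)"
    by (intro weak_pair_add weak_pair_cmult weak_pair_rapid[where x = x, OF u g e weak] p s rapid_tower_rapid[OF T(1)] rapid_tower_rapid[OF T(2)])
  moreover have "of_real (p y * Re (F 0 (sqdist x y))) + \<i> * of_real (p y * Im (F 0 (sqdist x y))) = of_real (p y) * F 0 (sqdist x y)" for y
    by (simp add: complex_eq_iff)
  ultimately show ?thesis by simp
qed

lemma norm_eq_1_if_square:
  fixes e :: complex assumes "e\<^sup>2 = -1" shows "norm e = 1"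
proof -
  have "(norm e)\<^sup>2 = 1" using assms norm_power[of e 2] by simp
  then show ?thesis using norm_ge_zero[of e] by (auto simp: power2_eq_1_iff)
qed

text \<open>For \<open>e\<^sup>2 = -1\<close> the function \<open>\<zeta> = y\<^sub>1 + e y\<^sub>2\<close> is annihilated by \<open>\<partial>\<^sub>1 + e \<partial>\<^sub>2\<close>, and this operator sends
  \<open>|y|\<^sup>2\<close> to \<open>2 \<zeta>\<close>.  Hence its square sends \<open>F (|y|\<^sup>2)\<close> to \<open>4 \<zeta>\<^sup>2 F'' (|y|\<^sup>2)\<close>.\<close>

lemma weak_pair_radial:
  fixes u g :: "real^2 \<Rightarrow> complex"
  assumes u: "u \<in> L2" and g: "g \<in> L2" and e: "e\<^sup>2 = -1"
    and weak: "\<And>\<phi>. \<phi> \<in> test_functions \<Longrightarrow> (LINT x|lebesgue. wirtinger2 e \<phi> x * u x) = (LINT x|lebesgue. \<phi> x *\<^sub>R g x)"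
    and F: "rapid_ctower F"
  shows "weak_pair u g (\<lambda>y. F 0 (sqdist x y))
    (\<lambda>y. 4 * (of_real (y $ 1 - x $ 1) + e * of_real (y $ 2 - x $ 2))\<^sup>2 * F 2 (sqdist x y))"
proof -
  have ne: "norm e = 1" by (rule norm_eq_1_if_square[OF e])
  note T = rapid_ctower_Re_Im[OF F]
  have st: "smooth_tower (\<lambda>m t. Re (F m t))" "smooth_tower (\<lambda>m t. Im (F m t))" using T by (auto simp: rapid_tower_def)
  have "weak_pair u g (\<lambda>y. of_real 1 * F 0 (sqdist x y))
    (\<lambda>y. wirtinger2 e (\<lambda>y. 1 * Re (F 0 (sqdist x y))) y + \<i> * wirtinger2 e (\<lambda>y. 1 * Im (F 0 (sqdist x y))) y)"
    by (rule weak_pair_complex[OF u g ne weak F]) auto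
  moreover have "wirtinger2 e (\<lambda>y. 1 * Re (F 0 (sqdist x y))) y + \<i> * wirtinger2 e (\<lambda>y. 1 * Im (F 0 (sqdist x y))) y
    = 4 * (of_real (y $ 1 - x $ 1) + e * of_real (y $ 2 - x $ 2))\<^sup>2 * F 2 (sqdist x y)" for y
  proof -
    define r where "r = complex_of_real (Re (F 2 (sqdist x y)))"
    define m where "m = complex_of_real (Im (F 2 (sqdist x y)))"
    have "F 2 (sqdist x y) = r + \<i> * m" unfolding r_def m_def by (rule complex_eq)
    then show ?thesis
      using wirtinger2_tower[OF st(1), of e x y] wirtinger2_tower[OF st(2), of e x y]
      unfolding r_def[symmetric] m_def[symmetric] by (simp add: e ring_distribs)
  qed
  ultimately show ?thesis by simp
qed

text \<open>The conjugate variable \<open>q = y\<^sub>1 - e y\<^sub>2\<close> is sent to the constant \<open>2\<close>, and \<open>q \<zeta> = |y|\<^sup>2\<close>.  The product rule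
  for \<open>q\<^sup>2 F (|y|\<^sup>2)\<close> therefore produces a radial function.\<close>

lemma weak_pair_quadratic:
  fixes u g :: "real^2 \<Rightarrow> complex"
  assumes u: "u \<in> L2" and g: "g \<in> L2" and e: "e\<^sup>2 = -1"
    and weak: "\<And>\<phi>. \<phi> \<in> test_functions \<Longrightarrow> (LINT x|lebesgue. wirtinger2 e \<phi> x * u x) = (LINT x|lebesgue. \<phi> x *\<^sub>R g x)"
    and F: "rapid_ctower F"
  shows "weak_pair u g (\<lambda>y. (of_real (y $ 1 - x $ 1) - e * of_real (y $ 2 - x $ 2))\<^sup>2 * F 0 (sqdist x y))
    (\<lambda>y. 4 * of_real (sqdist x y) ^ 2 * F 2 (sqdist x y) + 16 * of_real (sqdist x y) * F 1 (sqdist x y) + 8 * F 0 (sqdist x y))"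
proof -
  have ne: "norm e = 1" by (rule norm_eq_1_if_square[OF e])
  note T = rapid_ctower_Re_Im[OF F]
  have st: "smooth_tower (\<lambda>m t. Re (F m t))" "smooth_tower (\<lambda>m t. Im (F m t))" using T by (auto simp: rapid_tower_def)
  define P where "P a b y = (y $ a - x $ a) * (y $ b - x $ b)" for a b and y :: "real^2"
  define L where "L a b y = wirtinger2 e (\<lambda>y. P a b y * Re (F 0 (sqdist x y))) y + \<i> * wirtinger2 e (\<lambda>y. P a b y * Im (F 0 (sqdist x y))) y" for a b y
  have W: "weak_pair u g (\<lambda>y. of_real (P a b y) * F 0 (sqdist x y)) (L a b)" for a b
    unfolding L_def[abs_def]
  proof (rule weak_pair_complex[OF u g ne weak F])
    show "smooth (\<lambda>y. P a b y * f y)" if "smooth f" for f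
      unfolding P_def by (intro smooth_mult smooth_coord that)
    show "rapid x 2 (\<lambda>y. P a b y * f y)" if "smooth f" "rapid x 2 f" for f
    proof -
      have "rapid x 2 (\<lambda>y. 1 * (y $ a - x $ a) * (1 * (y $ b - x $ b) * f y))"
        by (intro rapid_coord smooth_mult smooth_coord smooth_const that)
      then show ?thesis by (simp add: P_def mult.assoc)
    qed
  qed
  have "weak_pair u g (\<lambda>y. of_real (P 1 1 y) * F 0 (sqdist x y) + ((-1) * (of_real (P 2 2 y) * F 0 (sqdist x y)) + (-2 * e) * (of_real (P 1 2 y) * F 0 (sqdist x y))))
      (\<lambda>y. L 1 1 y + ((-1) * L 2 2 y + (-2 * e) * L 1 2 y))"
    by (intro weak_pair_add weak_pair_cmult W)
  moreover have "of_real (P 1 1 y) * F 0 (sqdist x y) + ((-1) * (of_real (P 2 2 y) * F 0 (sqdist x y)) + (-2 * e) * (of_real (P 1 2 y) * F 0 (sqdist x y)))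
     = (of_real (y $ 1 - x $ 1) - e * of_real (y $ 2 - x $ 2))\<^sup>2 * F 0 (sqdist x y)" for y
  proof -
    have gen: "Y1 * Y1 * f + ((-1) * (Y2 * Y2 * f) + (-2 * e) * (Y1 * Y2 * f)) = (Y1 - e * Y2)\<^sup>2 * f" for Y1 Y2 f
      using e by algebra
    show ?thesis unfolding P_def of_real_mult by (rule gen)
  qed
  moreover have "L 1 1 y + ((-1) * L 2 2 y + (-2 * e) * L 1 2 y)
     = 4 * of_real (sqdist x y) ^ 2 * F 2 (sqdist x y) + 16 * of_real (sqdist x y) * F 1 (sqdist x y) + 8 * F 0 (sqdist x y)" for y
  proof -
    define Y1 where "Y1 = complex_of_real (y $ 1 - x $ 1)"
    define Y2 where "Y2 = complex_of_real (y $ 2 - x $ 2)"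
    define r where "r n = complex_of_real (Re (F n (sqdist x y)))" for n
    define m where "m n = complex_of_real (Im (F n (sqdist x y)))" for n
    have F: "F n (sqdist x y) = r n + \<i> * m n" for n unfolding r_def m_def by (rule complex_eq)
    note w1 = wirtinger2_coord_product_tower[OF st(1), of e x y, folded Y1_def Y2_def r_def]
    note w2 = wirtinger2_coord_product_tower[OF st(2), of e x y, folded Y1_def Y2_def m_def]
    have L11: "L 1 1 y = Y1\<^sup>2 * (4 * (Y1 + e * Y2)\<^sup>2 * F 2 (sqdist x y)) + 8 * Y1 * (Y1 + e * Y2) * F 1 (sqdist x y) + 2 * F 0 (sqdist x y)"
      unfolding L_def P_def w1 w2 F e by (simp add: ring_distribs)
    have L22: "L 2 2 y = Y2\<^sup>2 * (4 * (Y1 + e * Y2)\<^sup>2 * F 2 (sqdist x y)) + 8 * e * Y2 * (Y1 + e * Y2) * F 1 (sqdist x y) - 2 * F 0 (sqdist x y)"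
      unfolding L_def P_def w1 w2 F e by (simp add: ring_distribs)
    have L12: "L 1 2 y = Y1 * Y2 * (4 * (Y1 + e * Y2)\<^sup>2 * F 2 (sqdist x y)) + 4 * (Y2 + e * Y1) * (Y1 + e * Y2) * F 1 (sqdist x y) + 2 * e * F 0 (sqdist x y)"
      unfolding L_def P_def w1 w2 F e by (simp add: ring_distribs)
    have rho: "of_real (sqdist x y) = Y1\<^sup>2 + Y2\<^sup>2" by (simp add: sqdist_2 Y1_def Y2_def)
    show ?thesis unfolding L11 L22 L12 rho
      using e by algebra
  qed
  ultimately show ?thesis by simp
qed

text \<open>The pair of test functions is \<open>(a, q\<^sup>2 b)\<close> with \<open>b = 4 a'' / k\<close>.  The first operator sends \<open>a\<close> to
  \<open>4 q\<^sup>2 a'' = k q\<^sup>2 b\<close>, the second sends \<open>q\<^sup>2 b\<close> to \<open>k a + H\<close>; hence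
  only \<open>H u1\<close> survives when the operators minus \<open>k\<close> are tested with the pair.\<close>

lemma representation:
  fixes u1 u2 g1 g2 :: "real^2 \<Rightarrow> complex"
  assumes L2: "u1 \<in> L2" "u2 \<in> L2" "g1 \<in> L2" "g2 \<in> L2" and e: "e\<^sup>2 = -1" and k: "k \<noteq> 0"
    and weak1: "\<And>\<phi>. \<phi> \<in> test_functions \<Longrightarrow> (LINT x|lebesgue. wirtinger2 e \<phi> x * u2 x) = (LINT x|lebesgue. \<phi> x *\<^sub>R g1 x)"
    and weak2: "\<And>\<phi>. \<phi> \<in> test_functions \<Longrightarrow> (LINT x|lebesgue. wirtinger2 (- e) \<phi> x * u1 x) = (LINT x|lebesgue. \<phi> x *\<^sub>R g2 x)"
    and a: "rapid_ctower a"
    and H: "\<And>t. t \<ge> 0 \<Longrightarrow> 4 / k * (8 * a 2 t + 16 * of_real t * a 3 t + 4 * of_real t ^ 2 * a 4 t) = k * a 0 t + H t"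
  defines "q \<equiv> \<lambda>x y. complex_of_real (y $ 1 - x $ 1) + e * of_real (y $ 2 - x $ 2)"
  shows "(LINT y|lebesgue. H (sqdist x y) * u1 y)
     = (LINT y|lebesgue. a 0 (sqdist x y) * (g1 y - k * u1 y) + (q x y)\<^sup>2 * (4 / k * a 2 (sqdist x y)) * (g2 y - k * u2 y))"
proof -
  define b where "b m t = 4 / k * a (m + 2) t" for m t
  have b: "rapid_ctower b"
    unfolding rapid_ctower_def
  proof (intro conjI allI)
    fix m t show "(b m has_vector_derivative b (Suc m) t) (at t)"
      using a unfolding b_def rapid_ctower_def by (auto intro!: derivative_eq_intros)
  next
    fix m N
    obtain C where C: "\<And>t. t \<ge> 0 \<Longrightarrow> norm (a (m + 2) t) * (1 + t) ^ N \<le> C" using a unfolding rapid_ctower_def by meson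
    have "norm (b m t) * (1 + t) ^ N \<le> norm (4 / k) * C" if "t \<ge> 0" for t
      using mult_left_mono[OF C[OF that], of "norm (4 / k)"] by (simp add: b_def norm_mult norm_divide mult.assoc)
    then show "\<exists>C. \<forall>t\<ge>0. norm (b m t) * (1 + t) ^ N \<le> C" by blast
  qed
  have w1: "weak_pair u2 g1 (\<lambda>y. a 0 (sqdist x y)) (\<lambda>y. 4 * (q x y)\<^sup>2 * a 2 (sqdist x y))"
    unfolding q_def by (rule weak_pair_radial[OF L2(2,3) e weak1 a])
  have e': "(- e)\<^sup>2 = -1" using e by simp
  have w2: "weak_pair u1 g2 (\<lambda>y. (q x y)\<^sup>2 * b 0 (sqdist x y))
    (\<lambda>y. 4 * of_real (sqdist x y) ^ 2 * b 2 (sqdist x y) + 16 * of_real (sqdist x y) * b 1 (sqdist x y) + 8 * b 0 (sqdist x y))"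
    using weak_pair_quadratic[OF L2(1,4) e' weak2 b, of x] unfolding q_def by simp
  have HH: "4 * of_real t ^ 2 * b 2 t + 16 * of_real t * b 1 t + 8 * b 0 t = k * a 0 t + H t" if "t \<ge> 0" for t
    using H[OF that] by (simp add: b_def algebra_simps eval_nat_numeral)
  have b0: "4 / k * a 2 t = b 0 t" for t by (simp add: b_def numeral_2_eq_2)
  note W1 = w1[unfolded weak_pair_def] and W2 = w2[unfolded weak_pair_def HH[OF sqdist_nonneg]]
  have k2: "4 * (q x y)\<^sup>2 * a 2 (sqdist x y) = k * ((q x y)\<^sup>2 * b 0 (sqdist x y))" for y
    using k by (simp add: b_def numeral_2_eq_2)
  have cont: "continuous_on UNIV (a 0)"
    using a unfolding rapid_ctower_def by (meson continuous_at_imp_continuous_on has_vector_derivative_continuous)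
  obtain C where C: "\<And>t. t \<ge> 0 \<Longrightarrow> norm (a 0 t) * (1 + t) ^ 1 \<le> C" using a unfolding rapid_ctower_def by meson
  have i1: "integrable lebesgue (\<lambda>y. a 0 (sqdist x y) * u1 y)"
  proof (rule rapid0_integrable[OF L2(1)])
    show "continuous_on UNIV (\<lambda>y. a 0 (sqdist x y))"
      unfolding sqdist_def by (intro continuous_on_compose2[OF cont] continuous_intros) auto
    show "norm (a 0 (sqdist x y)) * (1 + sqdist x y) \<le> C" for y using C[OF sqdist_nonneg, of x y] by simp
  qed
  have i2: "integrable lebesgue (\<lambda>y. (q x y)\<^sup>2 * b 0 (sqdist x y) * u2 y)"
    using W1 integrable_mult_right[of "1/k" lebesgue "\<lambda>y. k * ((q x y)\<^sup>2 * b 0 (sqdist x y)) * u2 y"] k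
    unfolding k2 by (simp add: mult.assoc)
  have "(LINT y|lebesgue. H (sqdist x y) * u1 y) = (LINT y|lebesgue. (k * a 0 (sqdist x y) + H (sqdist x y)) * u1 y - k * (a 0 (sqdist x y) * u1 y))"
    by (simp add: algebra_simps)
  also have "\<dots> = (LINT y|lebesgue. (k * a 0 (sqdist x y) + H (sqdist x y)) * u1 y) - k * (LINT y|lebesgue. a 0 (sqdist x y) * u1 y)"
    using W2 i1 by (subst Bochner_Integration.integral_diff) auto
  also have "(LINT y|lebesgue. (k * a 0 (sqdist x y) + H (sqdist x y)) * u1 y) = (LINT y|lebesgue. (q x y)\<^sup>2 * b 0 (sqdist x y) * g2 y)"
    using W2 by auto
  also have "\<dots> = (LINT y|lebesgue. (q x y)\<^sup>2 * b 0 (sqdist x y) * g2 y) - k * (LINT y|lebesgue. (q x y)\<^sup>2 * b 0 (sqdist x y) * u2 y) + (LINT y|lebesgue. a 0 (sqdist x y) * g1 y)"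
    using W1 unfolding k2 by (simp add: mult.assoc)
  also have "\<dots> - k * (LINT y|lebesgue. a 0 (sqdist x y) * u1 y) = (LINT y|lebesgue. a 0 (sqdist x y) * g1 y - k * (a 0 (sqdist x y) * u1 y) + ((q x y)\<^sup>2 * b 0 (sqdist x y) * g2 y - k * ((q x y)\<^sup>2 * b 0 (sqdist x y) * u2 y)))"
    using W1 W2 i1 i2 by simp
  also have "\<dots> = (LINT y|lebesgue. a 0 (sqdist x y) * (g1 y - k * u1 y) + (q x y)\<^sup>2 * (4 / k * a 2 (sqdist x y)) * (g2 y - k * u2 y))"
    unfolding b0 by (intro Bochner_Integration.integral_cong refl) (simp add: algebra_simps)
  finally show ?thesis .
qed

section \<open>Laplace transforms of complex-time heat kernels\<close>

text \<open>A half line of complex times, starting at \<open>\<epsilon>\<close> in direction \<open>d\<close>.\<close>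

definition ray :: "real \<Rightarrow> complex \<Rightarrow> real \<Rightarrow> complex" where
  "ray \<epsilon> d s = of_real \<epsilon> + d * of_real s"

text \<open>Up to a constant, \<open>heat 1 w (|x|\<^sup>2)\<close> is the heat kernel of the plane at time \<open>w\<close>.  The other exponents arise
  by differentiation in \<open>r\<close>, which raises \<open>m\<close> by one and contributes a factor \<open>-1/4\<close>.\<close>

definition heat :: "nat \<Rightarrow> complex \<Rightarrow> real \<Rightarrow> complex" where
  "heat m w r = exp (- (of_real r / (4 * w))) / w ^ m"

lemma continuous_on_ray: "continuous_on S (ray \<epsilon> d)"
  unfolding ray_def by (intro continuous_intros)

lemma exp_decay_integral:
  fixes c :: real assumes "c > 0"
  shows "set_integrable lborel {0<..} (\<lambda>s. exp (- (c * s)))" "(LINT s:{0<..}|lborel. exp (- (c * s))) = 1 / c"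
proof -
  have "(\<integral>\<^sup>+ s. ennreal (exp (- (c * s))) * indicator {0..} s \<partial>lborel) = ennreal (0 - - exp (- (c * 0)) / c)"
  proof (rule nn_integral_FTC_atLeast)
    show "((\<lambda>s. - exp (- (c * s)) / c) has_real_derivative exp (- (c * s))) (at s)" for s
      using assms by (auto intro!: derivative_eq_intros)
    have "LIM s at_top. - (c * s) :> at_bot"
      unfolding filterlim_uminus_at_bot by (simp add: filterlim_tendsto_pos_mult_at_top[OF tendsto_const assms filterlim_ident])
    then have "((\<lambda>s. exp (- (c * s))) \<longlongrightarrow> 0) at_top" by (rule filterlim_compose[OF exp_at_bot])
    then show "((\<lambda>s. - exp (- (c * s)) / c) \<longlongrightarrow> 0) at_top"
      using tendsto_divide[OF tendsto_minus tendsto_const[of c], of "\<lambda>s. exp (- (c * s))" 0] assms by simp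
  qed auto
  also have "(\<integral>\<^sup>+ s. ennreal (exp (- (c * s))) * indicator {0..} s \<partial>lborel) = (\<integral>\<^sup>+ s. ennreal (indicator {0<..} s *\<^sub>R exp (- (c * s))) \<partial>lborel)"
    by (intro nn_integral_cong_AE eventually_mono[OF AE_lborel_singleton[of 0]]) (auto simp: indicator_def)
  finally have nn: "(\<integral>\<^sup>+ s. ennreal (indicator {0<..} s *\<^sub>R exp (- (c * s))) \<partial>lborel) = ennreal (1 / c)" by simp
  show "set_integrable lborel {0<..} (\<lambda>s. exp (- (c * s)))"
    unfolding set_integrable_def using nn by (intro integrableI_nonneg) (auto simp: indicator_def)
  show "(LINT s:{0<..}|lborel. exp (- (c * s))) = 1 / c"
    unfolding set_lebesgue_integral_def using nn assms
    by (subst integral_eq_nn_integral) (auto simp: indicator_def)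
qed

lemma exp_bounded_integrable:
  fixes f :: "real \<Rightarrow> complex"
  assumes c: "c > 0" and f: "continuous_on {0<..} f" "\<And>s. s > 0 \<Longrightarrow> norm (f s) \<le> C * exp (- (c * s))"
  shows "set_integrable lborel {0<..} f" "norm (LINT s:{0<..}|lborel. f s) \<le> C / c"
proof -
  have m: "set_borel_measurable lborel {0<..} f"
    using borel_measurable_continuous_on_indicator[OF _ f(1)] by (simp add: set_borel_measurable_def)
  have i: "set_integrable lborel {0<..} (\<lambda>s. C * exp (- (c * s)))"
    using exp_decay_integral(1)[OF c] by simp
  show 1: "set_integrable lborel {0<..} f"
  proof (rule set_integrable_bound[OF i m])
    show "AE x in lborel. x \<in> {0<..} \<longrightarrow> norm (f x) \<le> norm (C * exp (- (c * x)))"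
      using f(2) by (intro AE_I2) (force intro: order_trans)
  qed
  have "norm (LINT s:{0<..}|lborel. f s) \<le> (LINT s:{0<..}|lborel. norm (f s))"
    by (rule set_integral_norm_bound[OF 1])
  also have "\<dots> \<le> (LINT s:{0<..}|lborel. C * exp (- (c * s)))"
    by (rule set_integral_mono[OF set_integrable_norm[OF 1] i]) (use f(2) in auto)
  also have "\<dots> = C / c" using exp_decay_integral(2)[OF c] by simp
  finally show "norm (LINT s:{0<..}|lborel. f s) \<le> C / c" .
qed

lemma integral_derivative_half_line:
  fixes f F :: "real \<Rightarrow> complex"
  assumes F: "\<And>s. s \<ge> 0 \<Longrightarrow> (F has_vector_derivative f s) (at s)" and f: "\<And>s. s > 0 \<Longrightarrow> isCont f s"
    and i: "set_integrable lborel {0<..} f" and L: "(F \<longlongrightarrow> L) at_top"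
  shows "(LINT s:{0<..}|lborel. f s) = L - F 0"
proof -
  have "(LBINT s=0..\<infinity>. f s) = L - F 0"
  proof (rule interval_integral_FTC_integrable)
    have "isCont F 0" using F[of 0] has_vector_derivative_continuous by blast
    then have "(F \<longlongrightarrow> F 0) (at_right 0)" by (simp add: isCont_def filterlim_at_split)
    then show "((F \<circ> real_of_ereal) \<longlongrightarrow> F 0) (at_right 0)"
      by (simp add: zero_ereal_def ereal_tendsto_simps)
    show "((F \<circ> real_of_ereal) \<longlongrightarrow> L) (at_left \<infinity>)" using L by (simp add: ereal_tendsto_simps)
  qed (use F f i in \<open>auto simp: zero_ereal_def\<close>)
  then show ?thesis by (simp add: interval_lebesgue_integral_def zero_ereal_def)
qed

lemma has_vector_derivative_quadratic_remainder:
  fixes f :: "real \<Rightarrow> 'a::real_normed_vector"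
  assumes "\<And>h. \<bar>h\<bar> \<le> 1 \<Longrightarrow> norm (f (x + h) - f x - h *\<^sub>R v) \<le> K * h\<^sup>2"
  shows "(f has_vector_derivative v) (at x)"
proof -
  have "((\<lambda>h. norm (f (x + h) - f x - h *\<^sub>R v) / norm h) \<longlongrightarrow> 0) (at 0)"
  proof (rule tendsto_sandwich)
    show "\<forall>\<^sub>F h in at 0. 0 \<le> norm (f (x + h) - f x - h *\<^sub>R v) / norm h" by simp
    have "\<forall>\<^sub>F h::real in at 0. \<bar>h\<bar> \<le> 1" by (auto simp: eventually_at dist_real_def intro!: exI[of _ 1])
    then show "\<forall>\<^sub>F h in at 0. norm (f (x + h) - f x - h *\<^sub>R v) / norm h \<le> K * \<bar>h\<bar>"
    proof eventually_elim
      case (elim h)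
      show ?case using assms[OF elim] by (cases "h = 0") (auto simp: field_simps power2_eq_square abs_mult_self_eq)
    qed
    have "((\<lambda>h. K * \<bar>h\<bar>) \<longlongrightarrow> K * \<bar>0\<bar>) (at 0)" by (intro tendsto_intros)
    then show "((\<lambda>h. K * \<bar>h\<bar>) \<longlongrightarrow> 0) (at 0)" by simp
  qed auto
  then show ?thesis
    by (simp add: has_vector_derivative_def has_derivative_at bounded_linear_scaleR_left)
qed

lemma norm_heat: "norm (heat m w r) = exp (- (r * Re (1 / w) / 4)) / norm w ^ m"
proof -
  have "of_real r / (4 * w) = of_real (r / 4) * (1 / w)" by simp
  then have "Re (of_real r / (4 * w)) = r * Re (1 / w) / 4" by (simp only: times_complex.sel complex_of_real_def complex.sel) 
  then show ?thesis by (simp add: heat_def norm_divide norm_power)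
qed

lemma ray_Re:
  assumes "Re d \<ge> 0" "s \<ge> 0" shows "Re (ray \<epsilon> d s) \<ge> \<epsilon>"
  using assms by (simp add: ray_def)

lemma norm_exp_le: "norm (exp (z::complex)) \<le> exp (norm z)"
  by (simp add: complex_Re_le_cmod)

lemma norm_heat_crude:
  assumes "Re w \<ge> \<epsilon>" "\<epsilon> > 0"
  shows "norm (heat m w r) \<le> exp (\<bar>r\<bar> / (4 * \<epsilon>)) / \<epsilon> ^ m"
proof -
  have w: "norm w \<ge> \<epsilon>" using assms complex_Re_le_cmod[of w] by linarith
  have "norm (- (of_real r / (4 * w)) :: complex) = \<bar>r\<bar> / (4 * norm w)" by (simp add: norm_divide norm_mult)
  also have "\<dots> \<le> \<bar>r\<bar> / (4 * \<epsilon>)" using w assms by (intro frac_le) auto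
  finally have "norm (exp (- (of_real r / (4 * w)) :: complex)) \<le> exp (\<bar>r\<bar> / (4 * \<epsilon>))"
    using norm_exp_le[of "- (of_real r / (4 * w)) :: complex"] by (meson exp_le_cancel_iff order_trans)
  then show ?thesis
    unfolding heat_def norm_divide norm_power using w assms by (intro frac_le power_mono) auto
qed

text \<open>A remainder that is quadratic in \<open>h\<close>, uniformly along a ray, permits differentiation under the integral
  sign by mere integration of the estimate.\<close>

lemma heat_add_remainder:
  assumes "Re w \<ge> \<epsilon>" "\<epsilon> > 0" "\<bar>h\<bar> \<le> 1"
  shows "norm (heat m w (r + h) - heat m w r - h *\<^sub>R (- (1/4) * heat (Suc m) w r))
    \<le> exp (\<bar>r\<bar> / (4 * \<epsilon>)) / \<epsilon> ^ m * exp (1 / (4 * \<epsilon>)) * (1 / (4 * \<epsilon>))\<^sup>2 * h\<^sup>2"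
proof -
  have w: "norm w \<ge> \<epsilon>" "w \<noteq> 0" using assms complex_Re_le_cmod[of w] by auto
  define z where "z = - (of_real h / (4 * w))"
  have eq: "heat m w (r + h) - heat m w r - h *\<^sub>R (- (1/4) * heat (Suc m) w r) = heat m w r * (exp z - 1 - z)"
  proof -
    have "heat m w (r + h) = heat m w r * exp z"
      unfolding heat_def z_def by (simp add: exp_add[symmetric] add_divide_distrib)
    moreover have "h *\<^sub>R (- (1/4) * heat (Suc m) w r) = heat m w r * z"
      using w unfolding heat_def z_def by (simp add: scaleR_conv_of_real mult_ac)
    ultimately show ?thesis by (simp add: algebra_simps)
  qed
  have nz: "norm z \<le> \<bar>h\<bar> * (1 / (4 * \<epsilon>))"
    unfolding z_def using w assms by (simp add: norm_divide norm_mult frac_le)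
  then have nz1: "norm z \<le> 1 / (4 * \<epsilon>)"
    using assms mult_right_mono[of "\<bar>h\<bar>" 1 "1 / (4 * \<epsilon>)"] by simp
  have "norm (exp z - (\<Sum>k\<le>1. z ^ k / fact k)) \<le> exp \<bar>Re z\<bar> * norm z ^ Suc 1 / fact 1" by (rule Taylor_exp)
  then have "norm (exp z - 1 - z) \<le> exp \<bar>Re z\<bar> * (norm z)\<^sup>2" by (simp add: numeral_2_eq_2 diff_diff_eq)
  also have "\<dots> \<le> exp (1 / (4 * \<epsilon>)) * (\<bar>h\<bar> * (1 / (4 * \<epsilon>)))\<^sup>2"
    using nz nz1 abs_Re_le_cmod[of z] assms by (intro mult_mono power_mono) auto
  finally have "norm (heat m w r * (exp z - 1 - z)) \<le> (exp (\<bar>r\<bar> / (4 * \<epsilon>)) / \<epsilon> ^ m) * (exp (1 / (4 * \<epsilon>)) * (\<bar>h\<bar> * (1 / (4 * \<epsilon>)))\<^sup>2)"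
    unfolding norm_mult using assms by (intro mult_mono norm_heat_crude) auto
  then show ?thesis unfolding eq by (simp add: power_mult_distrib power_divide mult_ac)
qed

definition heat_laplace :: "nat \<Rightarrow> complex \<Rightarrow> complex \<Rightarrow> real \<Rightarrow> real \<Rightarrow> complex" where
  "heat_laplace m \<kappa> d \<epsilon> r = (LINT s:{0<..}|lborel. heat m (ray \<epsilon> d s) r * exp (\<kappa> * d * of_real s) * d)"

text \<open>The condition \<open>Re d \<ge> 0\<close> keeps all times in the half plane \<open>Re w \<ge> \<epsilon>\<close>, where the heat kernels are bounded;
  \<open>Re (\<kappa> d) < 0\<close> makes the exponential weight integrable.\<close>

locale laplace_ray =
  fixes \<kappa> d :: complex and \<epsilon> :: real
  assumes eps: "\<epsilon> > 0" and d: "Re d \<ge> 0" and kd: "Re (\<kappa> * d) < 0"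
begin

definition rate :: real where "rate = - Re (\<kappa> * d)"

lemma rate_pos: "rate > 0" using kd by (simp add: rate_def)

lemma norm_exp_ray: "norm (exp (\<kappa> * d * of_real s)) = exp (- (rate * s))"
  by (simp add: norm_exp rate_def algebra_simps)

lemma Re_ray: "s \<ge> 0 \<Longrightarrow> Re (ray \<epsilon> d s) \<ge> \<epsilon>"
  using d by (rule ray_Re)

lemma ray_nz: "s \<ge> 0 \<Longrightarrow> ray \<epsilon> d s \<noteq> 0"
  using Re_ray[of s] eps by auto

lemma continuous_heat_ray:
  "continuous_on {0<..} (\<lambda>s. heat m (ray \<epsilon> d s) r * exp (\<kappa> * d * of_real s) * d)"
  unfolding heat_def by (intro continuous_intros continuous_on_ray) (auto simp: ray_nz)

lemma heat_ray_integrable: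
  "set_integrable lborel {0<..} (\<lambda>s. heat m (ray \<epsilon> d s) r * exp (\<kappa> * d * of_real s) * d)"
proof (rule exp_bounded_integrable(1)[OF rate_pos continuous_heat_ray])
  fix s :: real assume s: "s > 0"
  show "norm (heat m (ray \<epsilon> d s) r * exp (\<kappa> * d * of_real s) * d) \<le> (exp (\<bar>r\<bar> / (4 * \<epsilon>)) / \<epsilon> ^ m * norm d) * exp (- (rate * s))"
    unfolding norm_mult norm_exp_ray
    using mult_right_mono[OF norm_heat_crude[OF Re_ray[of s] eps, of m r], of "exp (- (rate * s)) * norm d"] s
    by (simp add: mult_ac)
qed

lemma heat_laplace_derivative:
  "(heat_laplace m \<kappa> d \<epsilon> has_vector_derivative - (1/4) * heat_laplace (Suc m) \<kappa> d \<epsilon> r) (at r)"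
proof (rule has_vector_derivative_quadratic_remainder)
  fix h :: real assume h: "\<bar>h\<bar> \<le> 1"
  define K where "K = exp (\<bar>r\<bar> / (4 * \<epsilon>)) / \<epsilon> ^ m * exp (1 / (4 * \<epsilon>)) * (1 / (4 * \<epsilon>))\<^sup>2"
  define g where "g s = (heat m (ray \<epsilon> d s) (r + h) - heat m (ray \<epsilon> d s) r - h *\<^sub>R (- (1/4) * heat (Suc m) (ray \<epsilon> d s) r)) * exp (\<kappa> * d * of_real s) * d" for s
  have g: "g s = heat m (ray \<epsilon> d s) (r + h) * exp (\<kappa> * d * of_real s) * d - heat m (ray \<epsilon> d s) r * exp (\<kappa> * d * of_real s) * d
     - of_real (- h / 4) * (heat (Suc m) (ray \<epsilon> d s) r * exp (\<kappa> * d * of_real s) * d)" for s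
    by (simp add: g_def algebra_simps scaleR_conv_of_real)
  have "heat_laplace m \<kappa> d \<epsilon> (r + h) - heat_laplace m \<kappa> d \<epsilon> r - h *\<^sub>R (- (1/4) * heat_laplace (Suc m) \<kappa> d \<epsilon> r)
    = (LINT s:{0<..}|lborel. g s)"
    unfolding g heat_laplace_def
    using heat_ray_integrable[of m "r + h"] heat_ray_integrable[of m r] heat_ray_integrable[of "Suc m" r]
    by (simp add: set_integral_diff scaleR_conv_of_real)
  also have "norm \<dots> \<le> (K * norm d * h\<^sup>2) / rate"
  proof (rule exp_bounded_integrable(2)[OF rate_pos])
    show "continuous_on {0<..} g"
      unfolding g by (intro continuous_on_diff continuous_on_mult continuous_on_const continuous_heat_ray)
    fix s :: real assume s: "s > 0"
    have "norm (heat m (ray \<epsilon> d s) (r + h) - heat m (ray \<epsilon> d s) r - h *\<^sub>R (- (1/4) * heat (Suc m) (ray \<epsilon> d s) r)) \<le> K * h\<^sup>2"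
      unfolding K_def by (rule heat_add_remainder[OF Re_ray eps h]) (use s in auto)
    then have "norm (heat m (ray \<epsilon> d s) (r + h) - heat m (ray \<epsilon> d s) r - h *\<^sub>R (- (1/4) * heat (Suc m) (ray \<epsilon> d s) r)) * (exp (- (rate * s)) * norm d)
      \<le> K * h\<^sup>2 * (exp (- (rate * s)) * norm d)" by (rule mult_right_mono) simp
    then show "norm (g s) \<le> K * norm d * h\<^sup>2 * exp (- (rate * s))"
      unfolding g_def norm_mult norm_exp_ray by (simp only: mult_ac)
  qed
  finally show "norm (heat_laplace m \<kappa> d \<epsilon> (r + h) - heat_laplace m \<kappa> d \<epsilon> r - h *\<^sub>R (- (1/4) * heat_laplace (Suc m) \<kappa> d \<epsilon> r))
    \<le> (K * norm d / rate) * h\<^sup>2" by simp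
qed

lemma Re_inverse_ray:
  assumes "s \<ge> 0" shows "Re (1 / ray \<epsilon> d s) \<ge> \<epsilon> / (norm (ray \<epsilon> d s))\<^sup>2"
proof -
  have "Re (1 / ray \<epsilon> d s) = Re (ray \<epsilon> d s) / (norm (ray \<epsilon> d s))\<^sup>2"
    by (simp add: Re_divide cmod_power2)
  then show ?thesis using Re_ray[OF assms] by (simp add: divide_right_mono)
qed

end

lemma power_le_fact_exp: 
  fixes x :: real assumes "x \<ge> 0" shows "x ^ N \<le> fact N * exp x"
proof -
  have "x ^ N / fact N \<le> (\<Sum>n\<le>N. x ^ n / fact n)"
    by (rule member_le_sum) (use assms in auto)
  also have "\<dots> \<le> exp x" 
    using assms sum_le_suminf[OF summable_exp[of x], of "{..N}"] by (simp add: exp_def field_simps inverse_eq_divide)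
  finally show ?thesis by (simp add: field_simps)
qed

lemma poly_exp_decay:
  fixes c :: real assumes c: "c > 0"
  obtains C where "\<And>s. s \<ge> 0 \<Longrightarrow> (1 + s) ^ N * exp (- (c * s)) \<le> C * exp (- (c / 2 * s))"
proof -
  define q where "q = max 1 (2 / c)"
  have q: "q \<ge> 1" "q * (c / 2) \<ge> 1" using c by (auto simp: q_def field_simps max_def)
  have "(1 + s) ^ N * exp (- (c * s)) \<le> (q ^ N * fact N * exp 1) * exp (- (c / 2 * s))" if s: "s \<ge> 0" for s
  proof -
    have "1 + s \<le> q * (1 + c / 2 * s)"
      using q mult_right_mono[OF q(2) s] by (simp add: algebra_simps)
    then have "(1 + s) ^ N \<le> (q * (1 + c / 2 * s)) ^ N" using s by (intro power_mono) auto
    also have "\<dots> \<le> q ^ N * (fact N * exp (1 + c / 2 * s))"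
      unfolding power_mult_distrib using q s c by (intro mult_left_mono power_le_fact_exp) auto
    finally have "(1 + s) ^ N * exp (- (c * s)) \<le> q ^ N * (fact N * exp (1 + c / 2 * s)) * exp (- (c * s))"
      by (intro mult_right_mono) auto
    also have "\<dots> = (q ^ N * fact N * exp 1) * exp (- (c / 2 * s))"
      by (simp add: exp_add[symmetric] mult.assoc)
    finally show ?thesis .
  qed
  then show thesis by (rule that)
qed

context laplace_ray begin

text \<open>At time \<open>w\<close> the kernel is at most \<open>exp (- r \<epsilon> / (4 |w|\<^sup>2))\<close>.  As \<open>|w|\<close> grows linearly in \<open>s\<close>, each power of
  \<open>r\<close> costs two powers of \<open>1 + s\<close>, which the exponential weight absorbs.\<close>

lemma heat_laplace_rapid:
  "\<exists>C. \<forall>r\<ge>0. norm (heat_laplace m \<kappa> d \<epsilon> r) * (1 + r) ^ N \<le> C"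
proof -
  define K where "K = 1 + 4 * (\<epsilon> + norm d)\<^sup>2 / \<epsilon>"
  obtain C where C: "\<And>s. s \<ge> 0 \<Longrightarrow> (1 + s) ^ (2 * N) * exp (- (rate * s)) \<le> C * exp (- (rate / 2 * s))"
    using poly_exp_decay[OF rate_pos] by blast
  define M where "M = K ^ N * (fact N * exp 1) / \<epsilon> ^ m * norm d"
  have K: "K \<ge> 0" using eps by (simp add: K_def)
  have "norm (heat_laplace m \<kappa> d \<epsilon> r) * (1 + r) ^ N \<le> M * C / (rate / 2)" if r: "r \<ge> 0" for r
  proof -
    define p where "p = (1 + r) ^ N"
    have p: "p \<ge> 0" using r by (simp add: p_def)
    have "of_real p * heat_laplace m \<kappa> d \<epsilon> r = (LINT s:{0<..}|lborel. of_real p * (heat m (ray \<epsilon> d s) r * exp (\<kappa> * d * of_real s) * d))"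
      by (simp add: heat_laplace_def)
    also have "norm \<dots> \<le> M * C / (rate / 2)"
    proof (rule exp_bounded_integrable(2))
      show "rate / 2 > 0" using rate_pos by simp
      show "continuous_on {0<..} (\<lambda>s. of_real p * (heat m (ray \<epsilon> d s) r * exp (\<kappa> * d * of_real s) * d))"
        by (intro continuous_on_mult continuous_on_const continuous_heat_ray)
      fix s :: real assume s: "s > 0"
      define n where "n = norm (ray \<epsilon> d s)"
      have n: "n \<ge> \<epsilon>" "n > 0" using Re_ray[of s] complex_Re_le_cmod[of "ray \<epsilon> d s"] s eps by (auto simp: n_def)
      have "n \<le> \<epsilon> + norm d * s"
        unfolding n_def ray_def using s eps by (intro order_trans[OF norm_triangle_ineq]) (simp add: norm_mult)
      also have "\<dots> \<le> (\<epsilon> + norm d) * (1 + s)" using s eps by (simp add: algebra_simps)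
      finally have n2: "n \<le> (\<epsilon> + norm d) * (1 + s)" .
      define y where "y = r * \<epsilon> / (4 * n\<^sup>2)"
      have y: "y \<ge> 0" using r eps by (simp add: y_def)
      have "1 + r \<le> (1 + 4 * n\<^sup>2 / \<epsilon>) * (1 + y)"
      proof -
        define b where "b = 4 * n\<^sup>2 / \<epsilon>"
        have "r = b * y" using n eps by (simp add: y_def b_def)
        moreover have "0 \<le> b" using eps by (simp add: b_def)
        ultimately show ?thesis unfolding b_def[symmetric] using y by (simp add: ring_distribs)
      qed
      also have "1 + 4 * n\<^sup>2 / \<epsilon> \<le> K * (1 + s)\<^sup>2"
      proof -
        have "n\<^sup>2 \<le> (\<epsilon> + norm d)\<^sup>2 * (1 + s)\<^sup>2" using power_mono[OF n2, of 2] n by (simp add: power_mult_distrib)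
        then have "4 * n\<^sup>2 / \<epsilon> \<le> 4 * (\<epsilon> + norm d)\<^sup>2 / \<epsilon> * (1 + s)\<^sup>2" using eps by (simp add: divide_right_mono)
        moreover have "1 \<le> (1 + s)\<^sup>2" using s by simp
        ultimately have "1 + 4 * n\<^sup>2 / \<epsilon> \<le> (1 + s)\<^sup>2 + 4 * (\<epsilon> + norm d)\<^sup>2 / \<epsilon> * (1 + s)\<^sup>2" by (rule add_mono[rotated])
        then show ?thesis unfolding K_def ring_distribs by simp
      qed
      finally have "1 + r \<le> K * (1 + s)\<^sup>2 * (1 + y)" using y by (simp add: mult_right_mono)
      then have "p \<le> (K * (1 + s)\<^sup>2 * (1 + y)) ^ N" unfolding p_def using r by (intro power_mono) auto
      also have "\<dots> = K ^ N * (1 + s) ^ (2 * N) * (1 + y) ^ N" by (simp add: power_mult_distrib power_mult)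
      also have "\<dots> \<le> K ^ N * (1 + s) ^ (2 * N) * (fact N * exp (1 + y))"
        using y K s by (intro mult_left_mono power_le_fact_exp) auto
      finally have pb: "p \<le> K ^ N * (1 + s) ^ (2 * N) * (fact N * exp (1 + y))" .
      have "norm (heat m (ray \<epsilon> d s) r) \<le> exp (- y) / \<epsilon> ^ m"
        unfolding norm_heat
      proof (rule frac_le)
        show "exp (- (r * Re (1 / ray \<epsilon> d s) / 4)) \<le> exp (- y)"
          using mult_left_mono[OF Re_inverse_ray[of s] r] s by (simp add: y_def n_def)
        show "\<epsilon> ^ m \<le> cmod (ray \<epsilon> d s) ^ m" using n eps by (intro power_mono) (auto simp: n_def)
      qed (use eps in auto)
      then have "p * norm (heat m (ray \<epsilon> d s) r) \<le> K ^ N * (1 + s) ^ (2 * N) * (fact N * exp (1 + y)) * (exp (- y) / \<epsilon> ^ m)"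
        by (intro mult_mono pb) (use K s eps in auto)
      also have "\<dots> = (K ^ N * (fact N * exp 1) / \<epsilon> ^ m) * (1 + s) ^ (2 * N)"
        by (simp add: exp_add exp_minus field_simps)
      finally have "p * norm (heat m (ray \<epsilon> d s) r) * (exp (- (rate * s)) * norm d) \<le> (K ^ N * (fact N * exp 1) / \<epsilon> ^ m) * (1 + s) ^ (2 * N) * (exp (- (rate * s)) * norm d)"
        by (intro mult_right_mono) auto
      also have "\<dots> = M * ((1 + s) ^ (2 * N) * exp (- (rate * s)))" by (simp add: M_def)
      also have "\<dots> \<le> M * (C * exp (- (rate / 2 * s)))"
        using C[of s] s K eps by (intro mult_left_mono) (auto simp: M_def)
      finally show "norm (of_real p * (heat m (ray \<epsilon> d s) r * exp (\<kappa> * d * of_real s) * d)) \<le> M * C * exp (- (rate / 2 * s))"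
          unfolding norm_mult norm_exp_ray norm_of_real abs_of_nonneg[OF p] by (simp only: mult_ac)
    qed
    finally show ?thesis
      unfolding norm_mult norm_of_real abs_of_nonneg[OF p] unfolding p_def by (simp only: mult.commute)
  qed
  then show ?thesis by blast
qed

end

lemma heat_has_field_derivative:
  assumes "w \<noteq> 0"
  shows "((\<lambda>w. heat m w r) has_field_derivative of_real r / 4 * heat (m + 2) w r - of_nat m * heat (Suc m) w r) (at w)"
proof -
  have "((\<lambda>w. exp (- (of_real r / (4 * w))) * inverse w ^ m) has_field_derivative
     (exp (- (of_real r / (4 * w))) * (of_real r * 4 / (4 * w)\<^sup>2)) * inverse w ^ m
     + exp (- (of_real r / (4 * w))) * (of_nat m * inverse w ^ (m - 1) * (- (inverse w ^ 2)))) (at w)"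
  proof -
    have D1: "((\<lambda>w. exp (- (of_real r / (4 * w)))) has_field_derivative exp (- (of_real r / (4 * w))) * (of_real r * 4 / (4 * w)\<^sup>2)) (at w)"
    proof -
      have eq: "- (of_real r / (4 * w)) = (- (of_real r / 4)) * inverse w" for w :: complex
        by (simp only: divide_inverse inverse_mult_distrib minus_mult_left mult.assoc)
      have d: "of_real r * 4 / (4 * w)\<^sup>2 = - (of_real r / 4) * (- (inverse w * inverse w))"
        using assms by (simp add: power2_eq_square field_simps)
      have "((\<lambda>w. (- (of_real r / 4)) * inverse w) has_field_derivative (- (of_real r / 4)) * (- (inverse w * inverse w))) (at w)"
        using DERIV_cmult[OF DERIV_inverse[OF assms], of "- (of_real r / 4)"]
        by (simp only: numeral_2_eq_2 power_Suc power_0 mult_1_right)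
      from DERIV_fun_exp[OF this] show ?thesis unfolding eq d .
    qed
    have D2: "((\<lambda>w. inverse w ^ m) has_field_derivative of_nat m * inverse w ^ (m - 1) * (- (inverse w ^ 2))) (at w)"
      by (rule DERIV_cong[OF DERIV_power[OF DERIV_inverse[OF assms]]]) (simp add: numeral_2_eq_2)
    show ?thesis by (rule DERIV_cong[OF DERIV_mult[OF D1 D2]]) (simp only: mult_ac add_ac)
  qed
  also have "(exp (- (of_real r / (4 * w))) * (of_real r * 4 / (4 * w)\<^sup>2)) * inverse w ^ m
     + exp (- (of_real r / (4 * w))) * (of_nat m * inverse w ^ (m - 1) * (- (inverse w ^ 2)))
     = of_real r / 4 * heat (m + 2) w r - of_nat m * heat (Suc m) w r"
  proof (cases m)
    case 0
    then show ?thesis using assms by (simp add: heat_def power2_eq_square field_simps)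
  next
    case (Suc n)
    then show ?thesis using assms by (simp add: heat_def power2_eq_square field_simps power_inverse)
  qed
  finally show ?thesis by (simp only: heat_def[of m, abs_def] divide_inverse power_inverse)
qed

context laplace_ray begin

lemma heat_ray_vector_derivative:
  assumes "s \<ge> 0"
  shows "((\<lambda>s. heat m (ray \<epsilon> d s) r) has_vector_derivative (of_real r / 4 * heat (m + 2) (ray \<epsilon> d s) r - of_nat m * heat (Suc m) (ray \<epsilon> d s) r) * d) (at s)"
proof -
  have "(ray \<epsilon> d has_vector_derivative d) (at s)"
    unfolding ray_def by (auto intro!: derivative_eq_intros)
  from field_vector_diff_chain_at[OF this heat_has_field_derivative[OF ray_nz[OF assms]]]
  show ?thesis by (simp add: o_def mult.commute)
qed

lemma exp_ray_vector_derivative: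
  "((\<lambda>s. exp (\<kappa> * d * of_real s)) has_vector_derivative exp (\<kappa> * d * of_real s) * (\<kappa> * d)) (at s)"
  by (rule has_vector_derivative_real_field) (auto intro!: derivative_eq_intros)

lemma heat_ray_tendsto_0: "((\<lambda>s. heat m (ray \<epsilon> d s) r * exp (\<kappa> * d * of_real s)) \<longlongrightarrow> 0) at_top"
proof (rule Lim_null_comparison)
  show "\<forall>\<^sub>F s in at_top. norm (heat m (ray \<epsilon> d s) r * exp (\<kappa> * d * of_real s)) \<le> exp (\<bar>r\<bar> / (4 * \<epsilon>)) / \<epsilon> ^ m * exp (- (rate * s))"
    using eventually_ge_at_top[of 0]
  proof eventually_elim
    case (elim s)
    then show ?case unfolding norm_mult norm_exp_ray
      by (intro mult_right_mono norm_heat_crude[OF Re_ray eps]) auto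
  qed
  have "LIM s at_top. - (rate * s) :> at_bot"
    unfolding filterlim_uminus_at_bot by (simp add: filterlim_tendsto_pos_mult_at_top[OF tendsto_const rate_pos filterlim_ident])
  then have "((\<lambda>s. exp (- (rate * s))) \<longlongrightarrow> 0) at_top" by (rule filterlim_compose[OF exp_at_bot])
  then show "((\<lambda>s. exp (\<bar>r\<bar> / (4 * \<epsilon>)) / \<epsilon> ^ m * exp (- (rate * s))) \<longlongrightarrow> 0) at_top"
    by (rule tendsto_mult_right_zero)
qed

text \<open>The second derivative of \<open>heat 1\<close> in \<open>w\<close> is \<open>2 heat 3 - r heat 4 + r\<^sup>2/16 heat 5\<close>.  The integrand of
  the left-hand side is the derivative along the ray of \<open>(\<partial>\<^sub>w heat 1 - \<kappa> heat 1) exp (\<kappa> (w - \<epsilon>))\<close>, of which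
  only the value at the start of the ray remains.\<close>

lemma heat_laplace_wave:
  "2 * heat_laplace 3 \<kappa> d \<epsilon> r - of_real r * heat_laplace 4 \<kappa> d \<epsilon> r + (of_real r)\<^sup>2 / 16 * heat_laplace 5 \<kappa> d \<epsilon> r
    - \<kappa>\<^sup>2 * heat_laplace 1 \<kappa> d \<epsilon> r
   = \<kappa> * heat 1 (of_real \<epsilon>) r - (of_real r / 4 * heat 3 (of_real \<epsilon>) r - heat 2 (of_real \<epsilon>) r)"
proof -
  define h where "h m s = heat m (ray \<epsilon> d s) r" for m s
  define E where "E s = exp (\<kappa> * d * of_real s)" for s
  define G where "G s = (of_real r / 4 * h 3 s - h 2 s - \<kappa> * h 1 s) * E s" for s
  define g where "g s = 2 * (h 3 s * E s * d) - of_real r * (h 4 s * E s * d) + (of_real r)\<^sup>2 / 16 * (h 5 s * E s * d) - \<kappa>\<^sup>2 * (h 1 s * E s * d)" for s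
  have hi: "set_integrable lborel {0<..} (\<lambda>s. h m s * E s * d)" for m
    unfolding h_def E_def by (rule heat_ray_integrable)
  have hl: "heat_laplace m \<kappa> d \<epsilon> r = (LINT s:{0<..}|lborel. h m s * E s * d)" for m
    unfolding h_def E_def heat_laplace_def ..
  have hd: "(h m has_vector_derivative (of_real r / 4 * h (m + 2) s - of_nat m * h (Suc m) s) * d) (at s)" if "s \<ge> 0" for m s
    unfolding h_def by (rule heat_ray_vector_derivative[OF that])
  have Ed: "(E has_vector_derivative E s * (\<kappa> * d)) (at s)" for s
    unfolding E_def by (rule exp_ray_vector_derivative)
  have Gd: "(G has_vector_derivative g s) (at s)" if s: "s \<ge> 0" for s
  proof -
    have "(G has_vector_derivative (of_real r / 4 * h 3 s - h 2 s - \<kappa> * h 1 s) * (E s * (\<kappa> * d)) +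
       (of_real r / 4 * ((of_real r / 4 * h (3 + 2) s - of_nat 3 * h (Suc 3) s) * d) - (of_real r / 4 * h (2 + 2) s - of_nat 2 * h (Suc 2) s) * d
         - \<kappa> * ((of_real r / 4 * h (1 + 2) s - of_nat 1 * h (Suc 1) s) * d)) * E s) (at s)"
      unfolding G_def by (intro derivative_intros hd[OF s] Ed)
    also have "(of_real r / 4 * h 3 s - h 2 s - \<kappa> * h 1 s) * (E s * (\<kappa> * d)) +
       (of_real r / 4 * ((of_real r / 4 * h (3 + 2) s - of_nat 3 * h (Suc 3) s) * d) - (of_real r / 4 * h (2 + 2) s - of_nat 2 * h (Suc 2) s) * d
         - \<kappa> * ((of_real r / 4 * h (1 + 2) s - of_nat 1 * h (Suc 1) s) * d)) * E s = g s"
      unfolding g_def by (simp add: algebra_simps power2_eq_square eval_nat_numeral)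
    finally show ?thesis .
  qed
  have gi: "set_integrable lborel {0<..} g"
    unfolding g_def by (intro set_integral_add set_integral_diff set_integrable_mult_right hi)
  have "(LINT s:{0<..}|lborel. g s) = 0 - G 0"
  proof (rule integral_derivative_half_line[OF Gd _ gi])
    have "isCont (h m) s" if "s > 0" for m s
      using has_vector_derivative_continuous[OF hd[of s m]] that by auto
    moreover have "isCont E s" for s using has_vector_derivative_continuous[OF Ed] by auto
    ultimately show "isCont g s" if "s > 0" for s
      unfolding g_def using that by (intro continuous_intros) auto
    have G: "G s = of_real r / 4 * (h 3 s * E s) - h 2 s * E s - \<kappa> * (h 1 s * E s)" for s
      by (simp add: G_def algebra_simps)
    have "((\<lambda>s. of_real r / 4 * (h 3 s * E s) - h 2 s * E s - \<kappa> * (h 1 s * E s)) \<longlongrightarrow> of_real r / 4 * 0 - 0 - \<kappa> * 0) at_top"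
      unfolding h_def E_def by (intro tendsto_intros heat_ray_tendsto_0)
    then show "(G \<longlongrightarrow> 0) at_top" unfolding G by simp
  qed auto
  moreover have "(LINT s:{0<..}|lborel. g s) = 2 * heat_laplace 3 \<kappa> d \<epsilon> r - of_real r * heat_laplace 4 \<kappa> d \<epsilon> r + (of_real r)\<^sup>2 / 16 * heat_laplace 5 \<kappa> d \<epsilon> r
    - \<kappa>\<^sup>2 * heat_laplace 1 \<kappa> d \<epsilon> r"
    unfolding g_def hl
    by (simp only: set_integral_add set_integral_diff set_integral_mult_right set_integrable_mult_right hi)
  moreover have "G 0 = (of_real r / 4 * heat 3 (of_real \<epsilon>) r - heat 2 (of_real \<epsilon>) r) - \<kappa> * heat 1 (of_real \<epsilon>) r"
    by (simp add: G_def h_def E_def ray_def)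
  ultimately show ?thesis by simp
qed

end

section \<open>The mollified resolvent kernel\<close>

text \<open>The weights \<open>exp (k w)\<close> and \<open>exp (- k w)\<close> decay in different directions, whence two rays.\<close>

locale resolvent_rays =
  fixes k d1 d2 :: complex and \<epsilon> :: real
  assumes eps: "\<epsilon> > 0" and d1: "Re d1 \<ge> 0" "Re (k * d1) < 0" and d2: "Re d2 \<ge> 0" "Re (k * d2) > 0"
begin

sublocale plus: laplace_ray k d1 \<epsilon> using eps d1 by unfold_locales
sublocale minus: laplace_ray "- k" d2 \<epsilon> using eps d2 by unfold_locales auto

text \<open>The difference of the mollified resolvent kernels of \<open>-\<Delta>\<close> at \<open>k\<close> and \<open>-k\<close>, as a function of the squared
  distance, with its derivatives.\<close>

definition kernel :: "nat \<Rightarrow> real \<Rightarrow> complex" where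
  "kernel m r = (- (1/4)) ^ m * (heat_laplace (Suc m) k d1 \<epsilon> r - heat_laplace (Suc m) (- k) d2 \<epsilon> r)"

lemma kernel_rapid: "rapid_ctower kernel"
  unfolding rapid_ctower_def
proof (intro conjI allI)
  fix m r
  have "(kernel m has_vector_derivative (- (1/4)) ^ m * (- (1/4) * heat_laplace (Suc (Suc m)) k d1 \<epsilon> r - (- (1/4) * heat_laplace (Suc (Suc m)) (- k) d2 \<epsilon> r))) (at r)"
    unfolding kernel_def
    by (intro has_vector_derivative_mult_right has_vector_derivative_diff plus.heat_laplace_derivative minus.heat_laplace_derivative)
  then show "(kernel m has_vector_derivative kernel (Suc m) r) (at r)"
    by (simp add: kernel_def algebra_simps)
next
  fix m N
  obtain C1 C2 where C: "\<And>r. r \<ge> 0 \<Longrightarrow> norm (heat_laplace (Suc m) k d1 \<epsilon> r) * (1 + r) ^ N \<le> C1"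
    "\<And>r. r \<ge> 0 \<Longrightarrow> norm (heat_laplace (Suc m) (- k) d2 \<epsilon> r) * (1 + r) ^ N \<le> C2"
    using plus.heat_laplace_rapid[of "Suc m" N] minus.heat_laplace_rapid[of "Suc m" N] by blast
  have "norm (kernel m r) * (1 + r) ^ N \<le> C1 + C2" if r: "r \<ge> 0" for r
  proof -
    have "norm ((- (1/4)) ^ m :: complex) \<le> 1" by (simp add: norm_power power_le_one)
    moreover have "norm (heat_laplace (Suc m) k d1 \<epsilon> r - heat_laplace (Suc m) (- k) d2 \<epsilon> r) \<le> norm (heat_laplace (Suc m) k d1 \<epsilon> r) + norm (heat_laplace (Suc m) (- k) d2 \<epsilon> r)"
      by (rule norm_triangle_ineq4)
    ultimately have "norm (kernel m r) \<le> 1 * (norm (heat_laplace (Suc m) k d1 \<epsilon> r) + norm (heat_laplace (Suc m) (- k) d2 \<epsilon> r))"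
      unfolding kernel_def norm_mult by (intro mult_mono) auto
    then have "norm (kernel m r) * (1 + r) ^ N \<le> (norm (heat_laplace (Suc m) k d1 \<epsilon> r) + norm (heat_laplace (Suc m) (- k) d2 \<epsilon> r)) * (1 + r) ^ N"
      using r by (intro mult_right_mono) auto
    also have "\<dots> \<le> C1 + C2" using C[OF r] by (simp add: ring_distribs add_mono)
    finally show ?thesis .
  qed
  then show "\<exists>C. \<forall>r\<ge>0. norm (kernel m r) * (1 + r) ^ N \<le> C" by blast
qed

lemma k_nz: "k \<noteq> 0" using d1 by auto

text \<open>This is the radial equation required in \<open>representation\<close>.  Of the boundary terms at \<open>\<epsilon>\<close>, the one that is
  odd in \<open>\<kappa>\<close> is doubled in the difference of the two rays, and the even one cancels.\<close>

lemma kernel_equation: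
  "4 / k * (8 * kernel 2 r + 16 * of_real r * kernel 3 r + 4 * (of_real r)\<^sup>2 * kernel 4 r) = k * kernel 0 r + 2 * heat 1 (of_real \<epsilon>) r"
proof -
  define A where "A m = heat_laplace m k d1 \<epsilon> r" for m
  define B where "B m = heat_laplace m (- k) d2 \<epsilon> r" for m
  have wA: "2 * A 3 - of_real r * A 4 + (of_real r)\<^sup>2 / 16 * A 5
    = k\<^sup>2 * A 1 + k * heat 1 (of_real \<epsilon>) r - (of_real r / 4 * heat 3 (of_real \<epsilon>) r - heat 2 (of_real \<epsilon>) r)"
    using plus.heat_laplace_wave[of r] unfolding A_def by (simp add: algebra_simps)
  have wB: "2 * B 3 - of_real r * B 4 + (of_real r)\<^sup>2 / 16 * B 5
    = k\<^sup>2 * B 1 - k * heat 1 (of_real \<epsilon>) r - (of_real r / 4 * heat 3 (of_real \<epsilon>) r - heat 2 (of_real \<epsilon>) r)"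
    using minus.heat_laplace_wave[of r] unfolding B_def by (simp add: algebra_simps)
  have p: "(- (1/4) :: complex) ^ 2 = 1/16" "(- (1/4) :: complex) ^ 3 = - (1/64)" "(- (1/4) :: complex) ^ 4 = 1/256"
    by (simp_all add: power2_eq_square power3_eq_cube power4_eq_xxxx)
  have kern: "kernel 0 r = A 1 - B 1" "kernel 2 r = 1/16 * (A 3 - B 3)" "kernel 3 r = - (1/64) * (A 4 - B 4)" "kernel 4 r = 1/256 * (A 5 - B 5)"
    unfolding kernel_def A_def B_def p by simp_all
  have "4 * (8 * kernel 2 r + 16 * of_real r * kernel 3 r + 4 * (of_real r)\<^sup>2 * kernel 4 r)
     = (2 * A 3 - of_real r * A 4 + (of_real r)\<^sup>2 / 16 * A 5) - (2 * B 3 - of_real r * B 4 + (of_real r)\<^sup>2 / 16 * B 5)"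
    unfolding kern by (simp add: field_simps)
  also have "\<dots> = k * (k * kernel 0 r + 2 * heat 1 (of_real \<epsilon>) r)"
    unfolding wA wB kern by (simp add: algebra_simps power2_eq_square)
  finally show ?thesis using k_nz by (simp add: field_simps)
qed

end

section \<open>An oscillatory integral\<close>

text \<open>The mean value inequality on the right half plane, where the derivative of \<open>exp (- v)\<close> has modulus at most one.\<close>

lemma norm_exp_minus_1_le:
  fixes v :: complex assumes "Re v \<ge> 0" shows "norm (1 - exp (- v)) \<le> norm v"
proof -
  have "norm (exp (- v) - exp (- 0)) \<le> 1 * norm (v - 0)"
  proof (rule field_differentiable_bound[where S = "{z. Re z \<ge> 0}" and f = "\<lambda>z. exp (- z)" and f' = "\<lambda>z. - exp (- z)"])
    show "convex {z::complex. Re z \<ge> 0}" by (rule convex_halfspace_Re_ge)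
    show "((\<lambda>z. exp (- z)) has_field_derivative - exp (- z)) (at z within {z. Re z \<ge> 0})" for z :: complex
      by (auto intro!: derivative_eq_intros)
  qed (use assms in auto)
  then show ?thesis by (simp add: norm_minus_commute)
qed

lemma norm_exp_second_order_le:
  fixes v :: complex assumes "Re v \<ge> 0" shows "norm (1 - exp (- v) * (1 + v)) \<le> (norm v)\<^sup>2"
proof -
  define S where "S = {z::complex. Re z \<ge> 0 \<and> norm z \<le> norm v}"
  have S: "convex S" unfolding S_def
    using convex_Int[OF convex_halfspace_Re_ge[of 0] convex_cball[of "0::complex" "norm v"]]
    by (simp add: cball_def Int_def)
  have "norm (exp (- v) * (1 + v) - exp (- 0) * (1 + 0)) \<le> norm v * norm (v - 0)"
  proof (rule field_differentiable_bound[OF S, where f = "\<lambda>z. exp (- z) * (1 + z)" and f' = "\<lambda>z. - z * exp (- z)"])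
    fix z assume z: "z \<in> S"
    show "((\<lambda>z. exp (- z) * (1 + z)) has_field_derivative - z * exp (- z)) (at z within S)"
      by (auto intro!: derivative_eq_intros simp: algebra_simps)
    have "norm z * exp (- Re z) \<le> norm v * 1" using z by (intro mult_mono) (auto simp: S_def)
    then show "norm (- z * exp (- z)) \<le> norm v" by (simp add: norm_mult)
  qed (use assms in \<open>auto simp: S_def\<close>)
  then show ?thesis by (simp add: power2_eq_square norm_minus_commute)
qed

lemma half_line_integral:
  fixes f F :: "real \<Rightarrow> real"
  assumes b: "f \<in> borel_measurable borel" and F: "\<And>s. s \<ge> a \<Longrightarrow> (F has_real_derivative f s) (at s)" and nn: "\<And>s. s \<ge> a \<Longrightarrow> f s \<ge> 0"
    and L: "(F \<longlongrightarrow> L) at_top"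
  shows "set_integrable lborel {a<..} f" "(LINT s:{a<..}|lborel. f s) = L - F a"
proof -
  have "F a \<le> L"
  proof (rule tendsto_lowerbound[OF L])
    have "F a \<le> F s" if "s \<ge> a" for s
      by (rule DERIV_nonneg_imp_nondecreasing[OF that]) (use F nn in blast)
    then show "\<forall>\<^sub>F s in at_top. F a \<le> F s" by (intro eventually_mono[OF eventually_ge_at_top[of a]])
  qed simp
  have "(\<integral>\<^sup>+ s. ennreal (f s) * indicator {a..} s \<partial>lborel) = ennreal (L - F a)"
    by (rule nn_integral_FTC_atLeast[OF b F nn L]) auto
  also have "(\<integral>\<^sup>+ s. ennreal (f s) * indicator {a..} s \<partial>lborel) = (\<integral>\<^sup>+ s. ennreal (indicator {a<..} s *\<^sub>R f s) \<partial>lborel)"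
    by (intro nn_integral_cong_AE eventually_mono[OF AE_lborel_singleton[of a]]) (auto simp: indicator_def)
  finally have nn': "(\<integral>\<^sup>+ s. ennreal (indicator {a<..} s *\<^sub>R f s) \<partial>lborel) = ennreal (L - F a)" .
  have m: "(\<lambda>s. indicator {a<..} s *\<^sub>R f s) \<in> borel_measurable lborel" using b by simp
  show "set_integrable lborel {a<..} f"
    unfolding set_integrable_def using nn' m nn by (intro integrableI_nonneg) (auto simp: indicator_def)
  show "(LINT s:{a<..}|lborel. f s) = L - F a"
    unfolding set_lebesgue_integral_def using nn' m nn \<open>F a \<le> L\<close>
    by (subst integral_eq_nn_integral) (auto simp: indicator_def)
qed

text \<open>The integral over \<open>0 \<le> s \<le> r\<close> of \<open>exp (\<Phi> s) / w s\<close> with \<open>w = \<epsilon> \<plusminus> \<i> s\<close> and phase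
  \<open>\<Phi> = - r / (4 w) + \<mu> s\<close>.  Here \<open>w\<^sup>2 \<Phi>'\<close> is called \<open>denom\<close>.  It can be small only if \<open>|\<mu>| |w|\<^sup>2\<close> is
  comparable to \<open>r\<close>.  The corresponding \<open>s\<close> form an interval on which \<open>|w|\<close> is constant up to a factor
  of two, and the integral of \<open>1 / |w|\<close> over it is bounded.  Before and after that interval
  one integrates by parts.\<close>

locale phase =
  fixes \<mu> d :: complex and \<epsilon> r :: real
  assumes eps: "0 < \<epsilon>" "\<epsilon> \<le> r" and \<mu>: "Re \<mu> < 0" and d: "d = \<i> \<or> d = - \<i>"
begin

abbreviation w :: "real \<Rightarrow> complex" where "w \<equiv> ray \<epsilon> d"

lemma r_pos: "r > 0" using eps by linarith

lemma dd: "d * d = -1" "norm d = 1" "Re d = 0" "Im d * Im d = 1" using d by auto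

lemma norm_w: "(norm (w s))\<^sup>2 = \<epsilon>\<^sup>2 + s\<^sup>2"
  using d by (auto simp: ray_def cmod_power2)

lemma w_nz: "w s \<noteq> 0"
proof
  assume "w s = 0"
  then have "\<epsilon>\<^sup>2 + s\<^sup>2 = 0" using norm_w[of s] by simp
  then show False using eps by (simp add: sum_power2_eq_zero_iff)
qed

definition osc :: "real \<Rightarrow> complex" where
  "osc s = heat 0 (w s) r * exp (\<mu> * of_real s)"

definition denom :: "real \<Rightarrow> complex" where "denom s = of_real r * d / 4 + \<mu> * (w s)\<^sup>2"
definition numer :: "real \<Rightarrow> complex" where "numer s = d * (of_real r * d / 4 - \<mu> * (w s)\<^sup>2)"

lemma Re_inverse_w: "Re (1 / w s) \<ge> 0"
proof -
  have "Re (1 / w s) = \<epsilon> / (norm (w s))\<^sup>2"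
    using dd by (simp add: Re_divide cmod_power2 ray_def)
  then show ?thesis using eps by simp
qed

lemma norm_osc: "s \<ge> 0 \<Longrightarrow> norm (osc s) \<le> 1"
proof -
  assume s: "s \<ge> 0"
  have "norm (heat 0 (w s) r) \<le> 1" unfolding norm_heat using Re_inverse_w[of s] r_pos by simp
  moreover have "norm (exp (\<mu> * of_real s)) \<le> 1" using s \<mu> by (simp add: mult_nonpos_nonneg)
  ultimately show ?thesis unfolding osc_def norm_mult by (intro mult_le_one) auto
qed

text \<open>Since \<open>exp \<Phi>\<close> has derivative \<open>\<Phi>' exp \<Phi>\<close>, the factor \<open>w / denom = 1 / (w \<Phi>')\<close> reproduces the
  integrand \<open>exp \<Phi> / w\<close>; the second summand is the error to be estimated.\<close>

lemma osc_derivative: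
  assumes "denom s \<noteq> 0"
  shows "((\<lambda>s. w s / denom s * osc s) has_vector_derivative (osc s / w s + numer s / (denom s)\<^sup>2 * osc s)) (at s)"
proof -
  have wd: "(w has_vector_derivative d) (at s)" unfolding ray_def by (auto intro!: derivative_eq_intros)
  have hd: "((\<lambda>s. heat 0 (w s) r) has_vector_derivative (of_real r / 4 * heat 2 (w s) r) * d) (at s)"
    using field_vector_diff_chain_at[OF wd heat_has_field_derivative[OF w_nz, of 0 r s]]
    by (simp add: o_def mult.commute numeral_2_eq_2)
  have ed: "((\<lambda>s. exp (\<mu> * of_real s)) has_vector_derivative exp (\<mu> * of_real s) * \<mu>) (at s)"
    by (rule has_vector_derivative_real_field) (auto intro!: derivative_eq_intros)
  have od: "(osc has_vector_derivative heat 0 (w s) r * (exp (\<mu> * of_real s) * \<mu>) + (of_real r / 4 * heat 2 (w s) r) * d * exp (\<mu> * of_real s)) (at s)"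
    unfolding osc_def by (rule has_vector_derivative_mult[OF hd ed])
  have h2: "heat 2 (w s) r = heat 0 (w s) r / (w s)\<^sup>2" by (simp add: heat_def)
  have od': "(osc has_vector_derivative osc s * (denom s / (w s)\<^sup>2)) (at s)"
  proof -
    have gen: "h * (E * \<mu>) + (R / 4 * (h / z)) * d * E = (h * E) * ((R * d / 4 + \<mu> * z) / z)" if "z \<noteq> 0" for h E R z :: complex
      using that by (simp add: add_divide_distrib algebra_simps)
    have "(w s)\<^sup>2 \<noteq> 0" using w_nz by simp
    from gen[OF this] show ?thesis using od unfolding h2 by (simp only: osc_def denom_def)
  qed
  have qd: "((\<lambda>z. z / (of_real r * d / 4 + \<mu> * z\<^sup>2)) has_field_derivative (of_real r * d / 4 - \<mu> * (w s)\<^sup>2) / (denom s)\<^sup>2) (at (w s))"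
    using assms by (auto intro!: derivative_eq_intros simp: denom_def power2_eq_square algebra_simps)
  have qd': "((\<lambda>s. w s / denom s) has_vector_derivative numer s / (denom s)\<^sup>2) (at s)"
    using field_vector_diff_chain_at[OF wd qd] by (simp add: o_def denom_def numer_def)
  have "w s / denom s * (osc s * (denom s / (w s)\<^sup>2)) = osc s / w s"
    using w_nz[of s] assms by (simp add: power2_eq_square)
  with has_vector_derivative_mult[OF qd' od'] show ?thesis by simp
qed

lemma continuous_osc_w: "continuous_on S (\<lambda>s. osc s / w s)"
  unfolding osc_def heat_def by (intro continuous_intros continuous_on_ray) (auto simp: w_nz)

lemma osc_by_parts:
  assumes "a \<le> b" and nz: "\<And>s. s \<in> {a..b} \<Longrightarrow> denom s \<noteq> 0"
  shows "integral {a..b} (\<lambda>s. osc s / w s) = (w b / denom b * osc b - w a / denom a * osc a) - integral {a..b} (\<lambda>s. numer s / (denom s)\<^sup>2 * osc s)"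
    and "(\<lambda>s. numer s / (denom s)\<^sup>2 * osc s) integrable_on {a..b}"
proof -
  have F: "((\<lambda>s. osc s / w s + numer s / (denom s)\<^sup>2 * osc s) has_integral (w b / denom b * osc b - w a / denom a * osc a)) {a..b}"
    by (rule fundamental_theorem_of_calculus[OF assms(1)]) (use osc_derivative nz in \<open>auto intro: has_vector_derivative_at_within\<close>)
  show i: "(\<lambda>s. numer s / (denom s)\<^sup>2 * osc s) integrable_on {a..b}"
    unfolding osc_def heat_def numer_def
    by (intro integrable_continuous_interval continuous_intros continuous_on_ray)
       (use nz w_nz in \<open>auto simp: denom_def intro!: continuous_intros continuous_on_ray\<close>)
  show "integral {a..b} (\<lambda>s. osc s / w s) = (w b / denom b * osc b - w a / denom a * osc a) - integral {a..b} (\<lambda>s. numer s / (denom s)\<^sup>2 * osc s)"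
    using integral_unique[OF has_integral_diff[OF F integrable_integral[OF i]]] by simp
qed

lemma norm_leading: "norm (of_real r * d / 4) = r / 4" using dd r_pos by (simp add: norm_mult norm_divide)

lemma norm_mu_w: "norm (\<mu> * (w s)\<^sup>2) = norm \<mu> * (\<epsilon>\<^sup>2 + s\<^sup>2)" by (simp add: norm_mult norm_power norm_w)

lemma norm_numer: "norm (numer s) \<le> r / 4 + norm \<mu> * (\<epsilon>\<^sup>2 + s\<^sup>2)"
  unfolding numer_def norm_mult dd using norm_triangle_ineq4[of "of_real r * d / 4" "\<mu> * (w s)\<^sup>2"]
  by (simp only: norm_leading norm_mu_w mult_1)

lemma norm_denom: "norm (denom s) \<ge> r / 4 - norm \<mu> * (\<epsilon>\<^sup>2 + s\<^sup>2)" "norm (denom s) \<ge> norm \<mu> * (\<epsilon>\<^sup>2 + s\<^sup>2) - r / 4"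
  unfolding denom_def
  using norm_diff_ineq[of "of_real r * d / 4" "\<mu> * (w s)\<^sup>2"] norm_diff_ineq[of "\<mu> * (w s)\<^sup>2" "of_real r * d / 4"]
  by (simp_all only: norm_leading norm_mu_w add.commute)

lemma norm_w_le: "0 \<le> s \<Longrightarrow> s \<le> r \<Longrightarrow> norm (w s) \<le> 2 * r"
  using norm_triangle_ineq[of "of_real \<epsilon>" "d * of_real s"] eps dd by (simp add: ray_def norm_mult)

text \<open>Here \<open>|denom| \<ge> r / 8\<close>.  The two boundary terms contribute \<open>16\<close> each and the error term \<open>24\<close>.\<close>

lemma before_stationary:
  assumes ab: "0 \<le> b" "b \<le> r" and small: "\<And>s. s \<in> {0..b} \<Longrightarrow> norm \<mu> * (\<epsilon>\<^sup>2 + s\<^sup>2) \<le> r / 8"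
  shows "norm (integral {0..b} (\<lambda>s. osc s / w s)) \<le> 56"
proof -
  have D: "norm (denom s) \<ge> r / 8" if "s \<in> {0..b}" for s using norm_denom(1)[of s] small[OF that] by linarith
  then have nz: "denom s \<noteq> 0" if "s \<in> {0..b}" for s using D[OF that] r_pos by auto
  have e: "norm (w s / denom s * osc s) \<le> 16" if s: "s \<in> {0..b}" for s
  proof -
    have "norm (w s / denom s) \<le> (2 * r) / (r / 8)"
      unfolding norm_divide using D[OF s] norm_w_le[of s] s ab r_pos by (intro frac_le) auto
    then have "norm (w s / denom s) * norm (osc s) \<le> 16 * 1"
      using norm_osc[of s] s r_pos by (intro mult_mono) auto
    then show ?thesis by (simp only: norm_mult mult_1_right)
  qed
  have "norm (integral {0..b} (\<lambda>s. numer s / (denom s)\<^sup>2 * osc s)) \<le> integral {0..b} (\<lambda>s. 24 / r)"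
  proof (rule integral_norm_bound_integral)
    show "(\<lambda>s. numer s / (denom s)\<^sup>2 * osc s) integrable_on {0..b}" by (rule osc_by_parts(2)[OF ab(1) nz])
    fix s assume s: "s \<in> {0..b}"
    have "norm (numer s / (denom s)\<^sup>2) \<le> (3 * r / 8) / (r / 8)\<^sup>2"
      unfolding norm_divide norm_power using norm_numer[of s] small[OF s] D[OF s] r_pos by (intro frac_le power_mono) auto
    also have "\<dots> = 24 / r" using r_pos by (simp add: power2_eq_square field_simps)
    finally have "norm (numer s / (denom s)\<^sup>2) * norm (osc s) \<le> 24 / r * 1"
      using norm_osc[of s] s r_pos by (intro mult_mono) auto
    then show "norm (numer s / (denom s)\<^sup>2 * osc s) \<le> 24 / r" by (simp only: norm_mult mult_1_right)
  qed auto
  also have "\<dots> \<le> 24" using ab r_pos by (simp add: field_simps)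
  finally have I: "norm (integral {0..b} (\<lambda>s. numer s / (denom s)\<^sup>2 * osc s)) \<le> 24" .
  have "norm ((w b / denom b * osc b - w 0 / denom 0 * osc 0) - integral {0..b} (\<lambda>s. numer s / (denom s)\<^sup>2 * osc s)) \<le> (16 + 16) + 24"
    by (intro order_trans[OF norm_triangle_ineq4] add_mono e I) (use ab in auto)
  then show ?thesis using osc_by_parts(1)[OF ab(1) nz] by simp
qed

text \<open>Here \<open>|denom| \<ge> |\<mu>| |w|\<^sup>2 / 2\<close>.  With \<open>A\<^sup>2 = r / (2 |\<mu>|)\<close> all \<open>|w|\<close> are at least \<open>A\<close>, and the error term
  is dominated by a multiple of \<open>1 / (A\<^sup>2 + s\<^sup>2)\<close>, whose integral is of order \<open>1 / A\<close>.  Such an interval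
  exists only if \<open>|\<mu>| r \<ge> 1/4\<close>, because \<open>|w|\<^sup>2 \<le> 2 r\<^sup>2\<close>; hence \<open>|\<mu>| A\<close> is bounded below.\<close>

lemma after_stationary:
  assumes ab: "0 \<le> a" "a \<le> r" and large: "\<And>s. s \<in> {a..r} \<Longrightarrow> norm \<mu> * (\<epsilon>\<^sup>2 + s\<^sup>2) \<ge> r / 2"
  shows "norm (integral {a..r} (\<lambda>s. osc s / w s)) \<le> 84"
proof -
  define m where "m = norm \<mu>"
  have m: "m > 0" using \<mu> by (auto simp: m_def)
  define A where "A = sqrt (r / (2 * m))"
  have A: "A > 0" "A\<^sup>2 = r / (2 * m)" using m r_pos by (auto simp: A_def)
  have nA: "A\<^sup>2 \<le> \<epsilon>\<^sup>2 + s\<^sup>2" if "s \<in> {a..r}" for s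
    using large[OF that] m unfolding A(2) m_def[symmetric] by (simp add: field_simps)
  have mA: "m * A \<ge> 1 / 3"
  proof -
    have "m * (\<epsilon>\<^sup>2 + r\<^sup>2) \<ge> r / 2" using large[of r] ab by (simp add: m_def)
    moreover have "\<epsilon>\<^sup>2 + r\<^sup>2 \<le> 2 * r * r" using eps power_mono[of \<epsilon> r 2] by (simp add: power2_eq_square)
    ultimately have "r / 2 \<le> m * (2 * r * r)" using m by (meson less_imp_le mult_left_mono order_trans)
    then have "m * r \<ge> 1 / 4" using r_pos by simp
    then have "(m * A)\<^sup>2 \<ge> 1 / 8" using m unfolding power_mult_distrib A(2) by (simp add: power2_eq_square field_simps)
    then have "(1 / 3)\<^sup>2 \<le> (m * A)\<^sup>2" by (simp add: power2_eq_square)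
    then show ?thesis by (rule power2_le_imp_le) (use m A in auto)
  qed
  have D: "norm (denom s) \<ge> m * (\<epsilon>\<^sup>2 + s\<^sup>2) / 2" if "s \<in> {a..r}" for s
    using norm_denom(2)[of s] large[OF that] unfolding m_def[symmetric] by linarith
  have pos: "\<epsilon>\<^sup>2 + s\<^sup>2 > 0" for s using eps by (simp add: add_pos_nonneg)
  have nz: "denom s \<noteq> 0" if "s \<in> {a..r}" for s
  proof
    assume "denom s = 0"
    then have "m * (\<epsilon>\<^sup>2 + s\<^sup>2) / 2 \<le> 0" using D[OF that] by (simp only: norm_zero)
    moreover have "0 < m * (\<epsilon>\<^sup>2 + s\<^sup>2) / 2" by (rule half_gt_zero[OF mult_pos_pos[OF m pos]])
    ultimately show False by (meson not_le)
  qed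
  have e: "norm (w s / denom s * osc s) \<le> 6" if s: "s \<in> {a..r}" for s
  proof -
    have "A\<^sup>2 \<le> (norm (w s))\<^sup>2" unfolding norm_w by (rule nA[OF s])
    then have wA: "A \<le> norm (w s)" by (rule power2_le_imp_le) simp
    have "norm (w s / denom s) \<le> norm (w s) / (m * (norm (w s))\<^sup>2 / 2)"
      unfolding norm_divide norm_w 
      by (rule divide_left_mono[OF D[OF s] norm_ge_zero])
         (intro mult_pos_pos half_gt_zero m pos zero_less_norm_iff[THEN iffD2] nz s)
    also have "\<dots> = 2 / (m * norm (w s))" using w_nz[of s] m by (simp add: power2_eq_square field_simps)
    also have "\<dots> \<le> 2 / (m * A)" using wA m A by (intro divide_left_mono mult_left_mono mult_pos_pos) auto
    also have "\<dots> \<le> 2 / (1 / 3)" using mA by (intro divide_left_mono) auto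
    finally have "norm (w s / denom s) * norm (osc s) \<le> 6 * 1"
      using norm_osc[of s] s ab by (intro mult_mono) auto
    then show ?thesis by (simp only: norm_mult mult_1_right)
  qed
  have at: "((\<lambda>s. 12 / (m * A\<^sup>2) * inverse (1 + (s / A)\<^sup>2)) has_integral (12 / (m * A) * arctan (r / A) - 12 / (m * A) * arctan (a / A))) {a..r}"
  proof (rule fundamental_theorem_of_calculus[OF ab(2)])
    fix s
    have "((\<lambda>s. 12 / (m * A) * arctan (s / A)) has_real_derivative 12 / (m * A\<^sup>2) * inverse (1 + (s / A)\<^sup>2)) (at s within {a..r})"
      using A m by (auto intro!: derivative_eq_intros simp: power2_eq_square)
    then show "((\<lambda>s. 12 / (m * A) * arctan (s / A)) has_vector_derivative 12 / (m * A\<^sup>2) * inverse (1 + (s / A)\<^sup>2)) (at s within {a..r})"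
      by (simp add: has_real_derivative_iff_has_vector_derivative)
  qed
  have "norm (integral {a..r} (\<lambda>s. numer s / (denom s)\<^sup>2 * osc s)) \<le> integral {a..r} (\<lambda>s. 12 / (m * A\<^sup>2) * inverse (1 + (s / A)\<^sup>2))"
  proof (rule integral_norm_bound_integral)
    show "(\<lambda>s. numer s / (denom s)\<^sup>2 * osc s) integrable_on {a..r}" by (rule osc_by_parts(2)[OF ab(2) nz])
    show "(\<lambda>s. 12 / (m * A\<^sup>2) * inverse (1 + (s / A)\<^sup>2)) integrable_on {a..r}" using at by blast
    fix s assume s: "s \<in> {a..r}"
    define n where "n = \<epsilon>\<^sup>2 + s\<^sup>2"
    have n: "n > 0" using pos by (simp add: n_def)
    have "norm (numer s / (denom s)\<^sup>2) \<le> (3 / 2 * (m * n)) / (m * n / 2)\<^sup>2"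
      unfolding norm_divide norm_power using norm_numer[of s] large[OF s] D[OF s] m n
      by (intro frac_le power_mono) (auto simp: n_def m_def)
    also have "\<dots> = 6 / (m * n)" using m n by (simp add: power2_eq_square field_simps)
    also have "\<dots> \<le> 6 / (m * ((A\<^sup>2 + s\<^sup>2) / 2))"
    proof (intro divide_left_mono mult_left_mono mult_pos_pos)
      have "A\<^sup>2 + s\<^sup>2 \<le> n + n" unfolding n_def by (intro add_mono nA[OF s]) simp
      then show "(A\<^sup>2 + s\<^sup>2) / 2 \<le> n" by simp
      show "0 < (A\<^sup>2 + s\<^sup>2) / 2" using A(1) by (intro half_gt_zero add_pos_nonneg) auto
    qed (use m n in auto)
    also have "\<dots> = 12 / (m * A\<^sup>2) * inverse (1 + (s / A)\<^sup>2)"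
    proof -
      have "A\<^sup>2 + s\<^sup>2 = A\<^sup>2 * (1 + (s / A)\<^sup>2)" using A(1) by (simp add: power_divide field_simps)
      moreover have "6 / (m * ((A\<^sup>2 * X) / 2)) = 12 / (m * A\<^sup>2) * inverse X" for X :: real
        by (simp add: inverse_eq_divide mult.assoc)
      ultimately show ?thesis by simp
    qed
    finally have "norm (numer s / (denom s)\<^sup>2) * norm (osc s) \<le> 12 / (m * A\<^sup>2) * inverse (1 + (s / A)\<^sup>2) * 1"
      using norm_osc[of s] s ab m A by (intro mult_mono) auto
    then show "norm (numer s / (denom s)\<^sup>2 * osc s) \<le> 12 / (m * A\<^sup>2) * inverse (1 + (s / A)\<^sup>2)" by (simp only: norm_mult mult_1_right)
  qed
  also have "\<dots> = 12 / (m * A) * (arctan (r / A) - arctan (a / A))" unfolding integral_unique[OF at] by (rule right_diff_distrib[symmetric])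
  also have "\<dots> \<le> 36 * 2"
  proof (rule mult_mono)
    have "12 / (m * A) \<le> 12 / (1 / 3)" using mA by (intro divide_left_mono) auto
    then show "12 / (m * A) \<le> 36" by simp
    have "0 \<le> arctan (a / A)" unfolding zero_le_arctan_iff using ab(1) A(1) by (intro divide_nonneg_pos)
    then show "arctan (r / A) - arctan (a / A) \<le> 2" using arctan_ubound[of "r / A"] pi_less_4 by linarith
  qed (use ab A in \<open>auto simp: divide_right_mono arctan_le_iff\<close>)
  finally have I: "norm (integral {a..r} (\<lambda>s. numer s / (denom s)\<^sup>2 * osc s)) \<le> 72" by simp
  have "norm ((w r / denom r * osc r - w a / denom a * osc a) - integral {a..r} (\<lambda>s. numer s / (denom s)\<^sup>2 * osc s)) \<le> (6 + 6) + 72"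
    by (intro order_trans[OF norm_triangle_ineq4] add_mono e I) (use ab in auto)
  then show ?thesis using osc_by_parts(1)[OF ab(2) nz] by simp
qed

text \<open>With \<open>A\<^sup>2 = r / (2 |\<mu>|)\<close>, here \<open>A / 2 \<le> |w| \<le> A\<close>; in particular the interval is no longer than \<open>A\<close>.\<close>

lemma near_stationary:
  assumes ab: "0 \<le> a" "a \<le> b" and mid: "\<And>s. s \<in> {a..b} \<Longrightarrow> r / 8 \<le> norm \<mu> * (\<epsilon>\<^sup>2 + s\<^sup>2) \<and> norm \<mu> * (\<epsilon>\<^sup>2 + s\<^sup>2) \<le> r / 2"
  shows "norm (integral {a..b} (\<lambda>s. osc s / w s)) \<le> 2"
proof -
  define m where "m = norm \<mu>"
  have m: "m > 0" using \<mu> by (auto simp: m_def)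
  define A where "A = sqrt (r / (2 * m))"
  have A: "A > 0" "A\<^sup>2 = r / (2 * m)" using m r_pos by (auto simp: A_def)
  have "norm (integral {a..b} (\<lambda>s. osc s / w s)) \<le> integral {a..b} (\<lambda>s. 2 / A)"
  proof (rule integral_norm_bound_integral)
    show "(\<lambda>s. osc s / w s) integrable_on {a..b}" by (intro integrable_continuous_interval continuous_osc_w)
    fix s assume s: "s \<in> {a..b}"
    have "(A / 2)\<^sup>2 \<le> (norm (w s))\<^sup>2"
      using mid[OF s] m unfolding power_divide A(2) norm_w m_def[symmetric] by (simp add: field_simps)
    then have "A / 2 \<le> norm (w s)" by (rule power2_le_imp_le) simp
    then have "norm (osc s) / norm (w s) \<le> 1 / (A / 2)"
      using norm_osc[of s] s ab A by (intro frac_le) auto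
    then show "norm (osc s / w s) \<le> 2 / A" by (simp add: norm_divide)
  qed auto
  also have "\<dots> = (b - a) * (2 / A)" using ab by simp
  also have "\<dots> \<le> A * (2 / A)"
  proof (rule mult_right_mono)
    have "b\<^sup>2 \<le> \<epsilon>\<^sup>2 + b\<^sup>2" by simp
    also have "\<dots> \<le> A\<^sup>2" using mid[of b] ab m unfolding A(2) m_def[symmetric] by (simp add: field_simps)
    finally have "b \<le> A" by (rule power2_le_imp_le) (use A in auto)
    then show "b - a \<le> A" using ab by simp
  qed (use A in auto)
  finally show ?thesis using A by simp
qed

lemma osc_bound: "norm (integral {0..r} (\<lambda>s. osc s / w s)) \<le> 142"
proof -
  define m where "m = norm \<mu>"
  have m: "m > 0" using \<mu> by (auto simp: m_def)
  \<comment> \<open>Where \<open>|w|\<^sup>2\<close> reaches \<open>c\<close>, clipped to the range of integration.\<close>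
  define t where "t c = min r (sqrt (max 0 (c - \<epsilon>\<^sup>2)))" for c
  have t: "0 \<le> t c" "t c \<le> r" for c using r_pos by (auto simp: t_def)
  have lo: "\<epsilon>\<^sup>2 + s\<^sup>2 \<le> c" if "0 \<le> s" "s \<le> t c" "0 < t c" for s c
  proof -
    have c: "c - \<epsilon>\<^sup>2 > 0" using that(3) r_pos by (auto simp: t_def max_def split: if_splits)
    have "s \<le> sqrt (c - \<epsilon>\<^sup>2)" using that(2) c by (simp add: t_def)
    then have "s\<^sup>2 \<le> c - \<epsilon>\<^sup>2" using that(1) c by (metis less_imp_le power_mono real_sqrt_pow2)
    then show ?thesis by simp
  qed
  have hi: "c \<le> \<epsilon>\<^sup>2 + s\<^sup>2" if "t c \<le> s" "t c < r" for s c
  proof -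
    have "sqrt (max 0 (c - \<epsilon>\<^sup>2)) \<le> s" using that by (auto simp: t_def min_def split: if_splits)
    then have "max 0 (c - \<epsilon>\<^sup>2) \<le> s\<^sup>2" by (rule sqrt_le_D)
    then show ?thesis by simp
  qed
  define c1 where "c1 = r / (8 * m)"
  define c2 where "c2 = r / (2 * m)"
  have c12: "c1 \<le> c2" unfolding c1_def c2_def using m r_pos by (intro frac_le) auto
  then have t12: "t c1 \<le> t c2" unfolding t_def by (intro min.mono real_sqrt_le_mono max.mono) (use c12 in auto)
  have 1: "norm (integral {0..t c1} (\<lambda>s. osc s / w s)) \<le> 56"
  proof (cases "t c1 = 0")
    case False
    have "norm \<mu> * (\<epsilon>\<^sup>2 + s\<^sup>2) \<le> r / 8" if "s \<in> {0..t c1}" for s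
      using lo[of s c1] that False m t(1)[of c1] unfolding c1_def m_def[symmetric] by (simp add: field_simps)
    then show ?thesis by (intro before_stationary t) auto
  qed auto
  have 2: "norm (integral {t c1..t c2} (\<lambda>s. osc s / w s)) \<le> 2"
  proof (cases "t c1 = t c2")
    case False
    then have "t c1 < r" "0 < t c2" using t t12 by (smt (verit))+
    then have "r / 8 \<le> norm \<mu> * (\<epsilon>\<^sup>2 + s\<^sup>2) \<and> norm \<mu> * (\<epsilon>\<^sup>2 + s\<^sup>2) \<le> r / 2" if "s \<in> {t c1..t c2}" for s
      using hi[of c1 s] lo[of s c2] that m t(1)[of c1] unfolding c1_def c2_def m_def[symmetric] by (simp add: field_simps)
    then show ?thesis by (intro near_stationary t t12) auto
  qed auto
  have 3: "norm (integral {t c2..r} (\<lambda>s. osc s / w s)) \<le> 84"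
  proof (cases "t c2 = r")
    case False
    then have "t c2 < r" using t(2)[of c2] by simp
    then have "norm \<mu> * (\<epsilon>\<^sup>2 + s\<^sup>2) \<ge> r / 2" if "s \<in> {t c2..r}" for s
      using hi[of c2 s] that m unfolding c2_def m_def[symmetric] by (simp add: field_simps)
    then show ?thesis by (intro after_stationary t) auto
  qed auto
  have i: "(\<lambda>s. osc s / w s) integrable_on {a..b}" for a b by (intro integrable_continuous_interval continuous_osc_w)
  have "integral {0..r} (\<lambda>s. osc s / w s) = integral {0..t c1} (\<lambda>s. osc s / w s) + (integral {t c1..t c2} (\<lambda>s. osc s / w s) + integral {t c2..r} (\<lambda>s. osc s / w s))"
    using Henstock_Kurzweil_Integration.integral_combine[OF t(1)[of c1] t(2)[of c1] i] Henstock_Kurzweil_Integration.integral_combine[OF t12 t(2)[of c2] i] by simp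
  also have "norm \<dots> \<le> 56 + (2 + 84)" by (intro order_trans[OF norm_triangle_ineq] add_mono 1 2 3)
  finally show ?thesis by simp
qed

end

section \<open>The kernel along imaginary times\<close>

text \<open>The primitive of \<open>- heat 3\<close> in \<open>w\<close> that vanishes for \<open>w \<rightarrow> \<infinity>\<close>, for \<open>r > 0\<close>.  Integration by parts with it
  removes the factor \<open>1 / k\<close> from the off-diagonal entries.\<close>

definition heat_primitive :: "complex \<Rightarrow> real \<Rightarrow> complex" where
  "heat_primitive w r = 16 / (of_real r)\<^sup>2 * (1 - heat 0 w r) - 4 / of_real r * heat 1 w r"

lemma heat_0_0: "heat 0 w 0 = 1" by (simp add: heat_def)

lemma heat_primitive_eq:
  assumes "r \<noteq> 0" "w \<noteq> 0"
  shows "heat_primitive w r = 16 / (of_real r)\<^sup>2 * (1 - exp (- (of_real r / (4 * w))) * (1 + of_real r / (4 * w)))"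
  using assms by (simp add: heat_primitive_def heat_def field_simps power2_eq_square)

lemma norm_heat_primitive:
  assumes "r \<noteq> 0" "w \<noteq> 0"
  shows "norm (heat_primitive w r) = 16 / r\<^sup>2 * norm (1 - exp (- (of_real r / (4 * w))) * (1 + of_real r / (4 * w)))"
  unfolding heat_primitive_eq[OF assms]
  by (simp only: norm_mult norm_divide norm_power norm_of_real norm_numeral power2_abs)

context laplace_ray begin

definition primitive_laplace :: "real \<Rightarrow> complex" where
  "primitive_laplace r = (LINT s:{0<..}|lborel. heat_primitive (ray \<epsilon> d s) r * exp (\<kappa> * d * of_real s) * d)"

lemma primitive_split:
  "heat_primitive (ray \<epsilon> d s) r * exp (\<kappa> * d * of_real s) * d
    = 16 / (of_real r)\<^sup>2 * (heat 0 (ray \<epsilon> d s) 0 * exp (\<kappa> * d * of_real s) * d)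
      - 16 / (of_real r)\<^sup>2 * (heat 0 (ray \<epsilon> d s) r * exp (\<kappa> * d * of_real s) * d)
      - 4 / of_real r * (heat 1 (ray \<epsilon> d s) r * exp (\<kappa> * d * of_real s) * d)"
  unfolding heat_0_0 heat_primitive_def by (simp only: ring_distribs left_diff_distrib right_diff_distrib mult.assoc mult_1_left mult_1_right)

lemma primitive_integrable:
  "set_integrable lborel {0<..} (\<lambda>s. heat_primitive (ray \<epsilon> d s) r * exp (\<kappa> * d * of_real s) * d)"
  unfolding primitive_split by (intro set_integral_diff set_integrable_mult_right heat_ray_integrable)

lemma heat_laplace_3:
  assumes r: "r > 0"
  shows "heat_laplace 3 \<kappa> d \<epsilon> r = heat_primitive (of_real \<epsilon>) r + \<kappa> * primitive_laplace r"
proof -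
  define R where "R = complex_of_real r"
  have R: "R \<noteq> 0" using r by (simp add: R_def)
  define E where "E s = exp (\<kappa> * d * of_real s)" for s
  define P where "P s = heat_primitive (ray \<epsilon> d s) r" for s
  define h where "h m s = heat m (ray \<epsilon> d s) r" for m s
  have P: "P s = 16 / R\<^sup>2 * (1 - h 0 s) - 4 / R * h 1 s" for s by (simp add: P_def heat_primitive_def h_def R_def)
  have hd: "(h m has_vector_derivative (R / 4 * h (m + 2) s - of_nat m * h (Suc m) s) * d) (at s)" if "s \<ge> 0" for m s
    unfolding h_def R_def by (rule heat_ray_vector_derivative[OF that])
  have Ed: "(E has_vector_derivative E s * (\<kappa> * d)) (at s)" for s
    unfolding E_def by (rule exp_ray_vector_derivative)
  have Pd: "(P has_vector_derivative - h 3 s * d) (at s)" if s: "s \<ge> 0" for s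
  proof -
    have "(P has_vector_derivative 16 / R\<^sup>2 * (0 - (R / 4 * h (0 + 2) s - of_nat 0 * h (Suc 0) s) * d) - 4 / R * ((R / 4 * h (1 + 2) s - of_nat 1 * h (Suc 1) s) * d)) (at s)"
      unfolding P by (intro derivative_intros hd[OF s])
    also have "16 / R\<^sup>2 * (0 - (R / 4 * h (0 + 2) s - of_nat 0 * h (Suc 0) s) * d) - 4 / R * ((R / 4 * h (1 + 2) s - of_nat 1 * h (Suc 1) s) * d) = - h 3 s * d"
    proof -
      have "16 / R\<^sup>2 * (0 - (R / 4 * x) * d) - 4 / R * ((R / 4 * y - x) * d) = - y * d" for x y
        using R by (simp add: field_simps power2_eq_square)
      then show ?thesis by (simp add: numeral_2_eq_2 numeral_3_eq_3)
    qed
    finally show ?thesis .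
  qed
  have i3: "set_integrable lborel {0<..} (\<lambda>s. h 3 s * E s * d)" unfolding h_def E_def by (rule heat_ray_integrable)
  have iP: "set_integrable lborel {0<..} (\<lambda>s. P s * E s * d)" unfolding P_def E_def by (rule primitive_integrable)
  define g where "g s = \<kappa> * (P s * E s * d) - h 3 s * E s * d" for s
  have gi: "set_integrable lborel {0<..} g" unfolding g_def by (intro set_integral_diff set_integrable_mult_right i3 iP)
  have "(LINT s:{0<..}|lborel. g s) = 0 - P 0 * E 0"
  proof (rule integral_derivative_half_line[OF _ _ gi])
    show "((\<lambda>s. P s * E s) has_vector_derivative g s) (at s)" if "s \<ge> 0" for s
      using has_vector_derivative_mult[OF Pd[OF that] Ed] by (simp add: g_def algebra_simps)
    have "isCont P s" "isCont (h 3) s" if "s > 0" for s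
      using has_vector_derivative_continuous[OF Pd[of s]] has_vector_derivative_continuous[OF hd[of s 3]] that by auto
    moreover have "isCont E s" for s using has_vector_derivative_continuous[OF Ed] by auto
    ultimately show "isCont g s" if "s > 0" for s
      unfolding g_def using that by (intro continuous_intros) auto
    have PE: "P s * E s = 16 / R\<^sup>2 * (heat 0 (ray \<epsilon> d s) 0 * E s - h 0 s * E s) - 4 / R * (h 1 s * E s)" for s
      by (simp add: P heat_0_0 algebra_simps)
    have "((\<lambda>s. 16 / R\<^sup>2 * (heat 0 (ray \<epsilon> d s) 0 * E s - h 0 s * E s) - 4 / R * (h 1 s * E s)) \<longlongrightarrow> 16 / R\<^sup>2 * (0 - 0) - 4 / R * 0) at_top"
      unfolding h_def E_def by (intro tendsto_intros heat_ray_tendsto_0)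
    then show "((\<lambda>s. P s * E s) \<longlongrightarrow> 0) at_top" unfolding PE by simp
  qed
  moreover have "(LINT s:{0<..}|lborel. g s) = \<kappa> * primitive_laplace r - heat_laplace 3 \<kappa> d \<epsilon> r"
    using i3 iP unfolding g_def by (simp add: primitive_laplace_def heat_laplace_def P_def E_def h_def set_integral_diff)
  moreover have "P 0 * E 0 = heat_primitive (of_real \<epsilon>) r" by (simp add: P_def E_def ray_def)
  ultimately show ?thesis by (simp add: algebra_simps)
qed

end

context resolvent_rays begin

text \<open>The boundary terms at \<open>\<epsilon>\<close> are the same for both rays and cancel.\<close>

lemma kernel_2:
  assumes "r > 0"
  shows "4 / k * kernel 2 r = 1/4 * (plus.primitive_laplace r + minus.primitive_laplace r)"
proof -
  have "4 / k * kernel 2 r = 1 / (4 * k) * (heat_laplace 3 k d1 \<epsilon> r - heat_laplace 3 (- k) d2 \<epsilon> r)"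
  proof -
    have "4 / k * ((- (1/4))\<^sup>2 * X) = 1 / (4 * k) * X" for X by (simp add: power2_eq_square)
    then show ?thesis by (simp only: kernel_def numeral_3_eq_3 numeral_2_eq_2)
  qed
  also have "heat_laplace 3 k d1 \<epsilon> r - heat_laplace 3 (- k) d2 \<epsilon> r = k * (plus.primitive_laplace r + minus.primitive_laplace r)"
    unfolding plus.heat_laplace_3[OF assms] minus.heat_laplace_3[OF assms] by (simp add: algebra_simps)
  finally show ?thesis using k_nz by simp
qed

lemma kernel_0: "kernel 0 r = heat_laplace 1 k d1 \<epsilon> r - heat_laplace 1 (- k) d2 \<epsilon> r"
  by (simp add: kernel_def)

end

lemma set_integral_norm_dominated:
  fixes f :: "real \<Rightarrow> complex"
  assumes "set_integrable lborel S f" "set_integrable lborel S g" "\<And>s. s \<in> S \<Longrightarrow> norm (f s) \<le> g s"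
  shows "norm (LINT s:S|lborel. f s) \<le> (LINT s:S|lborel. g s)"
  using set_integral_norm_bound[OF assms(1)] set_integral_mono[OF set_integrable_norm[OF assms(1)] assms(2,3)]
  by (meson order_trans)

text \<open>For \<open>d = \<plusminus> \<i>\<close> the rays in directions \<open>d\<close> and \<open>- d\<close> are complex conjugate and carry the same weight
  \<open>exp (k d s)\<close>.\<close>

locale imaginary_rays =
  fixes k d :: complex and \<epsilon> r :: real
  assumes eps: "\<epsilon> > 0" and d: "d = \<i> \<or> d = - \<i>" and kd: "Re (k * d) < 0" and r: "r > 0"
begin

sublocale resolvent_rays k d "- d" \<epsilon>
  using eps d kd by unfold_locales auto

lemma norm_ray: "(norm (ray \<epsilon> d s))\<^sup>2 = \<epsilon>\<^sup>2 + s\<^sup>2" "(norm (ray \<epsilon> (- d) s))\<^sup>2 = \<epsilon>\<^sup>2 + s\<^sup>2"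
  using d by (auto simp: ray_def cmod_power2)

lemma norm_d: "norm d = 1" using d by auto

lemma norm_ray_ge: "s \<le> norm (ray \<epsilon> d s)" "s \<le> norm (ray \<epsilon> (- d) s)" "\<epsilon> \<le> norm (ray \<epsilon> d s)"  "\<epsilon> \<le> norm (ray \<epsilon> (- d) s)"
  by (rule power2_le_imp_le; simp only: norm_ray norm_ge_zero; simp)+

lemma exp_le_1: "s \<ge> 0 \<Longrightarrow> norm (exp (k * d * of_real s)) \<le> 1"
  unfolding plus.norm_exp_ray using plus.rate_pos by simp

text \<open>For \<open>\<epsilon> > r\<close> the integrand is at most \<open>1 / \<epsilon>\<close> on an interval of length \<open>r\<close>; otherwise the integral is the
  oscillatory one.\<close>

lemma phase_part:
  assumes d': "d' = d \<or> d' = - d"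
  shows "norm (LINT s:{0<..r}|lborel. heat 1 (ray \<epsilon> d' s) r * exp (k * d * of_real s)) \<le> 142"
proof -
  have d'': "d' = \<i> \<or> d' = - \<i>" using d d' by auto
  have w0: "ray \<epsilon> d' s \<noteq> 0" for s
    using norm_ray_ge(3,4)[of s] eps d' by auto
  define f where "f s = heat 1 (ray \<epsilon> d' s) r * exp (k * d * of_real s)" for s
  have cf: "continuous_on S f" for S
    unfolding f_def heat_def by (intro continuous_intros continuous_on_ray) (auto simp: w0)
  have i: "set_integrable lborel {0..r} f" by (rule borel_integrable_atLeastAtMost') (rule cf)
  have i': "set_integrable lborel {0<..r} f" by (rule set_integrable_subset[OF i]) auto
  have "(LINT s:{0<..r}|lborel. f s) = integral {0<..r} f" using set_borel_integral_eq_integral(2)[OF i'] .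
  also have "\<dots> = integral {0..r} f"
  proof (rule integral_spike_set)
    show "negligible {x \<in> {0<..r} - {0..r}. f x \<noteq> 0}" by (rule negligible_subset[of "{0}"]) auto
    show "negligible {x \<in> {0..r} - {0<..r}. f x \<noteq> 0}" by (rule negligible_subset[of "{0}"]) auto
  qed
  also have "norm \<dots> \<le> 142"
  proof (cases "\<epsilon> \<le> r")
    case True
    interpret p: phase "k * d" d' \<epsilon> r using eps True kd d'' by unfold_locales auto
    have "f = (\<lambda>s. p.osc s / ray \<epsilon> d' s)" by (simp add: fun_eq_iff f_def p.osc_def heat_def)
    then show ?thesis using p.osc_bound by simp
  next
    case False
    have "norm (integral {0..r} f) \<le> integral {0..r} (\<lambda>s. 1 / \<epsilon>)"
    proof (rule integral_norm_bound_integral)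
      show "f integrable_on {0..r}" by (rule integrable_continuous_interval[OF cf])
      fix s assume s: "s \<in> {0..r}"
      have "Re (1 / ray \<epsilon> d' s) \<ge> 0" using d'' eps by (auto simp: Re_divide ray_def)
      then have "norm (heat 1 (ray \<epsilon> d' s) r) \<le> 1 / \<epsilon>"
        unfolding norm_heat using r eps norm_ray_ge(3,4)[of s] d' by (intro frac_le) auto
      moreover have "norm (exp (k * d * of_real s)) \<le> 1" using s by (intro exp_le_1) simp
      ultimately have "norm (f s) \<le> 1 / \<epsilon> * 1" unfolding f_def norm_mult using eps by (intro mult_mono) auto
      then show "norm (f s) \<le> 1 / \<epsilon>" by simp
    qed auto
    also have "\<dots> \<le> 1" using False r eps by simp
    finally show ?thesis by simp
  qed
  finally show ?thesis by (simp add: f_def)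
qed

lemma split_at_r:
  fixes f :: "real \<Rightarrow> complex"
  assumes "set_integrable lborel {0<..} f"
  shows "(LINT s:{0<..}|lborel. f s) = (LINT s:{0<..r}|lborel. f s) + (LINT s:{r<..}|lborel. f s)"
    and "set_integrable lborel {0<..r} f" "set_integrable lborel {r<..} f"
proof -
  show i: "set_integrable lborel {0<..r} f" "set_integrable lborel {r<..} f"
    using r by (auto intro!: set_integrable_subset[OF assms])
  have U: "{0<..} = {0<..r} \<union> {r<..}" using r by auto
  show "(LINT s:{0<..}|lborel. f s) = (LINT s:{0<..r}|lborel. f s) + (LINT s:{r<..}|lborel. f s)"
    unfolding U by (rule set_integral_Un[OF _ i]) auto
qed

lemma Re_v: "Re (of_real r / (4 * ray \<epsilon> d s)) \<ge> 0" "Re (of_real r / (4 * ray \<epsilon> (- d) s)) \<ge> 0"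
proof -
  have "Re (of_real r / (4 * z)) = r / 4 * Re z / (norm z)\<^sup>2" for z :: complex
  proof -
    have "Re (1 / z) = Re z / (norm z)\<^sup>2" by (simp add: Re_divide cmod_power2)
    moreover have "of_real r / (4 * z) = of_real (r / 4) * (1 / z)" by simp
    ultimately show ?thesis by (simp only: times_complex.sel complex_of_real_def complex.sel) simp
  qed
  moreover have "Re (ray \<epsilon> d s) = \<epsilon>" "Re (ray \<epsilon> (- d) s) = \<epsilon>" using d by (auto simp: ray_def)
  ultimately show "Re (of_real r / (4 * ray \<epsilon> d s)) \<ge> 0" "Re (of_real r / (4 * ray \<epsilon> (- d) s)) \<ge> 0"
    using r eps by simp_all
qed

lemma rays_nz: "ray \<epsilon> d s \<noteq> 0" "ray \<epsilon> (- d) s \<noteq> 0"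
  using norm_ray_ge(3,4)[of s] eps by auto

lemma norm_v: "norm (of_real r / (4 * z) :: complex) = r / 4 / norm z"
  using r by (simp add: norm_divide norm_mult)

lemma sum_of_rays: "1 / ray \<epsilon> d s + 1 / ray \<epsilon> (- d) s = of_real (2 * \<epsilon> / (\<epsilon>\<^sup>2 + s\<^sup>2))"
proof -
  have "ray \<epsilon> d s * ray \<epsilon> (- d) s = of_real (\<epsilon>\<^sup>2 + s\<^sup>2)" "ray \<epsilon> d s + ray \<epsilon> (- d) s = of_real (2 * \<epsilon>)"
    using d by (auto simp: ray_def complex_eq_iff power2_eq_square)
  moreover have "1 / z + 1 / z' = (z + z') / (z * z')" if "z \<noteq> 0" "z' \<noteq> 0" for z z' :: complex
    using that by (simp add: field_simps)
  ultimately show ?thesis using rays_nz by simp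
qed

text \<open>Up to \<open>s = r\<close> both rays contribute at most \<open>142\<close>.  Beyond, replacing the exponentials \<open>exp (- r / (4 w))\<close> by
  \<open>1\<close> costs \<open>r / s\<^sup>2\<close>, and the leading terms \<open>1/w\<close> of the two conjugate rays add up to the Poisson
  kernel \<open>2 \<epsilon> / (\<epsilon>\<^sup>2 + s\<^sup>2)\<close>; each is integrable over \<open>s > r\<close> with a bound independent of \<open>\<epsilon>\<close> and \<open>r\<close>.\<close>

lemma kernel_0_bound: "norm (kernel 0 r) \<le> 300"
proof -
  define E where "E s = exp (k * d * of_real s)" for s
  define h where "h s = heat 1 (ray \<epsilon> d s) r" for s
  define h' where "h' s = heat 1 (ray \<epsilon> (- d) s) r" for s
  have i: "set_integrable lborel {0<..} (\<lambda>s. h s * E s * d)" "set_integrable lborel {0<..} (\<lambda>s. h' s * E s * (- d))"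
    unfolding h_def h'_def E_def using plus.heat_ray_integrable[of 1 r] minus.heat_ray_integrable[of 1 r] by simp_all
  have i': "set_integrable lborel {0<..} (\<lambda>s. h s * E s)" "set_integrable lborel {0<..} (\<lambda>s. h' s * E s)"
    using set_integrable_mult_left[OF i(1), of "1/d"] set_integrable_mult_left[OF i(2), of "- (1/d)"] d by auto
  have "kernel 0 r = (LINT s:{0<..}|lborel. h s * E s * d) - (LINT s:{0<..}|lborel. h' s * E s * (- d))"
    unfolding kernel_0 heat_laplace_def h_def h'_def E_def by simp
  also have "\<dots> = ((LINT s:{0<..}|lborel. h s * E s) + (LINT s:{0<..}|lborel. h' s * E s)) * d"
    unfolding set_integral_mult_left by (simp add: algebra_simps)
  also have "(LINT s:{0<..}|lborel. h s * E s) + (LINT s:{0<..}|lborel. h' s * E s)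
    = ((LINT s:{0<..r}|lborel. h s * E s) + (LINT s:{0<..r}|lborel. h' s * E s)) + (LINT s:{r<..}|lborel. h s * E s + h' s * E s)"
    using split_at_r[OF i'(1)] split_at_r[OF i'(2)] by (simp add: set_integral_add)
  finally have eq: "norm (kernel 0 r) = norm (((LINT s:{0<..r}|lborel. h s * E s) + (LINT s:{0<..r}|lborel. h' s * E s)) + (LINT s:{r<..}|lborel. h s * E s + h' s * E s))"
    by (simp add: norm_mult norm_d)
  \<comment> \<open>The majorant for \<open>s > r\<close>, and its primitive.\<close>
  define g where "g s = 2 * \<epsilon> / (\<epsilon>\<^sup>2 + s\<^sup>2) + r / (2 * s\<^sup>2)" for s
  define G where "G s = 2 * arctan (s / \<epsilon>) - r / (2 * s)" for s
  have gm: "g \<in> borel_measurable borel" unfolding g_def by measurable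
  have Gd: "(G has_real_derivative g s) (at s)" if "s \<ge> r" for s
  proof -
    have s: "s > 0" "\<epsilon>\<^sup>2 + s\<^sup>2 > 0" using that r eps by (auto simp: add_pos_pos)
    have "(G has_real_derivative 2 * (1 / \<epsilon> * inverse (1 + (s / \<epsilon>)\<^sup>2)) + r / (2 * s\<^sup>2)) (at s)"
      unfolding G_def using s eps by (auto intro!: derivative_eq_intros simp: power2_eq_square field_simps)
    also have "1 / \<epsilon> * inverse (1 + (s / \<epsilon>)\<^sup>2) = \<epsilon> / (\<epsilon>\<^sup>2 + s\<^sup>2)"
    proof -
      have "1 + (s / \<epsilon>)\<^sup>2 = (\<epsilon>\<^sup>2 + s\<^sup>2) / \<epsilon>\<^sup>2" using eps by (simp add: power_divide field_simps)
      then show ?thesis using eps by (simp add: power2_eq_square)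
    qed
    finally show ?thesis by (simp add: g_def)
  qed
  have "LIM s at_top. 1 / \<epsilon> * s :> at_top"
    by (rule filterlim_tendsto_pos_mult_at_top[OF tendsto_const _ filterlim_ident]) (use eps in auto)
  then have "((\<lambda>s. arctan (s / \<epsilon>)) \<longlongrightarrow> pi / 2) at_top"
    using filterlim_compose[OF tendsto_arctan_at_top] by simp
  moreover have "((\<lambda>s. r / (2 * s)) \<longlongrightarrow> 0) at_top"
    using tendsto_mult_right_zero[OF tendsto_inverse_0_at_top[OF filterlim_ident], of "r / 2"] by (simp add: inverse_eq_divide)
  ultimately have "(G \<longlongrightarrow> 2 * (pi / 2) - 0) at_top" unfolding G_def by (intro tendsto_intros)
  then have GL: "(G \<longlongrightarrow> pi) at_top" by simp
  have gnn: "g s \<ge> 0" for s unfolding g_def using eps r by simp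
  note GI = half_line_integral[OF gm Gd gnn GL]
  have "norm (LINT s:{r<..}|lborel. h s * E s + h' s * E s) \<le> (LINT s:{r<..}|lborel. g s)"
  proof (rule set_integral_norm_dominated)
    show "set_integrable lborel {r<..} (\<lambda>s. h s * E s + h' s * E s)"
      using split_at_r(3)[OF i'(1)] split_at_r(3)[OF i'(2)] by (rule set_integral_add)
    show "set_integrable lborel {r<..} g" by (rule GI(1))
    fix s assume s: "s \<in> {r<..}"
    define z where "z = ray \<epsilon> d s"
    define z' where "z' = ray \<epsilon> (- d) s"
    have nz: "z \<noteq> 0" "z' \<noteq> 0" unfolding z_def z'_def by (rule rays_nz)+
    have part: "norm ((1 - exp (- (of_real r / (4 * y)))) / y) \<le> r / (4 * s\<^sup>2)"
      if "y \<noteq> 0" "s \<le> norm y" "Re (of_real r / (4 * y)) \<ge> 0" for y :: complex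
    proof -
      have "norm (1 - exp (- (of_real r / (4 * y)))) \<le> r / 4 / norm y"
        using norm_exp_minus_1_le[OF that(3)] unfolding norm_v .
      then have "norm ((1 - exp (- (of_real r / (4 * y)))) / y) \<le> r / 4 / norm y / norm y"
        unfolding norm_divide by (intro divide_right_mono) auto
      also have "\<dots> = r / (4 * (norm y)\<^sup>2)" by (simp add: power2_eq_square)
      also have "\<dots> \<le> r / (4 * s\<^sup>2)"
        using that s r by (intro divide_left_mono mult_left_mono power_mono mult_pos_pos) auto
      finally show ?thesis .
    qed
    have "h s + h' s = (1 / z + 1 / z') - (1 - exp (- (of_real r / (4 * z)))) / z - (1 - exp (- (of_real r / (4 * z')))) / z'"
      by (simp add: h_def h'_def heat_def z_def z'_def diff_divide_distrib)
    also have "norm \<dots> \<le> 2 * \<epsilon> / (\<epsilon>\<^sup>2 + s\<^sup>2) + r / (4 * s\<^sup>2) + r / (4 * s\<^sup>2)"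
    proof (intro order_trans[OF norm_triangle_ineq4] add_mono part nz)
      show "norm (1 / z + 1 / z') \<le> 2 * \<epsilon> / (\<epsilon>\<^sup>2 + s\<^sup>2)"
        unfolding z_def z'_def sum_of_rays norm_of_real using eps by simp
    qed (auto simp: z_def z'_def norm_ray_ge Re_v)
    also have "\<dots> = g s" by (simp add: g_def)
    finally have "norm (h s + h' s) * norm (E s) \<le> g s * 1"
      using exp_le_1[of s] s r gnn unfolding E_def by (intro mult_mono) auto
    then show "norm (h s * E s + h' s * E s) \<le> g s" by (simp only: norm_mult[symmetric] ring_distribs mult_1_right)
  qed
  also have "\<dots> = pi - G r" by (rule GI(2))
  also have "\<dots> \<le> 5"
  proof -
    have "0 \<le> arctan (r / \<epsilon>)" unfolding zero_le_arctan_iff using r eps by simp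
    moreover have "r / (2 * r) = 1 / 2" using r by simp
    ultimately show ?thesis unfolding G_def using pi_less_4 by linarith
  qed
  finally have B: "norm (LINT s:{r<..}|lborel. h s * E s + h' s * E s) \<le> 5" .
  have A: "norm (LINT s:{0<..r}|lborel. h s * E s) \<le> 142" "norm (LINT s:{0<..r}|lborel. h' s * E s) \<le> 142"
    unfolding h_def h'_def E_def by (rule phase_part; simp)+
  have "norm (kernel 0 r) \<le> (142 + 142) + 5"
    unfolding eq by (intro order_trans[OF norm_triangle_ineq] add_mono A B order_trans[OF norm_triangle_ineq add_mono[OF A]])
  then show ?thesis by simp
qed

text \<open>Beyond \<open>s = r\<close> the primitive is at most \<open>1 / s\<^sup>2\<close>.  Up to \<open>s = r\<close> its constant part \<open>16 / r\<^sup>2\<close> cancels between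
  the rays, the exponentials of modulus at most one contribute \<open>32 / r\<close>, and the parts with \<open>heat 1\<close> are
  oscillatory integrals again.\<close>

lemma kernel_2_bound: "r * norm (4 / k * kernel 2 r) \<le> 300"
proof -
  define E where "E s = exp (k * d * of_real s)" for s
  define R where "R = complex_of_real r"
  define P where "P s = heat_primitive (ray \<epsilon> d s) r" for s
  define P' where "P' s = heat_primitive (ray \<epsilon> (- d) s) r" for s
  define h where "h s = heat 1 (ray \<epsilon> d s) r" for s
  define h' where "h' s = heat 1 (ray \<epsilon> (- d) s) r" for s
  define e where "e s = heat 0 (ray \<epsilon> d s) r" for s
  define e' where "e' s = heat 0 (ray \<epsilon> (- d) s) r" for s
  have i: "set_integrable lborel {0<..} (\<lambda>s. P s * E s * d)" "set_integrable lborel {0<..} (\<lambda>s. P' s * E s * (- d))"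
    unfolding P_def P'_def E_def using plus.primitive_integrable[of r] minus.primitive_integrable[of r] by simp_all
  have i': "set_integrable lborel {0<..} (\<lambda>s. P s * E s)" "set_integrable lborel {0<..} (\<lambda>s. P' s * E s)"
    using set_integrable_mult_left[OF i(1), of "1/d"] set_integrable_mult_left[OF i(2), of "- (1/d)"] d by auto
  have j: "set_integrable lborel {0<..} (\<lambda>s. heat m (ray \<epsilon> d s) r * E s)" "set_integrable lborel {0<..} (\<lambda>s. heat m (ray \<epsilon> (- d) s) r * E s)" for m
    using set_integrable_mult_left[OF plus.heat_ray_integrable[of m r], of "1/d"]
      set_integrable_mult_left[OF minus.heat_ray_integrable[of m r], of "- (1/d)"] d unfolding E_def by auto
  have "4 / k * kernel 2 r = 1/4 * ((LINT s:{0<..}|lborel. P s * E s * d) + (LINT s:{0<..}|lborel. P' s * E s * (- d)))"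
    unfolding kernel_2[OF r] plus.primitive_laplace_def minus.primitive_laplace_def P_def P'_def E_def by simp
  also have "\<dots> = 1/4 * ((LINT s:{0<..}|lborel. P s * E s) - (LINT s:{0<..}|lborel. P' s * E s)) * d"
    unfolding set_integral_mult_left by (simp add: algebra_simps)
  also have "(LINT s:{0<..}|lborel. P s * E s) - (LINT s:{0<..}|lborel. P' s * E s)
    = (LINT s:{0<..r}|lborel. P s * E s - P' s * E s) + ((LINT s:{r<..}|lborel. P s * E s) - (LINT s:{r<..}|lborel. P' s * E s))"
    using split_at_r[OF i'(1)] split_at_r[OF i'(2)] by (simp add: set_integral_diff)
  also have "(LINT s:{0<..r}|lborel. P s * E s - P' s * E s)
     = (LINT s:{0<..r}|lborel. 16 / R\<^sup>2 * (e' s * E s - e s * E s) - 4 / R * (h s * E s) + 4 / R * (h' s * E s))"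
    by (simp add: P_def P'_def e_def e'_def h_def h'_def heat_primitive_def R_def algebra_simps diff_divide_distrib add_divide_distrib)
  also have "\<dots> = 16 / R\<^sup>2 * (LINT s:{0<..r}|lborel. e' s * E s - e s * E s) - 4 / R * (LINT s:{0<..r}|lborel. h s * E s) + 4 / R * (LINT s:{0<..r}|lborel. h' s * E s)"
    unfolding e_def e'_def h_def h'_def
    by (simp only: set_integral_add set_integral_diff set_integral_mult_right set_integrable_mult_right split_at_r(2)[OF j(1)] split_at_r(2)[OF j(2)])
  finally have eq': "4 / k * kernel 2 r = 1/4 * (16 / R\<^sup>2 * (LINT s:{0<..r}|lborel. e' s * E s - e s * E s) - 4 / R * (LINT s:{0<..r}|lborel. h s * E s) + 4 / R * (LINT s:{0<..r}|lborel. h' s * E s)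
     + ((LINT s:{r<..}|lborel. P s * E s) - (LINT s:{r<..}|lborel. P' s * E s))) * d" .
  have eq: "norm (4 / k * kernel 2 r) = 1/4 * norm (16 / R\<^sup>2 * (LINT s:{0<..r}|lborel. e' s * E s - e s * E s) - 4 / R * (LINT s:{0<..r}|lborel. h s * E s) + 4 / R * (LINT s:{0<..r}|lborel. h' s * E s)
     + ((LINT s:{r<..}|lborel. P s * E s) - (LINT s:{r<..}|lborel. P' s * E s)))"
    unfolding eq' norm_mult[of _ d] norm_mult[of "1/4"] norm_d by simp
  have A: "norm (LINT s:{0<..r}|lborel. h s * E s) \<le> 142" "norm (LINT s:{0<..r}|lborel. h' s * E s) \<le> 142"
    unfolding h_def h'_def E_def by (rule phase_part; simp)+
  have e1: "norm (heat 0 z r) \<le> 1" if "Re (of_real r / (4 * z)) \<ge> 0" for z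
    using that by (simp add: heat_def)
  have C: "norm (LINT s:{0<..r}|lborel. e' s * E s - e s * E s) \<le> 2 * r"
  proof -
    have c: "set_integrable lborel {0<..r} (\<lambda>s. 2 :: real)"
      by (rule set_integrable_subset[OF borel_integrable_atLeastAtMost'[of 0 r]]) auto
    have "norm (LINT s:{0<..r}|lborel. e' s * E s - e s * E s) \<le> (LINT s:{0<..r}|lborel. 2)"
    proof (rule set_integral_norm_dominated[OF _ c])
      show "set_integrable lborel {0<..r} (\<lambda>s. e' s * E s - e s * E s)"
        unfolding e_def e'_def by (intro set_integral_diff split_at_r(2)[OF j(1)] split_at_r(2)[OF j(2)])
      fix s assume s: "s \<in> {0<..r}"
      have "norm (e' s * E s) \<le> 1 * 1" "norm (e s * E s) \<le> 1 * 1"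
        unfolding norm_mult e_def e'_def E_def using s by (intro mult_mono e1 Re_v exp_le_1; simp)+
      then show "norm (e' s * E s - e s * E s) \<le> 2" using norm_triangle_ineq4[of "e' s * E s" "e s * E s"] by simp
    qed
    also have "\<dots> = 2 * r" unfolding set_lebesgue_integral_def using r by simp
    finally show ?thesis .
  qed
  have G: "set_integrable lborel {r<..} (\<lambda>s. 1 / s\<^sup>2)" "(LINT s:{r<..}|lborel. 1 / s\<^sup>2) = 0 - - 1 / r"
  proof -
    have "((\<lambda>s. - 1 / s) has_real_derivative 1 / s\<^sup>2) (at s)" if "s \<ge> r" for s
      using that r by (auto intro!: derivative_eq_intros simp: power2_eq_square)
    moreover have "((\<lambda>s::real. - 1 / s) \<longlongrightarrow> 0) at_top"
      using tendsto_minus[OF tendsto_inverse_0_at_top[OF filterlim_ident]] by (simp add: inverse_eq_divide)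
    ultimately show "set_integrable lborel {r<..} (\<lambda>s. 1 / s\<^sup>2)" "(LINT s:{r<..}|lborel. 1 / s\<^sup>2) = 0 - - 1 / r"
      using half_line_integral[where f = "\<lambda>s. 1 / s\<^sup>2" and F = "\<lambda>s. - 1 / s" and L = 0 and a = r] by auto
  qed
  have Pb: "norm (heat_primitive y r) \<le> 1 / s\<^sup>2" if "y \<noteq> 0" "s \<le> norm y" "Re (of_real r / (4 * y)) \<ge> 0" "s > 0" for y s
  proof -
    have "norm (heat_primitive y r) = 16 / r\<^sup>2 * norm (1 - exp (- (of_real r / (4 * y))) * (1 + of_real r / (4 * y)))"
      using that r by (intro norm_heat_primitive) auto
    also have "\<dots> \<le> 16 / r\<^sup>2 * (r / 4 / norm y)\<^sup>2"
      using norm_exp_second_order_le[OF that(3)] unfolding norm_v by (intro mult_left_mono) auto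
    also have "\<dots> = 1 / (norm y)\<^sup>2" using r that(1) by (simp add: field_simps power2_eq_square)
    also have "\<dots> \<le> 1 / s\<^sup>2" using that by (intro divide_left_mono power_mono mult_pos_pos) auto
    finally show ?thesis .
  qed
  have B: "norm (LINT s:{r<..}|lborel. P s * E s) \<le> 1 / r" "norm (LINT s:{r<..}|lborel. P' s * E s) \<le> 1 / r"
  proof -
    have "norm (P s * E s) \<le> 1 / s\<^sup>2 * 1" "norm (P' s * E s) \<le> 1 / s\<^sup>2 * 1" if "s \<in> {r<..}" for s
      unfolding norm_mult P_def P'_def E_def using that r by (intro mult_mono Pb Re_v exp_le_1 rays_nz norm_ray_ge; simp)+
    then show "norm (LINT s:{r<..}|lborel. P s * E s) \<le> 1 / r" "norm (LINT s:{r<..}|lborel. P' s * E s) \<le> 1 / r"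
      using set_integral_norm_dominated[OF split_at_r(3)[OF i'(1)] G(1)] set_integral_norm_dominated[OF split_at_r(3)[OF i'(2)] G(1)] G(2)
      by auto
  qed
  have "norm (16 / R\<^sup>2 * (LINT s:{0<..r}|lborel. e' s * E s - e s * E s) - 4 / R * (LINT s:{0<..r}|lborel. h s * E s) + 4 / R * (LINT s:{0<..r}|lborel. h' s * E s)
     + ((LINT s:{r<..}|lborel. P s * E s) - (LINT s:{r<..}|lborel. P' s * E s)))
    \<le> 16 / r\<^sup>2 * (2 * r) + 4 / r * 142 + 4 / r * 142 + (1 / r + 1 / r)"
    (is "norm ((?a - ?b) + ?c + (?x - ?y)) \<le> _")
  proof -
    have "norm ?a \<le> 16 / r\<^sup>2 * (2 * r)" using C r by (simp add: norm_mult norm_divide norm_power R_def divide_right_mono)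
    moreover have "norm ?b \<le> 4 / r * 142" "norm ?c \<le> 4 / r * 142"
      using A r by (simp_all add: norm_mult norm_divide R_def divide_right_mono)
    ultimately show ?thesis using B by (intro norm_sum3 order_trans[OF norm_triangle_ineq4] add_mono) auto
  qed
  also have "\<dots> = 1170 / r" using r by (simp add: field_simps power2_eq_square)
  finally have "norm (4 / k * kernel 2 r) \<le> 1/4 * (1170 / r)" unfolding eq by (rule mult_left_mono) simp
  then have "r * norm (4 / k * kernel 2 r) \<le> r * (1/4 * (1170 / r))" using r by (intro mult_left_mono) auto
  then show ?thesis using r by simp
qed

end

section \<open>The kernel along tilted times\<close>

text \<open>A majorant, up to a constant, of the integral of \<open>exp (- c s) / (s + r)\<close> over \<open>s > 0\<close>.  At \<open>r = 0\<close> that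
  integral is only logarithmically singular; the power \<open>-1/4\<close> is small enough for square integrability in the
  plane, where \<open>r\<close> is a squared distance.\<close>

definition resolvent_profile :: "real \<Rightarrow> real" where
  "resolvent_profile r = min (r powr (- (1/4))) (1 / r)"

lemma powr_exp_integrable:
  fixes c :: real assumes c: "c > 0"
  shows "set_integrable lborel {0<..} (\<lambda>s. s powr (- (3/4)) * exp (- (c * s)))"
proof -
  define f where "f s = s powr (- (3/4)) * exp (- (c * s))" for s :: real
  have fm[measurable]: "f \<in> borel_measurable borel" unfolding f_def by measurable
  have "(\<integral>\<^sup>+ s. ennreal (indicator {0<..} s *\<^sub>R f s) \<partial>lborel)
     \<le> (\<integral>\<^sup>+ s. ennreal (s powr (- (3/4))) * indicator {0..1} s + ennreal (indicator {0<..} s *\<^sub>R exp (- (c * s))) \<partial>lborel)"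
  proof (rule nn_integral_mono)
    fix s :: real
    consider "s \<le> 0" | "0 < s" "s \<le> 1" | "s > 1" by linarith
    then show "ennreal (indicator {0<..} s *\<^sub>R f s) \<le> ennreal (s powr (- (3/4))) * indicator {0..1} s + ennreal (indicator {0<..} s *\<^sub>R exp (- (c * s)))"
    proof cases
      case 2
      then have "f s \<le> s powr (- (3/4)) * 1" unfolding f_def using c by (intro mult_left_mono) auto
      then show ?thesis using 2 by (auto simp: indicator_def intro!: add_increasing2 ennreal_leI)
    next
      case 3
      then have "f s \<le> 1 * exp (- (c * s))" unfolding f_def by (intro mult_right_mono) (auto intro: ge_one_powr_ge_zero simp: powr_le_one_le powr_minus_divide ge_one_powr_ge_zero)
      then show ?thesis using 3 by (auto simp: indicator_def intro!: add_increasing ennreal_leI)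
    qed auto
  qed
  also have "\<dots> = (\<integral>\<^sup>+ s. ennreal (s powr (- (3/4))) * indicator {0..1} s \<partial>lborel) + (\<integral>\<^sup>+ s. ennreal (indicator {0<..} s *\<^sub>R exp (- (c * s))) \<partial>lborel)"
    by (rule nn_integral_add) measurable
  also have "(\<integral>\<^sup>+ s. ennreal (s powr (- (3/4))) * indicator {0..1} s \<partial>lborel) = ennreal (1 powr (- (3/4) + 1) / (- (3/4) + 1))"
    by (rule nn_integral_has_integral_lebesgue'[OF _ has_integral_powr_from_0]) auto
  also have "(\<integral>\<^sup>+ s. ennreal (indicator {0<..} s *\<^sub>R exp (- (c * s))) \<partial>lborel) < \<infinity>"
    using exp_decay_integral(1)[OF c] unfolding set_integrable_def
    by (subst nn_integral_eq_integral) auto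
  finally have "(\<integral>\<^sup>+ s. ennreal (indicator {0<..} s *\<^sub>R f s) \<partial>lborel) < \<infinity>" by (simp add: less_top)
  then show ?thesis unfolding set_integrable_def f_def[symmetric]
    by (intro integrableI_nonneg) (auto simp: indicator_def f_def)
qed

text \<open>Either drop \<open>s\<close> from \<open>s + r\<close>, or use \<open>s + r \<ge> s powr (3/4) * r powr (1/4)\<close>.\<close>

lemma profile_integral_bound:
  fixes f :: "real \<Rightarrow> complex"
  assumes c: "c > 0" and K: "K \<ge> 0" and r: "r > 0" and i: "set_integrable lborel {0<..} f"
    and b: "\<And>s. s > 0 \<Longrightarrow> norm (f s) \<le> K / (s + r) * exp (- (c * s))"
  shows "norm (LINT s:{0<..}|lborel. f s) \<le> K * (1 / c + (LINT s:{0<..}|lborel. s powr (- (3/4)) * exp (- (c * s)))) * resolvent_profile r"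
proof -
  define Q where "Q = (LINT s:{0<..}|lborel. s powr (- (3/4)) * exp (- (c * s)))"
  have Q: "Q \<ge> 0" unfolding Q_def set_lebesgue_integral_def by (intro Bochner_Integration.integral_nonneg) (auto simp: indicator_def)
  have 1: "norm (LINT s:{0<..}|lborel. f s) \<le> K * (1 / c) * (1 / r)"
  proof -
    have "norm (LINT s:{0<..}|lborel. f s) \<le> (LINT s:{0<..}|lborel. K / r * exp (- (c * s)))"
    proof (rule set_integral_norm_dominated[OF i])
      show "set_integrable lborel {0<..} (\<lambda>s. K / r * exp (- (c * s)))" using exp_decay_integral(1)[OF c] by simp
      fix s :: real assume s: "s \<in> {0<..}"
      have "K / (s + r) \<le> K / r" using s r K by (intro divide_left_mono) auto
      then show "norm (f s) \<le> K / r * exp (- (c * s))" using b[of s] s by (meson exp_ge_zero greaterThan_iff mult_right_mono order_trans)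
    qed
    also have "\<dots> = K * (1 / c) * (1 / r)" using exp_decay_integral(2)[OF c] by simp
    finally show ?thesis .
  qed
  have 2: "norm (LINT s:{0<..}|lborel. f s) \<le> K * Q * (r powr (- (1/4)))"
  proof -
    have "norm (LINT s:{0<..}|lborel. f s) \<le> (LINT s:{0<..}|lborel. K * r powr (- (1/4)) * (s powr (- (3/4)) * exp (- (c * s))))"
    proof (rule set_integral_norm_dominated[OF i])
      show "set_integrable lborel {0<..} (\<lambda>s. K * r powr (- (1/4)) * (s powr (- (3/4)) * exp (- (c * s))))"
        using powr_exp_integrable[OF c] by simp
      fix s :: real assume s: "s \<in> {0<..}"
      have "s powr (3/4) * r powr (1/4) \<le> (s + r) powr (3/4) * (s + r) powr (1/4)"
        using s r by (intro mult_mono powr_mono2) auto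
      also have "\<dots> = s + r" using s r by (simp add: powr_add[symmetric])
      finally have "K / (s + r) \<le> K / (s powr (3/4) * r powr (1/4))"
        using s r K by (intro divide_left_mono) auto
      also have "\<dots> = K * r powr (- (1/4)) * s powr (- (3/4))" by (simp add: powr_minus_divide)
      finally have "K / (s + r) * exp (- (c * s)) \<le> K * r powr (- (1/4)) * s powr (- (3/4)) * exp (- (c * s))"
        by (rule mult_right_mono) simp
      from order_trans[OF b this] show "norm (f s) \<le> K * r powr (- (1/4)) * (s powr (- (3/4)) * exp (- (c * s)))"
        using s by (simp add: mult.assoc)
    qed
    also have "\<dots> = K * Q * (r powr (- (1/4)))" by (simp add: Q_def)
    finally show ?thesis .
  qed
  have "K * (1 / c) * (1 / r) \<le> K * (1 / c + Q) * (1 / r)" "K * Q * (r powr (- (1/4))) \<le> K * (1 / c + Q) * (r powr (- (1/4)))"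
    using K Q c r by (intro mult_right_mono mult_left_mono; simp)+
  then have "norm (LINT s:{0<..}|lborel. f s) \<le> K * (1 / c + Q) * (1 / r)" "norm (LINT s:{0<..}|lborel. f s) \<le> K * (1 / c + Q) * (r powr (- (1/4)))"
    using 1 2 by linarith+
  then show ?thesis unfolding resolvent_profile_def Q_def[symmetric] by (simp add: min_def)
qed

text \<open>In direction \<open>d\<close> with \<open>Re d > 0\<close> the times stay in a cone around the positive axis, of aperture
  measured by \<open>cone\<close>.  There heat kernels have Gaussian decay, and the integrands are of size \<open>1 / (s + r)\<close>.\<close>

locale tilted_ray = laplace_ray +
  assumes tilt: "Re d > 0"
begin

definition cone :: real where "cone = Re d / norm d"

lemma cone: "0 < cone" "cone \<le> 1"
proof -
  have "norm d > 0" using tilt by auto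
  then show "0 < cone" "cone \<le> 1" using tilt complex_Re_le_cmod[of d] by (simp_all add: cone_def)
qed

lemma Re_ray_cone: assumes s: "s \<ge> 0" shows "cone * norm (ray \<epsilon> d s) \<le> Re (ray \<epsilon> d s)"
proof -
  have nd: "norm d > 0" using tilt by auto
  have "norm (ray \<epsilon> d s) \<le> \<epsilon> + norm d * s"
    unfolding ray_def using s eps by (intro order_trans[OF norm_triangle_ineq]) (simp add: norm_mult)
  then have "cone * norm (ray \<epsilon> d s) \<le> cone * (\<epsilon> + norm d * s)" using cone by (intro mult_left_mono) auto
  also have "\<dots> = cone * \<epsilon> + Re d * s" using nd by (simp add: cone_def distrib_left)
  also have "\<dots> \<le> 1 * \<epsilon> + Re d * s" using cone eps by (intro add_right_mono mult_right_mono) auto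
  also have "\<dots> = Re (ray \<epsilon> d s)" by (simp add: ray_def)
  finally show ?thesis .
qed

lemma norm_ray_lower: "s \<ge> 0 \<Longrightarrow> Re d * s \<le> norm (ray \<epsilon> d s)"
  using complex_Re_le_cmod[of "ray \<epsilon> d s"] eps by (simp add: ray_def)

lemma norm_ray_pos: "s \<ge> 0 \<Longrightarrow> norm (ray \<epsilon> d s) > 0"
  using ray_nz by simp

lemma Re_v_cone:
  assumes "s \<ge> 0" "r > 0"
  shows "cone * norm (of_real r / (4 * ray \<epsilon> d s) :: complex) \<le> Re (of_real r / (4 * ray \<epsilon> d s))"
proof -
  define z where "z = ray \<epsilon> d s"
  have z: "norm z > 0" using norm_ray_pos[OF assms(1)] by (simp add: z_def)
  have "Re (1 / z) = Re z / (norm z)\<^sup>2" by (simp add: Re_divide cmod_power2)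
  moreover have "of_real r / (4 * z) = of_real (r / 4) * (1 / z)" by simp
  ultimately have "Re (of_real r / (4 * z)) = r / 4 * (Re z / (norm z)\<^sup>2)"
    by (simp only: times_complex.sel complex_of_real_def complex.sel)
  moreover have "cone / norm z \<le> Re z / (norm z)\<^sup>2"
  proof -
    have "cone / norm z = cone * norm z / (norm z)\<^sup>2" using z by (simp add: power2_eq_square)
    also have "\<dots> \<le> Re z / (norm z)\<^sup>2" using Re_ray_cone[OF assms(1)] unfolding z_def by (intro divide_right_mono) auto
    finally show ?thesis .
  qed
  then have "r / 4 * (cone / norm z) \<le> r / 4 * (Re z / (norm z)\<^sup>2)" using assms by (intro mult_left_mono) auto
  moreover have "norm (of_real r / (4 * z) :: complex) = r / 4 / norm z" using assms by (simp add: norm_divide norm_mult)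
  ultimately show ?thesis by (simp add: z_def mult.commute)
qed

lemma heat_1_tilted:
  assumes "s > 0" "r > 0"
  shows "norm (heat 1 (ray \<epsilon> d s) r) \<le> 1 / min (Re d) (cone / 4) / (s + r)"
proof -
  define n where "n = norm (ray \<epsilon> d s)"
  have n: "n > 0" using norm_ray_pos[of s] assms by (simp add: n_def)
  define y where "y = cone * (r / 4 / n)"
  have y: "y > 0" using n assms cone by (simp add: y_def)
  define c where "c = min (Re d) (cone / 4)"
  have c: "c > 0" using tilt cone by (simp add: c_def)
  have "y \<le> Re (of_real r / (4 * ray \<epsilon> d s))"
    using Re_v_cone[of s r] assms by (simp add: y_def n_def norm_divide norm_mult)
  then have "norm (heat 1 (ray \<epsilon> d s) r) \<le> exp (- y) / n"
    by (simp add: heat_def norm_divide n_def divide_right_mono)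
  also have "\<dots> \<le> 1 / (1 + y) / n"
  proof (rule divide_right_mono)
    have "exp (- y) = 1 / exp y" by (simp add: exp_minus inverse_eq_divide)
    also have "\<dots> \<le> 1 / (1 + y)" using y exp_ge_add_one_self[of y] by (intro divide_left_mono) auto
    finally show "exp (- y) \<le> 1 / (1 + y)" .
  qed (use n in auto)
  also have "\<dots> = 1 / (n + cone / 4 * r)"
  proof -
    have "n + cone / 4 * r = n * (1 + y)" using n by (simp add: y_def distrib_left)
    then show ?thesis by (simp add: mult.commute)
  qed
  also have "\<dots> \<le> 1 / (c * (s + r))"
  proof (rule divide_left_mono)
    have "c * s \<le> Re d * s" "c * r \<le> cone / 4 * r" using assms by (auto simp: c_def intro!: mult_right_mono)
    moreover have "Re d * s \<le> n" unfolding n_def by (rule norm_ray_lower) (use assms in simp)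
    ultimately show "c * (s + r) \<le> n + cone / 4 * r" unfolding distrib_left by linarith
  qed (use c n assms cone in \<open>auto intro!: mult_pos_pos add_pos_pos\<close>)
  finally show ?thesis by (simp add: c_def)
qed

text \<open>With \<open>v = r / (4 w)\<close>, the quantity \<open>1 - exp (- v) (1 + v)\<close> is at most \<open>|v|\<^sup>2\<close> for small \<open>v\<close> and bounded in the
  cone for large \<open>v\<close>; the case distinction is \<open>|w| \<ge> r\<close> or \<open>|w| < r\<close>.\<close>

lemma heat_primitive_tilted:
  assumes s: "s > 0" and r: "r > 0"
  shows "r * norm (heat_primitive (ray \<epsilon> d s) r) \<le> 32 * (2 + 1 / cone) / min 1 (Re d) / (s + r)"
proof -
  define z where "z = ray \<epsilon> d s"
  define n where "n = norm z"
  have n: "n > 0" "z \<noteq> 0" using norm_ray_pos[of s] s by (auto simp: n_def z_def)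
  define v where "v = complex_of_real r / (4 * z)"
  have nv: "norm v = r / 4 / n" using r by (simp add: v_def n_def norm_divide norm_mult)
  have Rv: "cone * norm v \<le> Re v" using Re_v_cone[of s r] s r by (simp add: v_def z_def)
  then have Rv0: "Re v \<ge> 0" using cone by (meson less_imp_le mult_nonneg_nonneg norm_ge_zero order_trans)
  define c where "c = min 1 (Re d)"
  have c: "c > 0" using tilt by (simp add: c_def)
  define B where "B = 2 + 1 / cone"
  have B: "B \<ge> 1" using cone by (simp add: B_def)
  have eq: "r * norm (heat_primitive z r) = 16 / r * norm (1 - exp (- v) * (1 + v))"
    unfolding v_def using r n by (subst norm_heat_primitive) (auto simp: power2_eq_square)
  have "16 / r * norm (1 - exp (- v) * (1 + v)) \<le> 32 * B / (n + r)"
  proof (cases "n \<ge> r")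
    case True
    have "16 / r * norm (1 - exp (- v) * (1 + v)) \<le> 16 / r * (r / 4 / n)\<^sup>2"
      using norm_exp_second_order_le[OF Rv0] r unfolding nv by (intro mult_left_mono) auto
    also have "\<dots> = r / n / n" using r n by (simp add: field_simps power2_eq_square)
    also have "\<dots> \<le> 1 / n" using True n by (intro divide_right_mono) auto
    also have "\<dots> = 2 / (n + n)" by simp
    also have "\<dots> \<le> 2 / (n + r)" using True n r by (intro divide_left_mono) auto
    also have "\<dots> \<le> 32 * B / (n + r)" using B n r by (intro divide_right_mono) auto
    finally show ?thesis .
  next
    case False
    have "norm v * exp (- Re v) \<le> 1 / cone"
    proof -
      have "cone * norm v * exp (- Re v) \<le> Re v * exp (- Re v)" using Rv by (intro mult_right_mono) auto
      also have "\<dots> \<le> exp (Re v) * exp (- Re v)" 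
      proof (rule mult_right_mono)
        show "Re v \<le> exp (Re v)" using exp_ge_add_one_self[of "Re v"] by linarith
      qed simp
      also have "\<dots> = 1" by (simp add: exp_minus)
      finally show ?thesis using cone by (simp add: field_simps)
    qed
    moreover have "norm (exp (- v)) \<le> 1" using Rv0 by simp
    ultimately have "norm (exp (- v) * (1 + v)) \<le> 1 + 1 / cone"
      unfolding distrib_left mult_1_right
      by (intro order_trans[OF norm_triangle_ineq] add_mono) (simp_all add: norm_mult mult.commute)
    then have "norm (1 - exp (- v) * (1 + v)) \<le> B"
      using norm_triangle_ineq4[of 1 "exp (- v) * (1 + v)"] by (simp add: B_def)
    then have "16 / r * norm (1 - exp (- v) * (1 + v)) \<le> 16 / r * B" using r by (intro mult_left_mono) auto
    also have "\<dots> = 32 * B / (r + r)" using r by (simp add: field_simps)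
    also have "\<dots> \<le> 32 * B / (n + r)" using False n r B by (intro divide_left_mono) auto
    finally show ?thesis .
  qed
  also have "\<dots> \<le> 32 * B / (c * (s + r))"
  proof (rule divide_left_mono)
    have "c * s \<le> Re d * s" "c * r \<le> 1 * r" using s r by (auto simp: c_def intro!: mult_right_mono)
    moreover have "Re d * s \<le> n" unfolding n_def z_def by (rule norm_ray_lower) (use s in simp)
    ultimately show "c * (s + r) \<le> n + r" unfolding distrib_left by linarith
  qed (use c n s r B in \<open>auto intro!: mult_pos_pos add_pos_pos\<close>)
  finally show ?thesis unfolding eq[unfolded z_def] B_def c_def by simp
qed

lemma heat_laplace_tilted:
  assumes "r > 0"
  shows "norm (heat_laplace 1 \<kappa> d \<epsilon> r) \<le> norm d / min (Re d) (cone / 4)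
     * (1 / rate + (LINT s:{0<..}|lborel. s powr (- (3/4)) * exp (- (rate * s)))) * resolvent_profile r"
  unfolding heat_laplace_def
proof (rule profile_integral_bound[OF rate_pos _ assms heat_ray_integrable])
  have c: "min (Re d) (cone / 4) > 0" using tilt cone by simp
  then show "0 \<le> norm d / min (Re d) (cone / 4)" by (intro divide_nonneg_pos) auto
  fix s :: real assume s: "s > 0"
  have "norm (heat 1 (ray \<epsilon> d s) r) * (exp (- (rate * s)) * norm d) \<le> 1 / min (Re d) (cone / 4) / (s + r) * (exp (- (rate * s)) * norm d)"
    by (intro mult_right_mono heat_1_tilted s assms) auto
  then show "norm (heat 1 (ray \<epsilon> d s) r * exp (\<kappa> * d * of_real s) * d) \<le> norm d / min (Re d) (cone / 4) / (s + r) * exp (- (rate * s))"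
    unfolding norm_mult norm_exp_ray by (simp add: mult_ac)
qed

lemma primitive_laplace_tilted:
  assumes r: "r > 0"
  shows "r * norm (primitive_laplace r) \<le> 32 * (2 + 1 / cone) / min 1 (Re d) * norm d
     * (1 / rate + (LINT s:{0<..}|lborel. s powr (- (3/4)) * exp (- (rate * s)))) * resolvent_profile r"
proof -
  have "r * norm (primitive_laplace r) = norm (of_real r * primitive_laplace r)" using r by (simp add: norm_mult)
  also have "of_real r * primitive_laplace r = (LINT s:{0<..}|lborel. of_real r * (heat_primitive (ray \<epsilon> d s) r * exp (\<kappa> * d * of_real s) * d))"
    by (simp add: primitive_laplace_def)
  also have "norm \<dots> \<le> 32 * (2 + 1 / cone) / min 1 (Re d) * norm d
     * (1 / rate + (LINT s:{0<..}|lborel. s powr (- (3/4)) * exp (- (rate * s)))) * resolvent_profile r"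
  proof (rule profile_integral_bound[OF rate_pos _ r])
    show "set_integrable lborel {0<..} (\<lambda>s. of_real r * (heat_primitive (ray \<epsilon> d s) r * exp (\<kappa> * d * of_real s) * d))"
      by (intro set_integrable_mult_right primitive_integrable)
    have c: "min 1 (Re d) > 0" using tilt by simp
    then show "0 \<le> 32 * (2 + 1 / cone) / min 1 (Re d) * norm d" using cone by (intro mult_nonneg_nonneg divide_nonneg_pos) auto
    fix s :: real assume s: "s > 0"
    have "(r * norm (heat_primitive (ray \<epsilon> d s) r)) * (exp (- (rate * s)) * norm d) \<le> 32 * (2 + 1 / cone) / min 1 (Re d) / (s + r) * (exp (- (rate * s)) * norm d)"
      by (intro mult_right_mono heat_primitive_tilted s r) auto
    then show "norm (of_real r * (heat_primitive (ray \<epsilon> d s) r * exp (\<kappa> * d * of_real s) * d)) \<le> 32 * (2 + 1 / cone) / min 1 (Re d) * norm d / (s + r) * exp (- (rate * s))"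
      unfolding norm_mult norm_exp_ray norm_of_real abs_of_pos[OF r] by (simp add: mult_ac)
  qed
  finally show ?thesis .
qed

end

lemma tilted_bound:
  assumes d: "Re d > 0" and kd: "Re (\<kappa> * d) < 0"
  obtains C where "C \<ge> 0"
    "\<And>\<epsilon> r. \<epsilon> > 0 \<Longrightarrow> r > 0 \<Longrightarrow> norm (heat_laplace 1 \<kappa> d \<epsilon> r) \<le> C * resolvent_profile r"
    "\<And>\<epsilon> r. \<epsilon> > 0 \<Longrightarrow> r > 0 \<Longrightarrow> r * norm (laplace_ray.primitive_laplace \<kappa> d \<epsilon> r) \<le> C * resolvent_profile r"
proof -
  define cn where "cn = Re d / norm d"
  define rt where "rt = - Re (\<kappa> * d)"
  define J where "J = 1 / rt + (LINT s:{0<..}|lborel. s powr (- (3/4)) * exp (- (rt * s)))"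
  define C1 where "C1 = norm d / min (Re d) (cn / 4) * J"
  define C2 where "C2 = 32 * (2 + 1 / cn) / min 1 (Re d) * norm d * J"
  have pr: "0 \<le> resolvent_profile r" if "r > 0" for r using that by (simp add: resolvent_profile_def)
  have b: "norm (heat_laplace 1 \<kappa> d \<epsilon> r) \<le> max 0 (max C1 C2) * resolvent_profile r \<and> r * norm (laplace_ray.primitive_laplace \<kappa> d \<epsilon> r) \<le> max 0 (max C1 C2) * resolvent_profile r"
    if "\<epsilon> > 0" "r > 0" for \<epsilon> r
  proof -
    interpret tilted_ray \<kappa> d \<epsilon> using that d kd by unfold_locales auto
    have "norm (heat_laplace 1 \<kappa> d \<epsilon> r) \<le> C1 * resolvent_profile r"
      using heat_laplace_tilted[OF that(2)] unfolding C1_def J_def cn_def rt_def cone_def rate_def .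
    moreover have "r * norm (primitive_laplace r) \<le> C2 * resolvent_profile r"
      using primitive_laplace_tilted[OF that(2)] unfolding C2_def J_def cn_def rt_def cone_def rate_def .
    moreover have "C1 * resolvent_profile r \<le> max 0 (max C1 C2) * resolvent_profile r" "C2 * resolvent_profile r \<le> max 0 (max C1 C2) * resolvent_profile r"
      using pr[OF that(2)] by (auto intro!: mult_right_mono)
    ultimately show ?thesis by linarith
  qed
  show thesis by (rule that[of "max 0 (max C1 C2)"]) (use b in auto)
qed

lemma kernel_tilted_bound:
  assumes d1: "Re d1 > 0" "Re (k * d1) < 0" and d2: "Re d2 > 0" "Re (k * d2) > 0"
  obtains C where "C \<ge> 0"
    "\<And>\<epsilon> r. \<epsilon> > 0 \<Longrightarrow> r > 0 \<Longrightarrow> norm (resolvent_rays.kernel k d1 d2 \<epsilon> 0 r) \<le> C * resolvent_profile r"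
    "\<And>\<epsilon> r. \<epsilon> > 0 \<Longrightarrow> r > 0 \<Longrightarrow> r * norm (4 / k * resolvent_rays.kernel k d1 d2 \<epsilon> 2 r) \<le> C * resolvent_profile r"
proof -
  have kd2: "Re (- k * d2) < 0" using d2 by simp
  obtain C1 where C1: "C1 \<ge> 0"
    "\<And>\<epsilon> r. \<epsilon> > 0 \<Longrightarrow> r > 0 \<Longrightarrow> norm (heat_laplace 1 k d1 \<epsilon> r) \<le> C1 * resolvent_profile r"
    "\<And>\<epsilon> r. \<epsilon> > 0 \<Longrightarrow> r > 0 \<Longrightarrow> r * norm (laplace_ray.primitive_laplace k d1 \<epsilon> r) \<le> C1 * resolvent_profile r"
    using tilted_bound[OF d1] by blast
  obtain C2 where C2: "C2 \<ge> 0"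
    "\<And>\<epsilon> r. \<epsilon> > 0 \<Longrightarrow> r > 0 \<Longrightarrow> norm (heat_laplace 1 (- k) d2 \<epsilon> r) \<le> C2 * resolvent_profile r"
    "\<And>\<epsilon> r. \<epsilon> > 0 \<Longrightarrow> r > 0 \<Longrightarrow> r * norm (laplace_ray.primitive_laplace (- k) d2 \<epsilon> r) \<le> C2 * resolvent_profile r"
    using tilted_bound[OF d2(1) kd2] by blast
  have "norm (resolvent_rays.kernel k d1 d2 \<epsilon> 0 r) \<le> (C1 + C2) * resolvent_profile r \<and> r * norm (4 / k * resolvent_rays.kernel k d1 d2 \<epsilon> 2 r) \<le> (C1 + C2) * resolvent_profile r"
    if "\<epsilon> > 0" "r > 0" for \<epsilon> r
  proof -
    interpret resolvent_rays k d1 d2 \<epsilon> using that d1 d2 by unfold_locales auto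
    have "norm (kernel 0 r) \<le> C1 * resolvent_profile r + C2 * resolvent_profile r"
      unfolding kernel_0 by (intro order_trans[OF norm_triangle_ineq4] add_mono C1 C2 that)
    moreover have "r * norm (4 / k * kernel 2 r) \<le> C1 * resolvent_profile r + C2 * resolvent_profile r"
    proof -
      have "norm (4 / k * kernel 2 r) \<le> 1 * norm (plus.primitive_laplace r + minus.primitive_laplace r)"
        unfolding kernel_2[OF that(2)] norm_mult by (intro mult_right_mono) auto
      also have "\<dots> \<le> norm (plus.primitive_laplace r) + norm (minus.primitive_laplace r)" by (simp add: norm_triangle_ineq)
      finally have "r * norm (4 / k * kernel 2 r) \<le> r * (norm (plus.primitive_laplace r) + norm (minus.primitive_laplace r))"
        using that by (intro mult_left_mono) auto
      then show ?thesis using C1(3)[OF that] C2(3)[OF that] unfolding distrib_left by linarith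
    qed
    ultimately show ?thesis by (simp add: distrib_right)
  qed
  then show thesis using C1(1) C2(1) by (intro that[of "C1 + C2"]) auto
qed

text \<open>The arithmetic-geometric mean inequality if both coordinates are small; otherwise \<open>r\<^sup>-\<^sup>2\<close> is dominated by the large
  coordinates alone.\<close>

lemma profile_product_bound:
  fixes a b :: real
  defines "H \<equiv> \<lambda>t::real. if \<bar>t\<bar> \<le> 1 then \<bar>t\<bar> powr (- (1/2)) else 1 / t\<^sup>2"
  assumes "a \<noteq> 0" "b \<noteq> 0"
  shows "(resolvent_profile (a\<^sup>2 + b\<^sup>2))\<^sup>2 \<le> H a * H b"
proof -
  define r where "r = a\<^sup>2 + b\<^sup>2"
  have r: "r > 0" "a\<^sup>2 \<le> r" "b\<^sup>2 \<le> r" using assms by (auto simp: r_def add_pos_pos)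
  have m: "0 \<le> resolvent_profile r" using r by (simp add: resolvent_profile_def)
  have p1: "(resolvent_profile r)\<^sup>2 \<le> r powr (- (1/2))"
  proof -
    have "(resolvent_profile r)\<^sup>2 \<le> (r powr (- (1/4)))\<^sup>2" using m by (intro power_mono) (auto simp: resolvent_profile_def)
    also have "\<dots> = r powr (- (1/2))" by (simp add: power2_eq_square powr_add[symmetric])
    finally show ?thesis .
  qed
  have p2: "(resolvent_profile r)\<^sup>2 \<le> 1 / r\<^sup>2"
  proof -
    have "(resolvent_profile r)\<^sup>2 \<le> (1 / r)\<^sup>2" using m by (intro power_mono) (auto simp: resolvent_profile_def)
    then show ?thesis by (simp add: power_divide)
  qed
  have big: "1 / r\<^sup>2 \<le> 1 / t\<^sup>2" if "t\<^sup>2 \<le> r" "\<bar>t\<bar> > 1" for t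
  proof -
    have "1 \<le> t\<^sup>2" using that(2) one_le_power[of "\<bar>t\<bar>" 2] by simp
    then have "t\<^sup>2 * 1 \<le> r * r" using that(1) by (intro mult_mono) auto
    moreover have "0 < t\<^sup>2" using that by (auto simp: zero_less_power2)
    ultimately show ?thesis using r(1) by (intro divide_left_mono mult_pos_pos) (auto simp: power2_eq_square)
  qed
  have H1: "H t \<ge> 1" if "\<bar>t\<bar> \<le> 1" "t \<noteq> 0" for t
  proof -
    have "\<bar>t\<bar> powr (1/2) \<le> 1" using that by (simp add: powr_le1)
    then show ?thesis using that by (simp add: H_def powr_minus_divide)
  qed
  consider "\<bar>a\<bar> \<le> 1" "\<bar>b\<bar> \<le> 1" | "\<bar>a\<bar> > 1" "\<bar>b\<bar> \<le> 1" | "\<bar>a\<bar> \<le> 1" "\<bar>b\<bar> > 1" | "\<bar>a\<bar> > 1" "\<bar>b\<bar> > 1" by linarith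
  then have "(resolvent_profile r)\<^sup>2 \<le> H a * H b"
  proof cases
    case 1
    have "\<bar>a\<bar> * \<bar>b\<bar> + \<bar>a\<bar> * \<bar>b\<bar> \<le> r" using sum_squares_bound[of "\<bar>a\<bar>" "\<bar>b\<bar>"] by (simp add: r_def)
    then have "\<bar>a\<bar> * \<bar>b\<bar> \<le> r" using mult_nonneg_nonneg[of "\<bar>a\<bar>" "\<bar>b\<bar>"] by linarith
    then have "r powr (- (1/2)) \<le> (\<bar>a\<bar> * \<bar>b\<bar>) powr (- (1/2))" using assms by (intro powr_mono2') auto
    also have "\<dots> = H a * H b" using 1 by (simp add: H_def powr_mult)
    finally show ?thesis using p1 by linarith
  next
    case 2
    have "(resolvent_profile r)\<^sup>2 \<le> H a * 1" using p2 big[OF r(2) 2(1)] 2 by (simp add: H_def)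
    also have "\<dots> \<le> H a * H b" using H1[OF 2(2) assms(3)] 2 by (intro mult_left_mono) (auto simp: H_def)
    finally show ?thesis .
  next
    case 3
    have "(resolvent_profile r)\<^sup>2 \<le> 1 * H b" using p2 big[OF r(3) 3(2)] 3 by (simp add: H_def)
    also have "\<dots> \<le> H a * H b" using H1[OF 3(1) assms(2)] 3 by (intro mult_right_mono) (auto simp: H_def)
    finally show ?thesis .
  next
    case 4
    have "a\<^sup>2 * b\<^sup>2 \<le> r\<^sup>2" unfolding power2_eq_square[of r] using r by (intro mult_mono) auto
    moreover have "0 < a\<^sup>2" "0 < b\<^sup>2" "0 < r\<^sup>2" using assms r(1) by auto
    ultimately have "1 / r\<^sup>2 \<le> 1 / (a\<^sup>2 * b\<^sup>2)" by (intro divide_left_mono mult_pos_pos) auto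
    then show ?thesis using 4 p2 by (simp add: H_def)
  qed
  then show ?thesis by (simp add: r_def)
qed

lemma profile_L2: "(\<lambda>y. complex_of_real (resolvent_profile (sqdist x y))) \<in> (L2 :: (real^2 \<Rightarrow> complex) set)"
proof -
  define H where "H t = (if \<bar>t\<bar> \<le> 1 then \<bar>t\<bar> powr (- (1/2)) else 1 / t\<^sup>2)" for t :: real
  have Hm[measurable]: "H \<in> borel_measurable borel" unfolding H_def by measurable
  have H0: "H t \<ge> 0" for t by (simp add: H_def)
  have "(\<integral>\<^sup>+ t. ennreal (H t) * indicator {0..} t \<partial>lborel)
     \<le> (\<integral>\<^sup>+ t. ennreal (t powr (- (1/2))) * indicator {0..1} t + ennreal (1 / t\<^sup>2) * indicator {1..} t \<partial>lborel)"
    by (intro nn_integral_mono) (auto simp: H_def indicator_def)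
  also have "\<dots> = (\<integral>\<^sup>+ t. ennreal (t powr (- (1/2))) * indicator {0..1} t \<partial>lborel) + (\<integral>\<^sup>+ t. ennreal (1 / t\<^sup>2) * indicator {1..} t \<partial>lborel)"
    by (rule nn_integral_add) measurable
  also have "(\<integral>\<^sup>+ t. ennreal (t powr (- (1/2))) * indicator {0..1} t \<partial>lborel) = ennreal (1 powr (- (1/2) + 1) / (- (1/2) + 1))"
    by (rule nn_integral_has_integral_lebesgue'[OF _ has_integral_powr_from_0]) auto
  also have "(\<integral>\<^sup>+ t. ennreal (1 / t\<^sup>2) * indicator {1..} t \<partial>lborel) = ennreal (0 - (- 1 / 1))"
  proof (rule nn_integral_FTC_atLeast[where F = "\<lambda>s. - 1 / s" and T = 0])
    show "((\<lambda>s. - 1 / s) has_real_derivative 1 / s\<^sup>2) (at s)" if "s \<ge> 1" for s :: real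
      using that by (auto intro!: derivative_eq_intros simp: power2_eq_square)
    show "((\<lambda>s::real. - 1 / s) \<longlongrightarrow> 0) at_top"
      using tendsto_minus[OF tendsto_inverse_0_at_top[OF filterlim_ident]] by (simp add: inverse_eq_divide)
  qed auto
  finally have fin: "(\<integral>\<^sup>+ t. ennreal (H t) * indicator {0..} t \<partial>lborel) < \<infinity>" by (auto elim!: le_less_trans)
  have ev: "H (- t) = H t" for t by (simp add: H_def)
  have ne: "AE y in lborel. (y :: real^2) $ i \<noteq> x $ i" for i
  proof -
    have "negligible {y :: real^2. axis i 1 \<bullet> y = x $ i}" by (rule negligible_hyperplane) (simp add: axis_eq_0_iff)
    then have "negligible {y :: real^2. y $ i = x $ i}" by (simp add: inner_axis')
    then have "AE y in lebesgue. (y :: real^2) $ i \<noteq> x $ i"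
      by (intro AE_I'[of "{y. y $ i = x $ i}"]) (auto simp: negligible_iff_null_sets)
    then show ?thesis by (simp add: AE_completion_iff)
  qed
  show ?thesis
  proof (rule L2_of_product_bound[where h = "\<lambda>i t. H (t - x $ i)" and C = 1])
    have "(\<lambda>y::real^2. sqdist x y) \<in> borel_measurable borel"
      unfolding sqdist_def by (intro borel_measurable_continuous_onI continuous_intros)
    then show "(\<lambda>y::real^2. resolvent_profile (sqdist x y)) \<in> borel_measurable borel"
      unfolding resolvent_profile_def by measurable
    show "(\<integral>\<^sup>+ t. ennreal (H (t - x $ i)) \<partial>lborel) < \<infinity>" for i
      by (rule nn_integral_even_finite[OF Hm ev fin])
    show "AE y in lborel. (resolvent_profile (sqdist x y))\<^sup>2 \<le> 1 * (H (y $ 1 - x $ 1) * H (y $ 2 - x $ 2))"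
      using ne[of 1] ne[of 2]
    proof eventually_elim
      case (elim y)
      then show ?case unfolding sqdist_2 using profile_product_bound[of "y $ 1 - x $ 1" "y $ 2 - x $ 2"] unfolding H_def by simp
    qed
  qed (auto simp: H0)
qed

section \<open>Gaussian averages determine a function\<close>

definition gauss :: "real^2 \<Rightarrow> real" where "gauss z = exp (- (z \<bullet> z) / 4)"

lemma gauss_pos: "gauss z > 0" by (simp add: gauss_def)

lemma gauss_borel [measurable]: "gauss \<in> borel_measurable borel"
  unfolding gauss_def by (intro borel_measurable_continuous_onI continuous_intros) auto

lemma gauss_integrable: "integrable lborel gauss"
proof -
  define h where "h i t = 4 / (1 + (t - (0 :: real^2) $ i)\<^sup>2)" for i :: 2 and t
  have b: "gauss z \<le> h 1 (z $ 1) * h 2 (z $ 2)" for z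
  proof -
    have e: "exp (- t\<^sup>2 / 4) \<le> 4 / (1 + t\<^sup>2)" for t :: real
    proof -
      have "1 + t\<^sup>2 / 4 \<le> exp (t\<^sup>2 / 4)" by (rule exp_ge_add_one_self)
      then have "(1 + t\<^sup>2) / 4 \<le> exp (t\<^sup>2 / 4)" by (rule order_trans[rotated]) (simp add: add_divide_distrib)
      then have "1 / exp (t\<^sup>2 / 4) \<le> 1 / ((1 + t\<^sup>2) / 4)" by (intro divide_left_mono) (auto simp: add_pos_nonneg)
      then show ?thesis by (simp add: exp_minus inverse_eq_divide)
    qed
    have "gauss z = exp (- (z $ 1)\<^sup>2 / 4) * exp (- (z $ 2)\<^sup>2 / 4)"
      by (simp add: gauss_def inner_vec_def sum_2 power2_eq_square exp_add[symmetric] add_divide_distrib)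
    also have "\<dots> \<le> h 1 (z $ 1) * h 2 (z $ 2)" using e unfolding h_def by (intro mult_mono) auto
    finally show ?thesis .
  qed
  have fin: "(\<integral>\<^sup>+ t. ennreal (h i t) \<partial>lborel) < \<infinity>" for i
  proof -
    have "(\<integral>\<^sup>+ t. ennreal (h i t) \<partial>lborel) = (\<integral>\<^sup>+ t. 4 * ennreal (1 / (1 + (t - (0 :: real^2) $ i)\<^sup>2)) \<partial>lborel)"
    proof (rule nn_integral_cong)
      fix t
      have "h i t = 4 * (1 / (1 + (t - (0 :: real^2) $ i)\<^sup>2))" by (simp add: h_def)
      then show "ennreal (h i t) = 4 * ennreal (1 / (1 + (t - (0 :: real^2) $ i)\<^sup>2))"
        using ennreal_mult[of 4 "1 / (1 + (t - (0 :: real^2) $ i)\<^sup>2)"] by (simp del: times_divide_eq_right)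
    qed
    also have "\<dots> = 4 * (\<integral>\<^sup>+ t. ennreal (1 / (1 + (t - (0 :: real^2) $ i)\<^sup>2)) \<partial>lborel)"
      by (rule nn_integral_cmult) measurable
    also have "\<dots> < \<infinity>" using nn_integral_inverse_quadratic[of "(0 :: real^2) $ i"] by (simp add: ennreal_mult_less_top)
    finally show ?thesis .
  qed
  have "(\<integral>\<^sup>+ z. ennreal (gauss z) \<partial>lborel) \<le> (\<integral>\<^sup>+ z. ennreal (h 1 (z $ 1) * h 2 (z $ 2)) \<partial>(lborel :: (real^2) measure))"
    by (intro nn_integral_mono ennreal_leI b)
  also have "\<dots> = (\<integral>\<^sup>+ t. ennreal (h 1 t) \<partial>lborel) * (\<integral>\<^sup>+ t. ennreal (h 2 t) \<partial>lborel)"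
    by (rule nn_integral_product_2) (auto simp: h_def)
  also have "\<dots> < \<infinity>" using fin[of 1] fin[of 2] by (simp add: ennreal_mult_less_top)
  finally show ?thesis by (intro integrableI_nonneg) (auto intro: less_imp_le[OF gauss_pos])
qed

definition gauss_mass :: real where "gauss_mass = (LINT z|lborel. gauss z)"

lemma gauss_mass_pos: "gauss_mass > 0"
proof -
  have "gauss_mass \<noteq> 0"
  proof
    assume "gauss_mass = 0"
    then have "AE z in (lborel :: (real^2) measure). gauss z = 0"
      using integral_nonneg_eq_0_iff_AE[OF gauss_integrable] gauss_pos by (auto simp: gauss_mass_def less_imp_le)
    then have "AE z in (lborel :: (real^2) measure). False" by eventually_elim (metis gauss_pos less_irrefl)
    then have "emeasure (lborel :: (real^2) measure) (space lborel) = 0" using ae_filter_eq_bot_iff eventually_False by (metis trivial_limit_def)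
    then show False by simp
  qed
  moreover have "gauss_mass \<ge> 0" unfolding gauss_mass_def by (intro Bochner_Integration.integral_nonneg less_imp_le gauss_pos)
  ultimately show ?thesis by simp
qed

lemma lborel_integral_affine_2:
  fixes f :: "real^2 \<Rightarrow> real"
  assumes [measurable]: "f \<in> borel_measurable borel" and c: "c \<noteq> 0"
  shows "(LINT y|lborel. f y) = c\<^sup>2 * (LINT z|lborel. f (t + c *\<^sub>R z))"
    and "integrable lborel f \<Longrightarrow> integrable lborel (\<lambda>z. f (t + c *\<^sub>R z))"
proof -
  have D: "lborel = density (distr lborel borel (\<lambda>x. t + c *\<^sub>R x)) (\<lambda>_. ennreal (c\<^sup>2))"
    using lborel_affine[OF c, of t] by simp
  have "(LINT y|lborel. f y) = (LINT y|density (distr lborel borel (\<lambda>x. t + c *\<^sub>R x)) (\<lambda>_. ennreal (c\<^sup>2)). f y)"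
    using D by simp
  also have "\<dots> = c\<^sup>2 * (LINT z|lborel. f (t + c *\<^sub>R z))"
    by (subst integral_density) (auto simp: integral_distr)
  finally show "(LINT y|lborel. f y) = c\<^sup>2 * (LINT z|lborel. f (t + c *\<^sub>R z))" .
  assume "integrable lborel f"
  then have "integrable (density (distr lborel borel (\<lambda>x. t + c *\<^sub>R x)) (\<lambda>_. ennreal (c\<^sup>2))) f" using D by simp
  then have "integrable lborel (\<lambda>z. c\<^sup>2 * f (t + c *\<^sub>R z))"
    by (subst (asm) integrable_density) (auto simp: integrable_distr_eq)
  then show "integrable lborel (\<lambda>z. f (t + c *\<^sub>R z))" using c by simp
qed

locale square_integrable_function =
  fixes v :: "real^2 \<Rightarrow> real"
  assumes v [measurable]: "v \<in> borel_measurable borel" and v2: "integrable lborel (\<lambda>y. (v y)\<^sup>2)"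
begin

lemma product_le_squares: "\<bar>a * b\<bar> \<le> a\<^sup>2 + (b::real)\<^sup>2"
proof -
  have "2 * \<bar>a\<bar> * \<bar>b\<bar> \<le> a\<^sup>2 + b\<^sup>2" using sum_squares_bound[of "\<bar>a\<bar>" "\<bar>b\<bar>"] by simp
  moreover have "0 \<le> \<bar>a\<bar> * \<bar>b\<bar>" by simp
  ultimately show ?thesis unfolding abs_mult by linarith
qed

lemma shift_integrals:
  assumes \<eta>: "\<eta> > 0"
  shows "integrable lborel (\<lambda>x. (v (x + \<eta> *\<^sub>R z))\<^sup>2)" "(LINT x|lborel. (v (x + \<eta> *\<^sub>R z))\<^sup>2) = (LINT x|lborel. (v x)\<^sup>2)"
  using lborel_integral_affine_2[of "\<lambda>y. (v y)\<^sup>2" 1 "\<eta> *\<^sub>R z"] v2 by (auto simp: add.commute)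

text \<open>Substituting \<open>y = x + \<eta> z\<close> with \<open>\<eta>\<^sup>2 = \<epsilon>\<close> turns the average into an integral of \<open>v (x + \<eta> z)\<close> against a fixed
  Gaussian.  After integration against \<open>g\<close> and an exchange of integrals the shift falls on the
  continuous function \<open>g\<close>, and the limit \<open>\<eta> \<rightarrow> 0\<close> can be taken.\<close>

lemma smoothed_average:
  assumes g: "continuous_on UNIV g" "\<And>x. 0 \<le> g x" "\<And>x. g x \<le> 1" "\<And>x. g x \<noteq> 0 \<Longrightarrow> norm x \<le> R"
    and avg: "\<And>x \<epsilon>. 0 < \<epsilon> \<Longrightarrow> (LINT y|lborel. exp (- (sqdist x y / (4 * \<epsilon>))) / \<epsilon> * v y) \<le> N"
  shows "gauss_mass * (LINT y|lborel. g y * v y) \<le> N * (LINT y|lborel. g y)"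
proof -
  have gm [measurable]: "g \<in> borel_measurable borel" by (rule borel_measurable_continuous_onI[OF g(1)])
  have ball: "integrable lborel (indicat_real (cball (0::real^2) r))" for r
    using emeasure_bounded_finite[OF bounded_cball[of "0::real^2" r]] by (simp add: integrable_indicator_iff)
  have g_le: "g x \<le> indicat_real (cball 0 R) x" for x using g(3,4)[of x] by (cases "g x = 0") (auto simp: indicator_def)
  have gi: "integrable lborel g"
    by (rule Bochner_Integration.integrable_bound[OF ball[of R]]) (use g_le g(2) in \<open>auto intro!: AE_I2\<close>)
  have g2: "integrable lborel (\<lambda>x. (g x)\<^sup>2)"
  proof (rule Bochner_Integration.integrable_bound[OF gi])
    show "AE x in lborel. norm ((g x)\<^sup>2) \<le> norm (g x)"
      using g(2,3) by (intro AE_I2) (simp add: power2_eq_square mult_left_le)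
  qed auto
  define C where "C = (LINT x|lborel. (g x)\<^sup>2) + (LINT x|lborel. (v x)\<^sup>2)"
  have J: "integrable lborel (\<lambda>x. g x * v (x + \<eta> *\<^sub>R z))" "(LINT x|lborel. \<bar>g x * v (x + \<eta> *\<^sub>R z)\<bar>) \<le> C" if \<eta>: "\<eta> > 0" for \<eta> z
  proof -
    have s: "integrable lborel (\<lambda>x. (g x)\<^sup>2 + (v (x + \<eta> *\<^sub>R z))\<^sup>2)" using g2 shift_integrals(1)[OF \<eta>] by simp
    show i: "integrable lborel (\<lambda>x. g x * v (x + \<eta> *\<^sub>R z))"
    proof (rule Bochner_Integration.integrable_bound[OF s])
      show "AE x in lborel. norm (g x * v (x + \<eta> *\<^sub>R z)) \<le> norm ((g x)\<^sup>2 + (v (x + \<eta> *\<^sub>R z))\<^sup>2)"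
        by (intro AE_I2) (metis abs_ge_self order_trans product_le_squares real_norm_def)
    qed measurable
    have "(LINT x|lborel. \<bar>g x * v (x + \<eta> *\<^sub>R z)\<bar>) \<le> (LINT x|lborel. (g x)\<^sup>2 + (v (x + \<eta> *\<^sub>R z))\<^sup>2)"
      by (intro integral_mono integrable_abs i s product_le_squares)
    also have "\<dots> = C" unfolding C_def using g2 shift_integrals[OF \<eta>] by simp
    finally show "(LINT x|lborel. \<bar>g x * v (x + \<eta> *\<^sub>R z)\<bar>) \<le> C" .
  qed
  have step: "(LINT z|lborel. gauss z * (LINT x|lborel. g x * v (x + \<eta> *\<^sub>R z))) \<le> N * (LINT y|lborel. g y)" if \<eta>: "\<eta> > 0" for \<eta>
  proof -
    define F where "F = (\<lambda>(z, x). gauss z * (g x * v (x + \<eta> *\<^sub>R z)))"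
    have Fm: "F \<in> borel_measurable (lborel \<Otimes>\<^sub>M lborel)" unfolding F_def by measurable
    have Fi: "integrable (lborel \<Otimes>\<^sub>M lborel) F"
    proof (rule lborel_pair.Fubini_integrable[OF Fm])
      have eq: "(LINT x|lborel. norm (F (z, x))) = gauss z * (LINT x|lborel. \<bar>g x * v (x + \<eta> *\<^sub>R z)\<bar>)" for z
        using gauss_pos[of z] by (simp add: F_def abs_mult[of "gauss z"])
      show "integrable lborel (\<lambda>z. LINT x|lborel. norm (F (z, x)))"
      proof (rule Bochner_Integration.integrable_bound)
        show "integrable lborel (\<lambda>z. gauss z * C)" using gauss_integrable by simp
        show "(\<lambda>z. LINT x|lborel. norm (F (z, x))) \<in> borel_measurable lborel"
          using Fm by measurable
        show "AE z in lborel. norm (LINT x|lborel. norm (F (z, x))) \<le> norm (gauss z * C)"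
        proof (rule AE_I2)
          fix z :: "real^2"
          have "0 \<le> (LINT x|lborel. norm (F (z, x)))" by (intro Bochner_Integration.integral_nonneg) simp
          moreover have "(LINT x|lborel. norm (F (z, x))) \<le> gauss z * C"
            unfolding eq using J(2)[OF \<eta>, of z] gauss_pos[of z] by (intro mult_left_mono) auto
          ultimately show "norm (LINT x|lborel. norm (F (z, x))) \<le> norm (gauss z * C)" by simp
        qed
      qed
      show "AE z in lborel. integrable lborel (\<lambda>x. F (z, x))"
        using J(1)[OF \<eta>] by (auto simp: F_def)
    qed
    have inner: "(LINT z|lborel. F (z, x)) = g x * (LINT y|lborel. exp (- (sqdist x y / (4 * \<eta>\<^sup>2))) / \<eta>\<^sup>2 * v y)" for x
    proof -
      have "(LINT y|lborel. exp (- (sqdist x y / (4 * \<eta>\<^sup>2))) / \<eta>\<^sup>2 * v y)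
        = \<eta>\<^sup>2 * (LINT z|lborel. exp (- (sqdist x (x + \<eta> *\<^sub>R z) / (4 * \<eta>\<^sup>2))) / \<eta>\<^sup>2 * v (x + \<eta> *\<^sub>R z))"
      proof (rule lborel_integral_affine_2(1))
        have "(\<lambda>y. exp (- (sqdist x y / (4 * \<eta>\<^sup>2))) / \<eta>\<^sup>2) \<in> borel_measurable borel"
          unfolding sqdist_def using \<eta> by (intro borel_measurable_continuous_onI continuous_intros) auto
        then show "(\<lambda>y. exp (- (sqdist x y / (4 * \<eta>\<^sup>2))) / \<eta>\<^sup>2 * v y) \<in> borel_measurable borel" by measurable
      qed (use \<eta> in auto)
      also have "\<dots> = (LINT z|lborel. gauss z * v (x + \<eta> *\<^sub>R z))"
      proof -
        have "\<eta>\<^sup>2 * (exp (- (sqdist x (x + \<eta> *\<^sub>R z) / (4 * \<eta>\<^sup>2))) / \<eta>\<^sup>2 * v (x + \<eta> *\<^sub>R z)) = gauss z * v (x + \<eta> *\<^sub>R z)" for z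
          using \<eta> by (simp add: sqdist_def gauss_def power2_eq_square)
        then show ?thesis by (subst integral_mult_right_zero[symmetric]) simp
      qed
      finally have e: "(LINT y|lborel. exp (- (sqdist x y / (4 * \<eta>\<^sup>2))) / \<eta>\<^sup>2 * v y) = (LINT z|lborel. gauss z * v (x + \<eta> *\<^sub>R z))" .
      show ?thesis unfolding e by (subst integral_mult_right_zero[symmetric]) (simp add: F_def mult_ac)
    qed
    have "(LINT z|lborel. gauss z * (LINT x|lborel. g x * v (x + \<eta> *\<^sub>R z))) = (LINT z|lborel. LINT x|lborel. F (z, x))"
      by (simp add: F_def)
    also have "\<dots> = (LINT x|lborel. LINT z|lborel. F (z, x))"
      using lborel_pair.Fubini_integral[of "\<lambda>z x. F (z, x)"] Fi by simp
    also have "\<dots> \<le> (LINT x|lborel. g x * N)"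
    proof (rule integral_mono)
      show "integrable lborel (\<lambda>x. LINT z|lborel. F (z, x))"
        using lborel_pair.integrable_snd[of "\<lambda>z x. F (z, x)"] Fi by simp
      show "(LINT z|lborel. F (z, x)) \<le> g x * N" for x
        unfolding inner using avg[of "\<eta>\<^sup>2" x] \<eta> g(2) by (intro mult_left_mono) auto
    qed (use gi in auto)
    finally show ?thesis by (simp add: mult.commute)
  qed
  define c where "c n = 1 / real (Suc n)" for n
  have c: "0 < c n" "c n \<le> 1" for n by (auto simp: c_def)
  have c0: "c \<longlonglongrightarrow> 0" unfolding c_def using LIMSEQ_inverse_real_of_nat by (simp add: inverse_eq_divide)
  have Jeq: "(LINT x|lborel. g x * v (x + \<eta> *\<^sub>R z)) = (LINT y|lborel. g (y - \<eta> *\<^sub>R z) * v y)" for \<eta> z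
    using lborel_integral_affine_2(1)[of "\<lambda>y. g (y - \<eta> *\<^sub>R z) * v y" 1 "\<eta> *\<^sub>R z"] by (simp add: add.commute)
  have Jlim: "(\<lambda>n. LINT x|lborel. g x * v (x + c n *\<^sub>R z)) \<longlonglongrightarrow> (LINT y|lborel. g y * v y)" for z
    unfolding Jeq
  proof (rule integral_dominated_convergence)
    show "integrable lborel (\<lambda>y. indicat_real (cball 0 (R + norm z)) y + (v y)\<^sup>2)" using ball v2 by simp
    show "AE y in lborel. (\<lambda>n. g (y - c n *\<^sub>R z) * v y) \<longlonglongrightarrow> g y * v y"
    proof (intro AE_I2 tendsto_intros)
      fix y
      have "(\<lambda>n. y - c n *\<^sub>R z) \<longlonglongrightarrow> y - 0 *\<^sub>R z" by (intro tendsto_intros c0)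
      then show "(\<lambda>n. g (y - c n *\<^sub>R z)) \<longlonglongrightarrow> g y"
        using continuous_on_tendsto_compose[OF g(1), of "\<lambda>n. y - c n *\<^sub>R z" y sequentially] by simp
    qed
    show "AE y in lborel. norm (g (y - c n *\<^sub>R z) * v y) \<le> indicat_real (cball 0 (R + norm z)) y + (v y)\<^sup>2" for n
    proof (rule AE_I2)
      fix y
      show "norm (g (y - c n *\<^sub>R z) * v y) \<le> indicat_real (cball 0 (R + norm z)) y + (v y)\<^sup>2"
      proof (cases "g (y - c n *\<^sub>R z) = 0")
        case False
        have "norm (c n *\<^sub>R z) \<le> norm z" using c[of n] by (simp add: mult_left_le_one_le)
        then have "norm y \<le> R + norm z"
          using g(4)[OF False] norm_triangle_ineq[of "y - c n *\<^sub>R z" "c n *\<^sub>R z"] by simp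
        then have y: "indicat_real (cball 0 (R + norm z)) y = 1" by (simp add: indicator_def)
        have "norm (g (y - c n *\<^sub>R z) * v y) \<le> (g (y - c n *\<^sub>R z))\<^sup>2 + (v y)\<^sup>2"
          using product_le_squares by simp
        also have "(g (y - c n *\<^sub>R z))\<^sup>2 \<le> 1" using g(2,3) by (simp add: power_le_one)
        finally show ?thesis using y by simp
      qed simp
    qed
  qed measurable
  have "(\<lambda>n. LINT z|lborel. gauss z * (LINT x|lborel. g x * v (x + c n *\<^sub>R z))) \<longlonglongrightarrow> (LINT z|lborel. gauss z * (LINT y|lborel. g y * v y))"
  proof (rule integral_dominated_convergence)
    show "integrable lborel (\<lambda>z. gauss z * C)" using gauss_integrable by simp
    show "AE z in lborel. (\<lambda>n. gauss z * (LINT x|lborel. g x * v (x + c n *\<^sub>R z))) \<longlonglongrightarrow> gauss z * (LINT y|lborel. g y * v y)"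
      by (intro AE_I2 tendsto_intros Jlim)
    show "AE z in lborel. norm (gauss z * (LINT x|lborel. g x * v (x + c n *\<^sub>R z))) \<le> gauss z * C" for n
    proof (rule AE_I2)
      fix z :: "real^2"
      have "\<bar>LINT x|lborel. g x * v (x + c n *\<^sub>R z)\<bar> \<le> C"
        using integral_abs_bound[of lborel "\<lambda>x. g x * v (x + c n *\<^sub>R z)"] J(2)[OF c(1), of n z] by linarith
      then show "norm (gauss z * (LINT x|lborel. g x * v (x + c n *\<^sub>R z))) \<le> gauss z * C"
        using gauss_pos[of z] by (simp add: abs_mult)
    qed
  qed measurable
  then have lim: "(\<lambda>n. LINT z|lborel. gauss z * (LINT x|lborel. g x * v (x + c n *\<^sub>R z))) \<longlonglongrightarrow> gauss_mass * (LINT y|lborel. g y * v y)"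
    by (simp add: gauss_mass_def)
  show ?thesis by (rule LIMSEQ_le_const2[OF lim]) (use step c in auto)
qed

text \<open>If the bound failed on a set of positive measure, it would fail on a compact set \<open>T\<close> of positive measure.  The
  functions \<open>max 0 (1 - m dist (x, T))\<close> are admissible in \<open>smoothed_average\<close> and converge to the
  indicator of \<open>T\<close>, so the mean of \<open>gauss_mass * v\<close> over \<open>T\<close> is at most \<open>N\<close>, a contradiction.\<close>

lemma average_bound_imp_bound:
  assumes avg: "\<And>x \<epsilon>. 0 < \<epsilon> \<Longrightarrow> (LINT y|lborel. exp (- (sqdist x y / (4 * \<epsilon>))) / \<epsilon> * v y) \<le> N"
  shows "AE y in lborel. gauss_mass * v y \<le> N"
proof (rule ccontr)
  assume not: "\<not> (AE y in lborel. gauss_mass * v y \<le> N)"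
  have ball: "integrable lborel (indicat_real (cball (0::real^2) r))" for r
    using emeasure_bounded_finite[OF bounded_cball[of "0::real^2" r]] by (simp add: integrable_indicator_iff)
  define S where "S n = {y. gauss_mass * v y > N} \<inter> cball 0 (real n)" for n :: nat
  have Sm: "S n \<in> sets borel" for n unfolding S_def by measurable
  have "\<exists>n. emeasure lborel (S n) \<noteq> 0"
  proof (rule ccontr)
    assume "\<not> (\<exists>n. emeasure lborel (S n) \<noteq> 0)"
    then have "AE y in lborel. y \<notin> S n" for n
      using Sm by (intro AE_not_in) (auto simp: null_sets_def)
    then have "AE y in lborel. \<forall>n. y \<notin> S n" by (simp add: AE_all_countable)
    then have "AE y in lborel. gauss_mass * v y \<le> N"
    proof eventually_elim
      case (elim y)
      obtain n where "norm y \<le> real n" using real_arch_simple by blast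
      then show ?case using elim[rule_format, of n] by (auto simp: S_def not_less)
    qed
    then show False using not by simp
  qed
  then obtain n where n: "emeasure lborel (S n) \<noteq> 0" by blast
  obtain e where e: "e > 0" "ennreal e \<le> emeasure lborel (S n)"
  proof (cases "emeasure lborel (S n) = \<infinity>")
    case True then show thesis using that[of 1] by simp
  next
    case False
    then obtain x where "emeasure lborel (S n) = ennreal x" "x \<ge> 0" by (cases "emeasure lborel (S n)") auto
    then show thesis using that[of x] n by (auto simp: less_le)
  qed
  have "S n \<in> sets lebesgue" using Sm[of n] by simp
  from sets_lebesgue_inner_closed[OF this e(1)] obtain T where T0: "closed T" "T \<subseteq> S n" "S n - T \<in> lmeasurable" "emeasure lebesgue (S n - T) < ennreal e" .
  note T = T0(1,2,4)
  have Tm [measurable]: "T \<in> sets borel" using T(1) by simp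
  have Tpos: "emeasure lborel T \<noteq> 0"
  proof
    assume T0: "emeasure lborel T = 0"
    have "emeasure lborel (S n) \<le> emeasure lborel T + emeasure lborel (S n - T)"
      using Sm[of n] T(2) by (metis Diff_partition Tm emeasure_subadditive sets.Diff sets_lborel)
    also have "\<dots> < ennreal e" using T(3) T0 Sm[of n] by simp
    finally show False using e(2) by simp
  qed
  then have Tne: "T \<noteq> {}" by auto
  have Tb: "norm t \<le> real n" if "t \<in> T" for t using T(2) that by (auto simp: S_def)
  define g where "g m x = max 0 (1 - real (Suc m) * infdist x T)" for m and x :: "real^2"
  have g: "continuous_on UNIV (g m)" "0 \<le> g m x" "g m x \<le> 1" "g m x \<noteq> 0 \<Longrightarrow> norm x \<le> real n + 1" for m x
  proof -
    show "continuous_on UNIV (g m)" unfolding g_def by (intro continuous_intros)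
    show "0 \<le> g m x" "g m x \<le> 1" by (auto simp: g_def infdist_nonneg)
    assume "g m x \<noteq> 0"
    then have "real (Suc m) * infdist x T < 1" by (auto simp: g_def max_def split: if_splits)
    moreover have "infdist x T \<le> real (Suc m) * infdist x T" using mult_right_mono[of 1 "real (Suc m)" "infdist x T"] infdist_nonneg[of x T] by simp
    ultimately have "infdist x T < 1" by linarith
    moreover obtain t where "t \<in> T" "infdist x T = dist x t" using infdist_attains_inf[OF T(1) Tne] by blast
    ultimately show "norm x \<le> real n + 1"
      using Tb[of t] norm_triangle_ineq2[of x t] by (simp add: dist_norm)
  qed
  have glim: "(\<lambda>m. g m x) \<longlonglongrightarrow> indicat_real T x" for x
  proof (cases "x \<in> T")
    case True then show ?thesis by (simp add: g_def)
  next
    case False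
    then have d: "infdist x T > 0" using T(1) Tne in_closed_iff_infdist_zero infdist_nonneg[of x T] by (metis less_le)
    obtain M where M: "real M > 1 / infdist x T" using reals_Archimedean2 by blast
    have "g m x = 0" if "m \<ge> M" for m
    proof -
      have "1 / infdist x T < real (Suc m)" using M that by simp
      then have "1 < real (Suc m) * infdist x T" using d by (simp add: pos_divide_less_eq)
      then show ?thesis by (simp add: g_def)
    qed
    then have "\<forall>\<^sub>F m in sequentially. g m x = indicat_real T x" using False eventually_sequentially by auto
    then show ?thesis by (rule tendsto_eventually)
  qed
  have gm [measurable]: "g m \<in> borel_measurable borel" for m by (rule borel_measurable_continuous_onI[OF g(1)])
  have g_le: "g m x \<le> indicat_real (cball 0 (real n + 1)) x" for m x using g(3,4)[of m x] by (cases "g m x = 0") (auto simp: indicator_def)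
  have "(\<lambda>m. LINT y|lborel. g m y * v y) \<longlonglongrightarrow> (LINT y|lborel. indicat_real T y * v y)"
  proof (rule integral_dominated_convergence)
    show "integrable lborel (\<lambda>y. indicat_real (cball 0 (real n + 1)) y + (v y)\<^sup>2)" using ball v2 by simp
    show "AE y in lborel. norm (g m y * v y) \<le> indicat_real (cball 0 (real n + 1)) y + (v y)\<^sup>2" for m
    proof (rule AE_I2)
      fix y
      have "norm (g m y * v y) \<le> (g m y)\<^sup>2 + (v y)\<^sup>2" using product_le_squares by simp
      also have "(g m y)\<^sup>2 \<le> g m y" using g(2,3)[of m y] by (simp add: power2_eq_square mult_left_le)
      also have "g m y \<le> indicat_real (cball 0 (real n + 1)) y" by (rule g_le)
      finally show "norm (g m y * v y) \<le> indicat_real (cball 0 (real n + 1)) y + (v y)\<^sup>2" by simp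
    qed
  qed (use glim in \<open>auto intro!: tendsto_intros AE_I2\<close>)
  then have l1: "(\<lambda>m. gauss_mass * (LINT y|lborel. g m y * v y)) \<longlonglongrightarrow> gauss_mass * (LINT y|lborel. indicat_real T y * v y)"
    by (rule tendsto_mult_left)
  have "(\<lambda>m. LINT y|lborel. g m y) \<longlonglongrightarrow> (LINT y|lborel. indicat_real T y)"
    by (rule integral_dominated_convergence[where w = "indicat_real (cball 0 (real n + 1))"])
       (use glim ball g_le g(2) in \<open>auto intro!: AE_I2\<close>)
  then have l2: "(\<lambda>m. N * (LINT y|lborel. g m y)) \<longlonglongrightarrow> N * (LINT y|lborel. indicat_real T y)"
    by (rule tendsto_mult_left)
  have sm: "gauss_mass * (LINT y|lborel. g m y * v y) \<le> N * (LINT y|lborel. g m y)" for m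
    by (rule smoothed_average[OF g(1) g(2) g(3) g(4) avg])
  have le: "gauss_mass * (LINT y|lborel. indicat_real T y * v y) \<le> N * (LINT y|lborel. indicat_real T y)"
    by (rule LIMSEQ_le[OF l1 l2]) (use sm in blast)
  have iT: "integrable lborel (indicat_real T)"
    by (rule Bochner_Integration.integrable_bound[OF ball[of "real n"]]) (use Tb in \<open>auto intro!: AE_I2 simp: indicator_def\<close>)
  have ivT: "integrable lborel (\<lambda>y. indicat_real T y * v y)"
  proof (rule Bochner_Integration.integrable_bound)
    show "integrable lborel (\<lambda>y. indicat_real T y + (v y)\<^sup>2)" using iT v2 by simp
    have "\<bar>indicat_real T y * v y\<bar> \<le> indicat_real T y + (v y)\<^sup>2" for y
      using product_le_squares[of "indicat_real T y" "v y"] by (cases "y \<in> T") simp_all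
    then show "AE y in lborel. norm (indicat_real T y * v y) \<le> norm (indicat_real T y + (v y)\<^sup>2)"
      by (intro AE_I2) (metis abs_ge_self order_trans real_norm_def)
  qed measurable
  define w where "w y = gauss_mass * (indicat_real T y * v y) - N * indicat_real T y" for y
  have w0: "w y \<ge> 0" for y using T(2) by (auto simp: w_def indicator_def S_def)
  have wi: "integrable lborel w" unfolding w_def using iT ivT by simp
  have "(LINT y|lborel. w y) \<le> 0" unfolding w_def using iT ivT le by simp
  then have "(LINT y|lborel. w y) = 0" using Bochner_Integration.integral_nonneg[of lborel w] w0 by (simp add: order_antisym)
  then have "AE y in lborel. w y = 0" using integral_nonneg_eq_0_iff_AE[OF wi] w0 by simp
  then have "AE y in lborel. y \<notin> T"
    by eventually_elim (use T(2) in \<open>auto simp: w_def S_def\<close>)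
  then have "T \<in> null_sets lborel" using Tm by (simp add: AE_iff_null_sets)
  then show False using Tpos by (simp add: null_sets_def)
qed

end

section \<open>Bounds for eigenfunctions\<close>

text \<open>By scaling, its integral is \<open>gauss_mass\<close> for every \<open>\<epsilon>\<close>.\<close>

definition gauss_kernel :: "real \<Rightarrow> real^2 \<Rightarrow> real^2 \<Rightarrow> real" where
  "gauss_kernel \<epsilon> x y = exp (- (sqdist x y / (4 * \<epsilon>))) / \<epsilon>"

lemma gauss_kernel_integrable:
  fixes w :: "real^2 \<Rightarrow> complex"
  assumes "w \<in> L2" "\<epsilon> > 0"
  shows "integrable lebesgue (\<lambda>y. of_real (gauss_kernel \<epsilon> x y) * w y)"
proof (rule rapid0_integrable[OF assms(1)])
  show "continuous_on UNIV (\<lambda>y. complex_of_real (gauss_kernel \<epsilon> x y))"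
    unfolding gauss_kernel_def sqdist_def using assms(2) by (intro continuous_intros) auto
  fix y
  define t where "t = sqdist x y / (4 * \<epsilon>)"
  have t: "t \<ge> 0" using assms(2) by (simp add: t_def)
  have r: "sqdist x y = 4 * \<epsilon> * t" using assms(2) by (simp add: t_def)
  have e1: "exp (- t) * (1 + t) \<le> 1"
    using exp_ge_add_one_self[of t] t by (simp add: exp_minus field_simps)
  have "1 + 4 * \<epsilon> * t \<le> (1 + 4 * \<epsilon>) * (1 + t)" using t assms(2) by (simp add: algebra_simps)
  then have "exp (- t) * (1 + 4 * \<epsilon> * t) \<le> exp (- t) * ((1 + 4 * \<epsilon>) * (1 + t))" by (rule mult_left_mono) simp
  also have "\<dots> = (1 + 4 * \<epsilon>) * (exp (- t) * (1 + t))" by (simp only: mult_ac)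
  also have "\<dots> \<le> (1 + 4 * \<epsilon>) * 1" by (rule mult_left_mono[OF e1]) (use assms(2) in simp)
  finally have "exp (- t) * (1 + 4 * \<epsilon> * t) \<le> 1 + 4 * \<epsilon>" by simp
  then have "exp (- t) * (1 + 4 * \<epsilon> * t) / \<epsilon> \<le> (1 + 4 * \<epsilon>) / \<epsilon>" using assms(2) by (intro divide_right_mono) auto
  then show "norm (complex_of_real (gauss_kernel \<epsilon> x y)) * (1 + sqdist x y) \<le> (1 + 4 * \<epsilon>) / \<epsilon>"
    using assms(2) unfolding gauss_kernel_def t_def[symmetric] norm_of_real unfolding r by simp
qed

lemma real_part_bound:
  fixes w :: "real^2 \<Rightarrow> complex" and T :: "complex \<Rightarrow> real"
  assumes w: "w \<in> L2" and T: "bounded_linear T" "\<And>z. \<bar>T z\<bar> \<le> norm z"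
    and avg: "\<And>x \<epsilon>. 0 < \<epsilon> \<Longrightarrow> norm (LINT y|lebesgue. of_real (gauss_kernel \<epsilon> x y) * w y) \<le> N"
  shows "AE y in lebesgue. gauss_mass * T (w y) \<le> N"
proof -
  interpret T: bounded_linear T by fact
  define v where "v y = T (w y)" for y
  have vL: "v \<in> L2" unfolding v_def by (rule L2_linear[OF w T(1)])
  then have "v \<in> borel_measurable (completion lborel)" by (simp add: L2_def)
  from completion_ex_borel_measurable_real[OF this] obtain v' where v': "v' \<in> borel_measurable lborel" "AE y in lborel. v y = v' y"
    by blast
  have ae: "AE y in lebesgue. v y = v' y" using v'(2) by (rule AE_completion)
  have m: "v' \<in> borel_measurable borel" using v'(1) by simp
  have ml: "v' \<in> borel_measurable lebesgue" "v \<in> borel_measurable lebesgue"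
    using v'(1) vL by (auto simp: L2_def intro: measurable_completion)
  have i1: "integrable lebesgue (\<lambda>y. (v y)\<^sup>2)" using vL by (simp add: L2_def)
  have ae2: "AE y in lebesgue. (v y)\<^sup>2 = (v' y)\<^sup>2" using ae by eventually_elim simp
  have "integrable lebesgue (\<lambda>y. (v' y)\<^sup>2)"
    by (rule integrable_cong_AE_imp[OF i1 borel_measurable_power[OF ml(1)]]) (use ae2 in eventually_elim, simp)
  then have i: "integrable lborel (\<lambda>y. (v' y)\<^sup>2)" using m by (subst (asm) integrable_completion) auto
  interpret square_integrable_function v' using m i by unfold_locales
  have "AE y in lborel. gauss_mass * v' y \<le> N"
  proof (rule average_bound_imp_bound)
    fix x \<epsilon> assume \<epsilon>: "(0::real) < \<epsilon>"
    have km: "(\<lambda>y. gauss_kernel \<epsilon> x y) \<in> borel_measurable borel"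
      unfolding gauss_kernel_def sqdist_def using \<epsilon> by (intro borel_measurable_continuous_onI continuous_intros) auto
    have "(LINT y|lborel. gauss_kernel \<epsilon> x y * v' y) = (LINT y|lebesgue. gauss_kernel \<epsilon> x y * v' y)"
      using km m by (subst integral_completion) auto
    also have "\<dots> = (LINT y|lebesgue. gauss_kernel \<epsilon> x y * v y)"
    proof (rule integral_cong_AE)
      show "(\<lambda>y. gauss_kernel \<epsilon> x y * v' y) \<in> borel_measurable lebesgue" "(\<lambda>y. gauss_kernel \<epsilon> x y * v y) \<in> borel_measurable lebesgue"
        using borel_lebesgue[OF km] ml by auto
      show "AE y in lebesgue. gauss_kernel \<epsilon> x y * v' y = gauss_kernel \<epsilon> x y * v y" using ae by eventually_elim simp
    qed
    also have "\<dots> = (LINT y|lebesgue. T (of_real (gauss_kernel \<epsilon> x y) * w y))"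
      by (simp add: v_def T.scaleR flip: scaleR_conv_of_real)
    also have "\<dots> = T (LINT y|lebesgue. of_real (gauss_kernel \<epsilon> x y) * w y)"
      by (rule integral_bounded_linear[OF T(1) gauss_kernel_integrable[OF w \<epsilon>]])
    also have "\<dots> \<le> N" using T(2) avg[OF \<epsilon>, of x] by (meson abs_le_D1 order_trans)
    finally show "(LINT y|lborel. exp (- (sqdist x y / (4 * \<epsilon>))) / \<epsilon> * v' y) \<le> N" by (simp add: gauss_kernel_def)
  qed
  then have "AE y in lebesgue. gauss_mass * v' y \<le> N" by (rule AE_completion)
  then show ?thesis using ae by eventually_elim (simp add: v_def)
qed

text \<open>The factor two results from estimating real and imaginary parts separately.\<close>

lemma average_bound_complex:
  fixes w :: "real^2 \<Rightarrow> complex"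
  assumes w: "w \<in> L2"
    and avg: "\<And>x \<epsilon>. 0 < \<epsilon> \<Longrightarrow> norm (LINT y|lebesgue. of_real (gauss_kernel \<epsilon> x y) * w y) \<le> N"
  shows "AE y in lebesgue. norm (w y) \<le> 2 * N / gauss_mass"
proof -
  have "AE y in lebesgue. gauss_mass * Re (w y) \<le> N" "AE y in lebesgue. gauss_mass * Im (w y) \<le> N"
    "AE y in lebesgue. gauss_mass * - Re (w y) \<le> N" "AE y in lebesgue. gauss_mass * - Im (w y) \<le> N"
    by (rule real_part_bound[OF w _ _ avg];
        simp add: bounded_linear_Re bounded_linear_Im bounded_linear_minus abs_Re_le_cmod abs_Im_le_cmod)+
  then show ?thesis
  proof eventually_elim
    case (elim y)
    have "gauss_mass * \<bar>Re (w y)\<bar> \<le> N" "gauss_mass * \<bar>Im (w y)\<bar> \<le> N"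
      using elim by (auto simp: abs_if)
    moreover have "gauss_mass * norm (w y) \<le> gauss_mass * (\<bar>Re (w y)\<bar> + \<bar>Im (w y)\<bar>)"
      using cmod_le gauss_mass_pos by (intro mult_left_mono) auto
    ultimately show ?case using gauss_mass_pos by (simp add: pos_le_divide_eq distrib_left mult.commute)
  qed
qed

text \<open>The weak form of \<open>(D0 - k) u = f\<close>.  Both components of an eigenfunction lead to this situation, with
  \<open>e = - \<i>\<close> for the first and, after exchanging the components, \<open>e = \<i>\<close> for the second.\<close>

locale weak_system =
  fixes u1 u2 f1 f2 :: "real^2 \<Rightarrow> complex" and e k :: complex
  assumes L2: "u1 \<in> L2" "u2 \<in> L2" "f1 \<in> L2" "f2 \<in> L2"
    and e: "e\<^sup>2 = -1" and k: "Im k \<noteq> 0"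
    and weak1: "\<And>\<phi>. \<phi> \<in> test_functions \<Longrightarrow> (LINT x|lebesgue. wirtinger2 e \<phi> x * u2 x) = (LINT x|lebesgue. \<phi> x *\<^sub>R (k * u1 x + f1 x))"
    and weak2: "\<And>\<phi>. \<phi> \<in> test_functions \<Longrightarrow> (LINT x|lebesgue. wirtinger2 (- e) \<phi> x * u1 x) = (LINT x|lebesgue. \<phi> x *\<^sub>R (k * u2 x + f2 x))"
begin

text \<open>The representation formula in the form of an estimate.  The factor two from \<open>|q|\<^sup>2 \<le> 2 |y - x|\<^sup>2\<close> is
  compensated by the factor two in front of the heat kernel.\<close>

lemma average_by_kernel:
  assumes rays: "resolvent_rays k d1 d2 \<epsilon>"
    and m0: "\<And>r. r > 0 \<Longrightarrow> norm (resolvent_rays.kernel k d1 d2 \<epsilon> 0 r) \<le> m r"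
    and m2: "\<And>r. r > 0 \<Longrightarrow> r * norm (4 / k * resolvent_rays.kernel k d1 d2 \<epsilon> 2 r) \<le> m r"
    and i: "integrable lebesgue (\<lambda>y. m (sqdist x y) * (norm (f1 y) + norm (f2 y)))"
  shows "norm (LINT y|lebesgue. of_real (gauss_kernel \<epsilon> x y) * u1 y) \<le> (LINT y|lebesgue. m (sqdist x y) * (norm (f1 y) + norm (f2 y)))"
proof -
  interpret resolvent_rays k d1 d2 \<epsilon> by fact
  define q where "q y = complex_of_real (y $ 1 - x $ 1) + e * of_real (y $ 2 - x $ 2)" for y :: "real^2"
  define F where "F y = kernel 0 (sqdist x y) * f1 y + (q y)\<^sup>2 * (4 / k * kernel 2 (sqdist x y)) * f2 y" for y
  have gL: "(\<lambda>x. k * u1 x + f1 x) \<in> L2" "(\<lambda>x. k * u2 x + f2 x) \<in> L2"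
    using L2_add[OF L2_linear[OF L2(1) bounded_linear_mult_right[of k]] L2(3)] L2_add[OF L2_linear[OF L2(2) bounded_linear_mult_right[of k]] L2(4)] by auto
  have R: "(LINT y|lebesgue. (2 * heat 1 (of_real \<epsilon>) (sqdist x y)) * u1 y) = (LINT y|lebesgue. F y)"
    using representation[OF L2(1,2) gL e k_nz weak1 weak2 kernel_rapid, where H = "\<lambda>t. 2 * heat 1 (of_real \<epsilon>) t" and x = x] kernel_equation
    unfolding F_def q_def by simp
  have eqn: "2 * heat 1 (of_real \<epsilon>) (sqdist x y) * u1 y = 2 * (of_real (gauss_kernel \<epsilon> x y) * u1 y)" for y
    by (simp add: heat_def gauss_kernel_def exp_of_real[symmetric])
  have rep: "2 * (LINT y|lebesgue. of_real (gauss_kernel \<epsilon> x y) * u1 y) = (LINT y|lebesgue. F y)"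
    using R unfolding eqn by simp
  have ne: "norm e = 1" by (rule norm_eq_1_if_square[OF e])
  have q2: "(norm (q y))\<^sup>2 \<le> 2 * sqdist x y" for y
  proof -
    have "norm (q y) \<le> \<bar>y $ 1 - x $ 1\<bar> + \<bar>y $ 2 - x $ 2\<bar>"
      unfolding q_def using norm_triangle_ineq[of "complex_of_real (y $ 1 - x $ 1)" "e * of_real (y $ 2 - x $ 2)"]
      by (simp only: norm_mult ne norm_of_real mult_1)
    then have "(norm (q y))\<^sup>2 \<le> (\<bar>y $ 1 - x $ 1\<bar> + \<bar>y $ 2 - x $ 2\<bar>)\<^sup>2" by (rule power_mono) simp
    also have "\<dots> \<le> 2 * sqdist x y"
      using sum_squares_bound[of "\<bar>y $ 1 - x $ 1\<bar>" "\<bar>y $ 2 - x $ 2\<bar>"] unfolding sqdist_2 power2_sum by simp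
    finally show ?thesis .
  qed
  have bF: "norm (F y) \<le> 2 * (m (sqdist x y) * (norm (f1 y) + norm (f2 y)))" if "y \<noteq> x" for y
  proof -
    define r where "r = sqdist x y"
    have r: "r > 0" using that by (simp add: r_def sqdist_def)
    have m: "0 \<le> m r" using m0[OF r] norm_ge_zero order_trans by blast
    have "norm ((q y)\<^sup>2 * (4 / k * kernel 2 r)) \<le> (2 * r) * norm (4 / k * kernel 2 r)"
      unfolding norm_mult[of "(q y)\<^sup>2"] norm_power using q2[of y] by (intro mult_right_mono) (auto simp: r_def)
    also have "\<dots> \<le> 2 * m r" using m2[OF r] by simp
    finally have "norm ((q y)\<^sup>2 * (4 / k * kernel 2 r)) * norm (f2 y) \<le> 2 * m r * norm (f2 y)" by (rule mult_right_mono) simp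
    moreover have "norm (kernel 0 r) * norm (f1 y) \<le> 2 * m r * norm (f1 y)" using m0[OF r] m by (intro mult_right_mono) auto
    moreover have "norm (F y) \<le> norm (kernel 0 r) * norm (f1 y) + norm ((q y)\<^sup>2 * (4 / k * kernel 2 r)) * norm (f2 y)"
      unfolding F_def r_def norm_mult[symmetric] by (rule norm_triangle_ineq)
    ultimately show ?thesis unfolding r_def[symmetric] distrib_left by linarith
  qed
  have ae: "AE y in lebesgue. norm (F y) \<le> 2 * (m (sqdist x y) * (norm (f1 y) + norm (f2 y)))"
  proof -
    have "AE y in lborel. y \<noteq> x" by (rule AE_lborel_singleton)
    then have "AE y in lebesgue. y \<noteq> x" by (rule AE_completion)
    then show ?thesis by eventually_elim (rule bF)
  qed
  have "norm (LINT y|lebesgue. F y) \<le> (LINT y|lebesgue. 2 * (m (sqdist x y) * (norm (f1 y) + norm (f2 y))))"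
  proof (cases "integrable lebesgue F")
    case True
    have "norm (LINT y|lebesgue. F y) \<le> (LINT y|lebesgue. norm (F y))" by (rule integral_norm_bound)
    also have "\<dots> \<le> (LINT y|lebesgue. 2 * (m (sqdist x y) * (norm (f1 y) + norm (f2 y))))"
      by (rule integral_mono_AE) (use True i ae in auto)
    finally show ?thesis .
  next
    case False
    have "AE y in lebesgue. 0 \<le> 2 * (m (sqdist x y) * (norm (f1 y) + norm (f2 y)))" using ae by eventually_elim (meson norm_ge_zero order_trans)
    then show ?thesis using integral_nonneg_AE False by (simp add: not_integrable_integral_eq)
  qed
  also have "\<dots> = 2 * (LINT y|lebesgue. m (sqdist x y) * (norm (f1 y) + norm (f2 y)))" by simp
  finally have "norm (2 * (LINT y|lebesgue. of_real (gauss_kernel \<epsilon> x y) * u1 y)) \<le> 2 * (LINT y|lebesgue. m (sqdist x y) * (norm (f1 y) + norm (f2 y)))"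
    unfolding rep .
  then show ?thesis by (simp add: norm_mult)
qed

text \<open>The directions \<open>\<plusminus> \<i>\<close>, tilted slightly to the right.\<close>

lemma tilted_directions:
  obtains d1 d2 where "Re d1 > 0" "Re (k * d1) < 0" "Re d2 > 0" "Re (k * d2) > 0"
proof -
  \<comment> \<open>The tilt must satisfy \<open>|Re k| \<delta> < |Im k|\<close>, since \<open>Re (k (\<delta> \<plusminus> \<i>)) = \<delta> Re k \<mp> Im k\<close>.\<close>
  define \<delta> where "\<delta> = \<bar>Im k\<bar> / (2 * (\<bar>Re k\<bar> + 1))"
  have \<delta>: "\<delta> > 0" using k by (simp add: \<delta>_def)
  have "\<bar>Re k\<bar> * \<delta> < (\<bar>Re k\<bar> + 1) * \<delta>" using \<delta> by simp
  also have "\<dots> = \<bar>Im k\<bar> / 2"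
  proof -
    have "p * (q / (2 * p)) = q / 2" if "p > 0" for p q :: real using that by simp
    then show ?thesis unfolding \<delta>_def by (simp only: add_nonneg_pos abs_ge_zero zero_less_one)
  qed
  also have "\<dots> < \<bar>Im k\<bar>" using k by simp
  finally have "\<bar>Re k * \<delta>\<bar> < \<bar>Im k\<bar>" using \<delta> by (simp add: abs_mult)
  then have s: "Re k * \<delta> < \<bar>Im k\<bar>" "- \<bar>Im k\<bar> < Re k * \<delta>" by linarith+
  have "Im k * sgn (Im k) = \<bar>Im k\<bar>" by (simp add: mult.commute abs_sgn)
  then show thesis using \<delta> s by (intro that[of "Complex \<delta> (sgn (Im k))" "Complex \<delta> (- sgn (Im k))"]) auto
qed

lemma profile_pairing:
  fixes f :: "real^2 \<Rightarrow> complex"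
  assumes "f \<in> L2"
  shows "integrable lebesgue (\<lambda>y. resolvent_profile (sqdist x y) * norm (f y :: complex))"
    "(LINT y|lebesgue. resolvent_profile (sqdist x y) * norm (f y)) \<le> (LINT z|lborel. (resolvent_profile (sqdist 0 (z :: real^2)))\<^sup>2) + (LINT y|lebesgue. (norm (f y))\<^sup>2)"
proof -
  have pos: "0 \<le> resolvent_profile (sqdist x y)" for x y :: "real^2" by (simp add: resolvent_profile_def)
  show i: "integrable lebesgue (\<lambda>y. resolvent_profile (sqdist x y) * norm (f y))"
    using Bochner_Integration.integrable_norm[OF L2_mult_integrable[OF profile_L2[of x] assms]] pos by (simp add: norm_mult)
  have j: "integrable lebesgue (\<lambda>y. (resolvent_profile (sqdist x y))\<^sup>2)" "integrable lebesgue (\<lambda>y. (norm (f y))\<^sup>2)"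
    using profile_L2[of x] assms by (auto simp: L2_def)
  have pm: "(\<lambda>y. (resolvent_profile (sqdist x y))\<^sup>2) \<in> borel_measurable borel" for x :: "real^2"
  proof -
    have "(\<lambda>y::real^2. sqdist x y) \<in> borel_measurable borel"
      unfolding sqdist_def by (intro borel_measurable_continuous_onI continuous_intros)
    then show ?thesis unfolding resolvent_profile_def by measurable
  qed
  have "(LINT y|lebesgue. resolvent_profile (sqdist x y) * norm (f y)) \<le> (LINT y|lebesgue. (resolvent_profile (sqdist x y))\<^sup>2 + (norm (f y))\<^sup>2)"
  proof (rule integral_mono[OF i])
    show "integrable lebesgue (\<lambda>y. (resolvent_profile (sqdist x y))\<^sup>2 + (norm (f y))\<^sup>2)" using j by simp
    show "resolvent_profile (sqdist x y) * norm (f y) \<le> (resolvent_profile (sqdist x y))\<^sup>2 + (norm (f y))\<^sup>2" for y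
      using sum_squares_bound[of "resolvent_profile (sqdist x y)" "norm (f y)"] mult_nonneg_nonneg[OF pos[of x y] norm_ge_zero[of "f y"]] by linarith
  qed
  also have "\<dots> = (LINT y|lborel. (resolvent_profile (sqdist x y))\<^sup>2) + (LINT y|lebesgue. (norm (f y))\<^sup>2)"
    using j pm by (simp add: integral_completion)
  also have "(LINT y|lborel. (resolvent_profile (sqdist x y))\<^sup>2) = (LINT z|lborel. (resolvent_profile (sqdist 0 (z :: real^2)))\<^sup>2)"
    using lborel_integral_affine_2(1)[OF pm[of x], of 1 x] by (simp add: sqdist_def)
  finally show "(LINT y|lebesgue. resolvent_profile (sqdist x y) * norm (f y)) \<le> (LINT z|lborel. (resolvent_profile (sqdist 0 (z :: real^2)))\<^sup>2) + (LINT y|lebesgue. (norm (f y))\<^sup>2)" .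
qed

text \<open>The kernel of the tilted rays is square integrable, uniformly in \<open>\<epsilon>\<close> and \<open>x\<close>, and so are the data; the
  product of two square integrable functions is integrable.\<close>

lemma bounded_solution: "\<exists>B. AE y in lebesgue. norm (u1 y) \<le> B"
proof -
  obtain d1 d2 where d: "Re d1 > 0" "Re (k * d1) < 0" "Re d2 > 0" "Re (k * d2) > 0" using tilted_directions .
  obtain C where C: "C \<ge> 0"
    "\<And>\<epsilon> r. \<epsilon> > 0 \<Longrightarrow> r > 0 \<Longrightarrow> norm (resolvent_rays.kernel k d1 d2 \<epsilon> 0 r) \<le> C * resolvent_profile r"
    "\<And>\<epsilon> r. \<epsilon> > 0 \<Longrightarrow> r > 0 \<Longrightarrow> r * norm (4 / k * resolvent_rays.kernel k d1 d2 \<epsilon> 2 r) \<le> C * resolvent_profile r"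
    using kernel_tilted_bound[OF d] by blast
  define P where "P = (LINT z|lborel. (resolvent_profile (sqdist 0 (z :: real^2)))\<^sup>2)"
  define N where "N = C * ((P + (LINT y|lebesgue. (norm (f1 y))\<^sup>2)) + (P + (LINT y|lebesgue. (norm (f2 y))\<^sup>2)))"
  have "norm (LINT y|lebesgue. of_real (gauss_kernel \<epsilon> x y) * u1 y) \<le> N" if \<epsilon>: "\<epsilon> > 0" for x \<epsilon>
  proof -
    have rays: "resolvent_rays k d1 d2 \<epsilon>" using \<epsilon> d by unfold_locales auto
    have eq: "C * resolvent_profile (sqdist x y) * (norm (f1 y) + norm (f2 y)) = C * (resolvent_profile (sqdist x y) * norm (f1 y) + resolvent_profile (sqdist x y) * norm (f2 y))" for y
      by (simp add: algebra_simps)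
    have i: "integrable lebesgue (\<lambda>y. C * resolvent_profile (sqdist x y) * (norm (f1 y) + norm (f2 y)))"
      unfolding eq using profile_pairing(1)[OF L2(3)] profile_pairing(1)[OF L2(4)] by simp
    have "norm (LINT y|lebesgue. of_real (gauss_kernel \<epsilon> x y) * u1 y) \<le> (LINT y|lebesgue. C * resolvent_profile (sqdist x y) * (norm (f1 y) + norm (f2 y)))"
      by (rule average_by_kernel[OF rays C(2)[OF \<epsilon>] C(3)[OF \<epsilon>] i])
    also have "\<dots> = C * ((LINT y|lebesgue. resolvent_profile (sqdist x y) * norm (f1 y)) + (LINT y|lebesgue. resolvent_profile (sqdist x y) * norm (f2 y)))"
      unfolding eq using profile_pairing(1)[OF L2(3)] profile_pairing(1)[OF L2(4)] by simp
    also have "\<dots> \<le> N"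
      unfolding N_def P_def by (intro mult_left_mono add_mono profile_pairing(2) L2 C(1))
    finally show ?thesis .
  qed
  from average_bound_complex[OF L2(1) this] show ?thesis by blast
qed

text \<open>The constant is absolute because the bounds along imaginary times depend neither on \<open>k\<close> nor on \<open>\<epsilon>\<close>.\<close>

lemma uniform_estimate:
  assumes i: "integrable lebesgue (\<lambda>y. norm (f1 y) + norm (f2 y))"
  shows "AE y in lebesgue. norm (u1 y) \<le> 600 / gauss_mass * (LINT y|lebesgue. norm (f1 y) + norm (f2 y))"
proof -
  define d where "d = (if Im k > 0 then \<i> else - \<i>)"
  have d: "d = \<i> \<or> d = - \<i>" "Re (k * d) < 0" using k by (auto simp: d_def)
  have "norm (LINT y|lebesgue. of_real (gauss_kernel \<epsilon> x y) * u1 y) \<le> 300 * (LINT y|lebesgue. norm (f1 y) + norm (f2 y))" if \<epsilon>: "\<epsilon> > 0" for x \<epsilon>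
  proof -
    have rays: "resolvent_rays k d (- d) \<epsilon>" using \<epsilon> d by unfold_locales auto
    have "norm (resolvent_rays.kernel k d (- d) \<epsilon> 0 r) \<le> 300" "r * norm (4 / k * resolvent_rays.kernel k d (- d) \<epsilon> 2 r) \<le> 300" if "r > 0" for r
    proof -
      interpret imaginary_rays k d \<epsilon> r using \<epsilon> d that by unfold_locales auto
      show "norm (kernel 0 r) \<le> 300" "r * norm (4 / k * kernel 2 r) \<le> 300" by (rule kernel_0_bound kernel_2_bound)+
    qed
    then have "norm (LINT y|lebesgue. of_real (gauss_kernel \<epsilon> x y) * u1 y) \<le> (LINT y|lebesgue. (\<lambda>_. 300) (sqdist x y) * (norm (f1 y) + norm (f2 y)))"
      by (intro average_by_kernel[OF rays]) (simp_all only: integrable_mult_right[OF i])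
    then show ?thesis by (simp only: integral_mult_right_zero)
  qed
  from average_bound_complex[OF L2(1) this] show ?thesis by (simp only: mult_2 mult.assoc[symmetric]) (simp add: mult.commute)
qed

end

lemma matrix_vector_component_bound:
  fixes A :: "complex^2^2"
  assumes "norm (x $ 1) \<le> B" "norm (x $ 2) \<le> B"
  shows "norm ((A *v x) $ i) \<le> 2 * B * norm A"
proof -
  have a: "norm (A $ i $ j) \<le> norm A" for j
    by (rule order_trans[OF Finite_Cartesian_Product.norm_nth_le Finite_Cartesian_Product.norm_nth_le])
  have B: "B \<ge> 0" using assms(1) norm_ge_zero order_trans by blast
  have "(A *v x) $ i = A $ i $ 1 * x $ 1 + A $ i $ 2 * x $ 2" by (simp add: matrix_vector_mult_def sum_2)
  also have "norm \<dots> \<le> norm A * B + norm A * B"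
    by (intro order_trans[OF norm_triangle_ineq] add_mono) (auto simp: norm_mult intro!: mult_mono a assms)
  finally show ?thesis by simp
qed

text \<open>If the right-hand side were smaller than one, the uniform estimate applied to \<open>f = - V u\<close> would improve
  every bound \<open>B\<close> for \<open>u\<close> to \<open>\<theta> B\<close> with a fixed \<open>\<theta> < 1\<close>.  Iteration from the bound of
  \<open>bounded_solution\<close> gives \<open>u = 0\<close>.  The constant is \<open>4 \<cdot> 600\<close>: the two components of \<open>V u\<close> are each at
  most \<open>2 B |V|\<close>.\<close>

lemma eigenvalue_potential_bound:
  fixes V :: "real^2 \<Rightarrow> complex^2^2"
  assumes V: "potential V" and k: "k \<notin> \<real>" and ev: "eigenvalue (Sobolev2 2) (D V) k"
  shows "1 \<le> ennreal (2400 / gauss_mass) * (\<integral>\<^sup>+ x. ennreal (norm (V x)) \<partial>lebesgue)"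
proof (rule ccontr)
  assume "\<not> 1 \<le> ennreal (2400 / gauss_mass) * (\<integral>\<^sup>+ x. ennreal (norm (V x)) \<partial>lebesgue)"
  then have lt: "ennreal (2400 / gauss_mass) * (\<integral>\<^sup>+ x. ennreal (norm (V x)) \<partial>lebesgue) < 1" by simp
  obtain u where u: "u \<in> Sobolev2 2" "\<not> (AE x in lebesgue. u x = 0)" "AE x in lebesgue. D V u x = k *s u x"
    using ev by (auto simp: eigenvalue_def)
  have Vu: "(\<lambda>x. V x *v u x) \<in> L2" using V u(1) by (auto simp: potential_def)
  have uL: "u \<in> L2" using u(1) by (simp add: Sobolev2_def)
  have Imk: "Im k \<noteq> 0" using k complex_is_Real_iff by blast
  define f where "f i x = - (V x *v u x) $ i" for i x
  have fL: "f i \<in> L2" for i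
    using L2_linear[OF L2_vec_nth[OF Vu, of i] bounded_linear_minus[OF bounded_linear_ident]] unfolding f_def .
  note W = eigenfunction_weak[OF u(1) Vu u(3)]
  interpret s1: weak_system "\<lambda>x. u x $ 1" "\<lambda>x. u x $ 2" "f 1" "f 2" "- \<i>" k
    using uL fL Imk W by unfold_locales (auto simp: L2_vec_nth f_def)
  interpret s2: weak_system "\<lambda>x. u x $ 2" "\<lambda>x. u x $ 1" "f 2" "f 1" "\<i>" k
    using uL fL Imk W by unfold_locales (auto simp: L2_vec_nth f_def)
  have Vm: "V \<in> borel_measurable lebesgue" using V by (simp add: potential_def)
  have "(\<integral>\<^sup>+ x. ennreal (norm (V x)) \<partial>lebesgue) < \<infinity>"
    using lt gauss_mass_pos by (auto simp: ennreal_mult_less_top less_top[symmetric] ennreal_mult_eq_top_iff dest!: less_trans[OF _ ennreal_one_less_top])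
  then have Vi: "integrable lebesgue V" using Vm by (intro integrableI_bounded) auto
  then have Vn: "integrable lebesgue (\<lambda>x. norm (V x))" by (rule Bochner_Integration.integrable_norm)
  define I where "I = (LINT x|lebesgue. norm (V x))"
  have I0: "I \<ge> 0" unfolding I_def by (intro Bochner_Integration.integral_nonneg) simp
  have "(\<integral>\<^sup>+ x. ennreal (norm (V x)) \<partial>lebesgue) = ennreal I"
    unfolding I_def by (rule nn_integral_eq_integral[OF Vn]) simp
  moreover have "ennreal (2400 / gauss_mass * I) = ennreal (2400 / gauss_mass) * ennreal I"
    by (rule ennreal_mult) (use gauss_mass_pos I0 in auto)
  ultimately have "ennreal (2400 / gauss_mass * I) < 1" using lt by simp
  then have \<theta>1: "2400 / gauss_mass * I < 1" by (simp only: ennreal_less_one_iff)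
  define \<theta> where "\<theta> = 2400 / gauss_mass * I"
  have \<theta>: "0 \<le> \<theta>" "\<theta> < 1" using \<theta>1 I0 gauss_mass_pos by (auto simp: \<theta>_def)
  have contract: "AE y in lebesgue. norm (u y $ 1) \<le> \<theta> * B \<and> norm (u y $ 2) \<le> \<theta> * B"
    if B: "AE y in lebesgue. norm (u y $ 1) \<le> B \<and> norm (u y $ 2) \<le> B" for B
  proof -
    have b: "AE y in lebesgue. norm (f i y) \<le> 2 * B * norm (V y)" for i
      using B by eventually_elim (auto simp: f_def intro!: matrix_vector_component_bound)
    have fi: "integrable lebesgue (\<lambda>y. norm (f i y))" for i
    proof (rule Bochner_Integration.integrable_bound)
      show "integrable lebesgue (\<lambda>y. 2 * B * norm (V y))" using Vn by simp
      show "(\<lambda>y. norm (f i y)) \<in> borel_measurable lebesgue" using fL[of i] by (auto simp: L2_def)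
      show "AE y in lebesgue. norm (norm (f i y)) \<le> norm (2 * B * norm (V y))"
        using b[of i]
      proof eventually_elim
        case (elim y)
        then show ?case using abs_ge_self[of "2 * B * norm (V y)"] unfolding real_norm_def abs_norm_cancel by linarith
      qed
    qed
    have "(LINT y|lebesgue. norm (f i y)) \<le> 2 * B * I" for i
    proof -
      have "(LINT y|lebesgue. norm (f i y)) \<le> (LINT y|lebesgue. 2 * B * norm (V y))"
        by (rule integral_mono_AE[OF fi _ b]) (use Vn in simp)
      then show ?thesis using Vn by (simp add: I_def)
    qed
    note l1 = this
    have tot: "(LINT y|lebesgue. norm (f i y) + norm (f j y)) \<le> 4 * B * I" for i j
    proof -
      have "(LINT y|lebesgue. norm (f i y) + norm (f j y)) = (LINT y|lebesgue. norm (f i y)) + (LINT y|lebesgue. norm (f j y))"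
        by (rule Bochner_Integration.integral_add[OF fi fi])
      then show ?thesis using l1[of i] l1[of j] by linarith
    qed
    have S: "600 / gauss_mass * X \<le> \<theta> * B" if "X \<le> 4 * B * I" for X
    proof -
      have "600 / gauss_mass * X \<le> 600 / gauss_mass * (4 * B * I)" using that gauss_mass_pos by (intro mult_left_mono) auto
      then show ?thesis by (simp add: \<theta>_def mult_ac)
    qed
    have "AE y in lebesgue. norm (u y $ 1) \<le> 600 / gauss_mass * (LINT y|lebesgue. norm (f 1 y) + norm (f 2 y))"
      by (rule s1.uniform_estimate) (use fi in simp)
    moreover have "AE y in lebesgue. norm (u y $ 2) \<le> 600 / gauss_mass * (LINT y|lebesgue. norm (f 2 y) + norm (f 1 y))"
      by (rule s2.uniform_estimate) (use fi in simp)
    ultimately show ?thesis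
    proof eventually_elim
      case (elim y)
      then show ?case using S[OF tot[of 1 2]] S[OF tot[of 2 1]] by linarith
    qed
  qed
  obtain B1 B2 where "AE y in lebesgue. norm (u y $ 1) \<le> B1" "AE y in lebesgue. norm (u y $ 2) \<le> B2"
    using s1.bounded_solution s2.bounded_solution by blast
  then have B: "AE y in lebesgue. norm (u y $ 1) \<le> max B1 B2 \<and> norm (u y $ 2) \<le> max B1 B2"
    by eventually_elim auto
  have pow: "AE y in lebesgue. norm (u y $ 1) \<le> \<theta> ^ n * max B1 B2 \<and> norm (u y $ 2) \<le> \<theta> ^ n * max B1 B2" for n
    by (induction n) (use B contract in \<open>auto simp: mult.assoc\<close>)
  have "(\<lambda>n. \<theta> ^ n * max B1 B2) \<longlonglongrightarrow> 0"
    using tendsto_mult_left_zero[OF LIMSEQ_realpow_zero[OF \<theta>]] .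
  then have lim: "a \<le> 0" if "\<And>n. a \<le> \<theta> ^ n * max B1 B2" for a
    by (rule LIMSEQ_le_const) (use that in auto)
  have "AE y in lebesgue. \<forall>n. norm (u y $ 1) \<le> \<theta> ^ n * max B1 B2 \<and> norm (u y $ 2) \<le> \<theta> ^ n * max B1 B2"
    unfolding AE_all_countable using pow by blast
  then have "AE y in lebesgue. u y = 0"
  proof eventually_elim
    case (elim y)
    have "norm (u y $ 1) \<le> 0" "norm (u y $ 2) \<le> 0" by (rule lim; use elim in blast)+
    then have "u y $ i = 0" for i using exhaust_2[of i] by auto
    then show ?case by (simp add: vec_eq_iff)
  qed
  then show False using u(2) by simp
qed

theorem corollary1p1:
  "\<exists>C::real. C > 0 \<and>
     (\<forall>(V :: real^2 \<Rightarrow> complex^2^2) (k :: complex).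
        potential V \<longrightarrow> k \<notin> \<real> \<longrightarrow> eigenvalue (Sobolev2 2) (D V) k \<longrightarrow>
        ennreal C *
          (ennreal \<bar>ln (cmod k)\<bar> *
             (SUP x :: real^2. \<integral>\<^sup>+ y. indicator (ball x (inverse (2 * cmod k))) y * ennreal (norm (V y)) \<partial>lebesgue)
           + (SUP x :: real^2. \<integral>\<^sup>+ y. ennreal ((1 + \<bar>ln (dist x y)\<bar>) * norm (V y)) \<partial>lebesgue))
        + 3 * ennreal C * (\<integral>\<^sup>+ x. ennreal (norm (V x)) \<partial>lebesgue) \<ge> 1)"
proof (intro exI[of _ "2400 / gauss_mass"] conjI allI impI)
  show "2400 / gauss_mass > 0" using gauss_mass_pos by simp
  fix V :: "real^2 \<Rightarrow> complex^2^2" and k :: complex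
  assume "potential V" "k \<notin> \<real>" "eigenvalue (Sobolev2 2) (D V) k"
  from eigenvalue_potential_bound[OF this]
  have "1 \<le> ennreal (2400 / gauss_mass) * (\<integral>\<^sup>+ x. ennreal (norm (V x)) \<partial>lebesgue)" .
  also have "\<dots> \<le> 3 * (ennreal (2400 / gauss_mass) * (\<integral>\<^sup>+ x. ennreal (norm (V x)) \<partial>lebesgue))"
    using mult_right_mono[of 1 "3 :: ennreal"] by simp
  also have "\<dots> \<le> ennreal (2400 / gauss_mass) *
          (ennreal \<bar>ln (cmod k)\<bar> *
             (SUP x :: real^2. \<integral>\<^sup>+ y. indicator (ball x (inverse (2 * cmod k))) y * ennreal (norm (V y)) \<partial>lebesgue)
           + (SUP x :: real^2. \<integral>\<^sup>+ y. ennreal ((1 + \<bar>ln (dist x y)\<bar>) * norm (V y)) \<partial>lebesgue))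
        + 3 * ennreal (2400 / gauss_mass) * (\<integral>\<^sup>+ x. ennreal (norm (V x)) \<partial>lebesgue)"
    unfolding mult.assoc by (rule add_increasing) auto
  finally show "ennreal (2400 / gauss_mass) *
          (ennreal \<bar>ln (cmod k)\<bar> *
             (SUP x :: real^2. \<integral>\<^sup>+ y. indicator (ball x (inverse (2 * cmod k))) y * ennreal (norm (V y)) \<partial>lebesgue)
           + (SUP x :: real^2. \<integral>\<^sup>+ y. ennreal ((1 + \<bar>ln (dist x y)\<bar>) * norm (V y)) \<partial>lebesgue))
        + 3 * ennreal (2400 / gauss_mass) * (\<integral>\<^sup>+ x. ennreal (norm (V x)) \<partial>lebesgue) \<ge> 1" .
qed

end
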